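(* Let $\gamma>1$. For the Leray transform $\boldsymbol{L}$ on the hypersurface $M_\gamma$, the operator norm of $\boldsymbol{L}$ on $L^2(M_\gamma,\mu_d)$ is as follows in the cases listed. (a) For $\gamma=2$, $$\|\boldsymbol{L}\|_{L^2(M_2,\mu_d)}=\begin{cases}\sqrt{\tfrac{\pi}{2}(1-d)\sec\left(\tfrac{d\pi}{2}\right)}, & d\in(-1,1)\cup(1,3),\\ 1,& d=1.\end{cases}$$ (b) For $d=1$, $$\|\boldsymbol{L}\|_{L^2(M_\gamma,\mu_1)}=\begin{cases}(\gamma-1)^{\frac1\gamma-1}\sqrt{\tfrac{\pi}{4}(\gamma-2)\gamma\csc\left(\tfrac{2\pi}{\gamma}\right)}, & \gamma\in(1,2)\cup(2,\infty),\\ 1,&\gamma=2.\end{cases}$$ (c) For the pairing measure $\sigma=\mu_{\gamma-1}$, $$\|\boldsymbol{L}\|_{L^2(M_\gamma,\sigma)}=\frac{\gamma}{2\sqrt{\gamma-1}}.$$ (d) For the preferred measure $\nu=\mu_{(\gamma+1)/3}$, $$\|\boldsymbol{L}\|_{L^2(M_\gamma,\nu)}=\sqrt{\frac{\gamma}{2\sqrt{\gamma-1}}}.$$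
   Context: For $\gamma>1$ let $M_\gamma=\{(\zeta_1,\zeta_2)\in\mathbb{C}^2:\operatorname{Im}\zeta_2=|\zeta_1|^\gamma\}$, the boundary of $\Omega_\gamma=\{(z_1,z_2)\in\mathbb{C}^2:\operatorname{Im}z_2>|z_1|^\gamma\}$. Parametrize $M_\gamma$ by $(\zeta_1,\zeta_2)=(re^{i\theta},s+ir^\gamma)$ with $r\ge0$, $s\in\mathbb{R}$, $\theta\in[0,2\pi)$. For $d\in\mathbb{R}$ let $\mu_d$ be the measure $r^d\,dr\,d\theta\,ds$ on $M_\gamma$. The pairing measure is $\sigma=r^{\gamma-1}\,dr\,d\theta\,ds$ and the preferred measure is $\nu=r^{(\gamma+1)/3}\,dr\,d\theta\,ds$. The Leray transform of a function $f$ on $M_\gamma$ is the holomorphic function on $\Omega_\gamma$ $$\boldsymbol{L}f(z)=\int_{\zeta\in M_\gamma}f(\zeta)\,\frac{1}{(2\pi i)^2}\frac{\partial\rho(\zeta)\wedge\bar\partial\partial\rho(\zeta)}{\langle\partial\rho(\zeta),\zeta-z\rangle^2},$$ where $\rho$ is a defining function (the formula does not depend on the choice; e.g. $\rho(\zeta)=|\zeta_1|^\gamma-\operatorname{Im}\zeta_2$) and $\langle\cdot,\cdot\rangle$ is the bilinear pairing of $(1,0)$-forms and vectors. In the parametrization $(\zeta_1,\zeta_2)=(re^{i\theta},s+ir^\gamma)$ of $M_\gamma$, $$\boldsymbol{L}f(z)=\frac{\gamma^2}{16\pi^2}\int_{\mathbb{R}}\int_0^{2\pi}\int_0^\infty\frac{f(r,\theta,s)\,r^{\gamma-1}\,dr\,d\theta\,ds}{\left[\tfrac{\gamma}{2}\left(r^\gamma-r^{\gamma-1}e^{-i\theta}z_1\right)+\tfrac{i}{2}\left(s+ir^\gamma-z_2\right)\right]^2}.$$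 As an operator on $L^2(M_\gamma,\mu_d)$, $\boldsymbol{L}f$ denotes the boundary function $z\mapsto\lim_{\varepsilon\to0^+}\boldsymbol{L}f(z_1,z_2+i\varepsilon)$, $z\in M_\gamma$; it is defined first for $f$ smooth with compact support in $\{r>0\}\subset M_\gamma$, its norm is the supremum of $\|\boldsymbol{L}f\|/\|f\|$ over such nonzero $f$, and when this is finite $\boldsymbol{L}$ is extended by density to a bounded operator on $L^2(M_\gamma,\mu_d)$. *)

theory Defs
  imports "HOL-Analysis.Analysis"
begin

section \<open>The hypersurface and its measures\<close>

definition Mgam :: "real \<Rightarrow> (complex \<times> complex) set" where
  "Mgam \<gamma> = {\<zeta>. Im (snd \<zeta>) = cmod (fst \<zeta>) powr \<gamma>}"

text \<open>The locus \<open>r = 0\<close> is left out of the parameter domain: it is a null set,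
  and the parametrization is not an immersion there.\<close>

definition pdom :: "(real \<times> real \<times> real) set" where
  "pdom = {(r, \<theta>, s). 0 < r \<and> 0 \<le> \<theta> \<and> \<theta> < 2 * pi}"

definition par :: "real \<Rightarrow> real \<times> real \<times> real \<Rightarrow> complex \<times> complex" where
  "par \<gamma> = (\<lambda>(r, \<theta>, s). (of_real r * cis \<theta>, Complex s (r powr \<gamma>)))"

text \<open>\<open>\<mu>\<^sub>d = r\<^sup>d dr d\<theta> ds\<close>, realized as a Borel measure on \<open>\<complex>\<^sup>2\<close> concentrated on \<open>M\<^sub>\<gamma>\<close>.\<close>

definition mu :: "real \<Rightarrow> real \<Rightarrow> (complex \<times> complex) measure" where
  "mu \<gamma> d = distr (density lborel (\<lambda>p. ennreal (fst p powr d) * indicator pdom p)) borel (par \<gamma>)"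

definition pairing_measure :: "real \<Rightarrow> (complex \<times> complex) measure" where
  "pairing_measure \<gamma> = mu \<gamma> (\<gamma> - 1)"

definition preferred_measure :: "real \<Rightarrow> (complex \<times> complex) measure" where
  "preferred_measure \<gamma> = mu \<gamma> ((\<gamma> + 1) / 3)"


section \<open>Complex differential forms on \<open>\<complex>\<^sup>2\<close>\<close>

text \<open>A \<open>k\<close>-form at a point is represented by its values on \<open>k\<close> real tangent vectors, with the
  normalization \<open>(\<alpha> \<and> \<beta>)(u,v) = \<alpha>(u) \<beta>(v) - \<alpha>(v) \<beta>(u)\<close> for 1-forms.
  \<open>mulI\<close> is the complex structure; \<open>del g\<close> and \<open>delbar g\<close> are the complex linear and the
  complex antilinear parts of the real differential \<open>dg\<close>.\<close>

definition mulI :: "complex \<times> complex \<Rightarrow> complex \<times> complex" where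
  "mulI v = (\<i> * fst v, \<i> * snd v)"

definition del :: "(complex \<times> complex \<Rightarrow> complex) \<Rightarrow> complex \<times> complex \<Rightarrow> complex \<times> complex \<Rightarrow> complex"
  where "del g \<zeta> v =
    (frechet_derivative g (at \<zeta>) v - \<i> * frechet_derivative g (at \<zeta>) (mulI v)) / 2"

definition delbar :: "(complex \<times> complex \<Rightarrow> complex) \<Rightarrow> complex \<times> complex \<Rightarrow> complex \<times> complex \<Rightarrow> complex"
  where "delbar g \<zeta> v =
    (frechet_derivative g (at \<zeta>) v + \<i> * frechet_derivative g (at \<zeta>) (mulI v)) / 2"

text \<open>For a \<open>(1,0)\<close>-form \<open>\<omega> = \<Sum>\<^sub>j \<omega>\<^sub>j d\<zeta>\<^sub>j\<close> this is \<open>\<Sum>\<^sub>j \<partial>bar \<omega>\<^sub>j \<and> d\<zeta>\<^sub>j\<close>.\<close>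

definition delbar_form ::
  "(complex \<times> complex \<Rightarrow> complex \<times> complex \<Rightarrow> complex) \<Rightarrow> complex \<times> complex
    \<Rightarrow> complex \<times> complex \<Rightarrow> complex \<times> complex \<Rightarrow> complex"
  where "delbar_form \<omega> \<zeta> u v = delbar (\<lambda>\<xi>. \<omega> \<xi> v) \<zeta> u - delbar (\<lambda>\<xi>. \<omega> \<xi> u) \<zeta> v"

definition wedge12 :: "('v \<Rightarrow> complex) \<Rightarrow> ('v \<Rightarrow> 'v \<Rightarrow> complex) \<Rightarrow> 'v \<Rightarrow> 'v \<Rightarrow> 'v \<Rightarrow> complex" where
  "wedge12 \<alpha> \<beta> u v w = \<alpha> u * \<beta> v w - \<alpha> v * \<beta> u w + \<alpha> w * \<beta> u v"


section \<open>The Leray transform\<close>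

definition rho :: "real \<Rightarrow> complex \<times> complex \<Rightarrow> complex" where
  "rho \<gamma> \<zeta> = of_real (cmod (fst \<zeta>) powr \<gamma> - Im (snd \<zeta>))"

text \<open>The coefficient of \<open>dr \<and> d\<theta> \<and> ds\<close> in the pullback of \<open>\<partial>\<rho> \<and> \<partial>bar\<partial>\<rho>\<close> under the
  parametrization; \<open>M\<^sub>\<gamma>\<close> is oriented by \<open>dr \<and> d\<theta> \<and> ds\<close>.\<close>

definition leray_form :: "real \<Rightarrow> real \<times> real \<times> real \<Rightarrow> complex" where
  "leray_form \<gamma> p =
    wedge12 (del (rho \<gamma>) (par \<gamma> p)) (delbar_form (del (rho \<gamma>)) (par \<gamma> p))
      (frechet_derivative (par \<gamma>) (at p) (1, 0, 0))
      (frechet_derivative (par \<gamma>) (at p) (0, 1, 0))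
      (frechet_derivative (par \<gamma>) (at p) (0, 0, 1))"

definition leray :: "real \<Rightarrow> (complex \<times> complex \<Rightarrow> complex) \<Rightarrow> complex \<times> complex \<Rightarrow> complex" where
  "leray \<gamma> f z =
    (LINT p:pdom|lborel.
       f (par \<gamma> p) * (1 / (2 * of_real pi * \<i>)\<^sup>2 * leray_form \<gamma> p /
         (del (rho \<gamma>) (par \<gamma> p) (par \<gamma> p - z))\<^sup>2))"

text \<open>The boundary function; only its values at \<open>z \<in> M\<^sub>\<gamma>\<close> matter.\<close>

definition leray_bd :: "real \<Rightarrow> (complex \<times> complex \<Rightarrow> complex) \<Rightarrow> complex \<times> complex \<Rightarrow> complex" where
  "leray_bd \<gamma> f z = Lim (at_right 0) (\<lambda>\<epsilon>. leray \<gamma> f (fst z, snd z + \<i> * of_real \<epsilon>))"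


section \<open>Test functions and the operator norm\<close>

primrec Ck_on :: "nat \<Rightarrow> 'a::real_normed_vector set \<Rightarrow> ('a \<Rightarrow> 'b::real_normed_vector) \<Rightarrow> bool" where
  "Ck_on 0 S f \<longleftrightarrow> continuous_on S f"
| "Ck_on (Suc k) S f \<longleftrightarrow>
     (\<forall>x\<in>S. f differentiable (at x)) \<and> (\<forall>v. Ck_on k S (\<lambda>x. frechet_derivative f (at x) v))"

text \<open>Smooth functions with compact support in \<open>M\<^sub>\<gamma> \<inter> {\<zeta>\<^sub>1 \<noteq> 0}\<close>. Smoothness is expressed in the
  global chart \<open>(w, s) \<mapsto> (w, s + i |w|\<^sup>\<gamma>)\<close>, which over \<open>w \<noteq> 0\<close> is a smooth embedding onto
  that part of the hypersurface. Values off \<open>M\<^sub>\<gamma>\<close> are irrelevant throughout.\<close>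

definition test_fun :: "real \<Rightarrow> (complex \<times> complex \<Rightarrow> complex) \<Rightarrow> bool" where
  "test_fun \<gamma> f \<longleftrightarrow>
    (\<forall>k. Ck_on k {(w, s). w \<noteq> 0}
       (\<lambda>(w :: complex, s :: real). f (w, Complex s (cmod w powr \<gamma>)))) \<and>
    (\<exists>K. compact K \<and> K \<subseteq> Mgam \<gamma> \<inter> {\<zeta>. fst \<zeta> \<noteq> 0} \<and> (\<forall>\<zeta> \<in> Mgam \<gamma> - K. f \<zeta> = 0))"

definition L2norm :: "'a measure \<Rightarrow> ('a \<Rightarrow> complex) \<Rightarrow> ennreal" where
  "L2norm M f =
    (let I = (\<integral>\<^sup>+ x. ennreal ((cmod (f x))\<^sup>2) \<partial>M)
     in if I = \<infinity> then \<infinity> else ennreal (sqrt (enn2real I)))"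

definition leray_opnorm :: "real \<Rightarrow> (complex \<times> complex) measure \<Rightarrow> ennreal" where
  "leray_opnorm \<gamma> M =
    (SUP f \<in> {f. test_fun \<gamma> f \<and> (\<exists>\<zeta>\<in>Mgam \<gamma>. f \<zeta> \<noteq> 0)}. L2norm M (leray_bd \<gamma> f) / L2norm M f)"


section \<open>The Leray transform in the parametrization\<close>

lemma par_measurable: "par \<gamma> \<in> borel_measurable borel"
proof -
  have q: "(\<lambda>p::real\<times>real\<times>real. fst p powr \<gamma>) \<in> borel_measurable borel"
    by (rule powr_real_measurable)
       (auto intro!: borel_measurable_continuous_onI continuous_intros)
  have q1: "(\<lambda>p::real\<times>real\<times>real. complex_of_real (fst p) * cis (fst (snd p))) \<in> borel_measurable borel"
    unfolding cis_conv_exp by (intro borel_measurable_continuous_onI continuous_intros)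
  have q2: "(\<lambda>p::real\<times>real\<times>real. complex_of_real (snd (snd p))) \<in> borel_measurable borel"
    by (intro borel_measurable_continuous_onI continuous_intros)
  have "(\<lambda>p::real\<times>real\<times>real. (complex_of_real (fst p) * cis (fst (snd p)),
      complex_of_real (snd (snd p)) + \<i> * complex_of_real (fst p powr \<gamma>))) \<in> borel_measurable borel"
    by (rule borel_measurable_Pair[OF q1 borel_measurable_add[OF q2 borel_measurable_times[OF
        borel_measurable_const measurable_compose[OF q borel_measurable_of_real]]]])
  moreover have "par \<gamma> = (\<lambda>p. (complex_of_real (fst p) * cis (fst (snd p)),
      complex_of_real (snd (snd p)) + \<i> * complex_of_real (fst p powr \<gamma>)))"
    by (auto simp: par_def fun_eq_iff complex_eq_iff)
  ultimately show ?thesis by simp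
qed

lemma has_derivative_norm_powr:
  assumes "fst (\<zeta> :: complex \<times> complex) \<noteq> 0"
  shows "((\<lambda>\<zeta>. cmod (fst \<zeta>) powr a) has_derivative
     (\<lambda>v. a * cmod (fst \<zeta>) powr (a - 2) * Re (cnj (fst \<zeta>) * fst v))) (at \<zeta>)"
proof -
  have n: "((\<lambda>\<zeta>::complex\<times>complex. cmod (fst \<zeta>)) has_derivative
      (\<lambda>v. inner (fst v) (sgn (fst \<zeta>)))) (at \<zeta>)"
    using has_derivative_compose[OF has_derivative_fst[OF has_derivative_ident]
        has_derivative_norm[OF assms], of UNIV] by simp
  have p: "((\<lambda>x. x powr a) has_derivative (*) (a * cmod (fst \<zeta>) powr (a - 1))) (at (cmod (fst \<zeta>)))"
    using has_real_derivative_powr[of "cmod (fst \<zeta>)" a] assms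
    by (simp add: has_field_derivative_def)
  have e: "a * cmod (fst \<zeta>) powr (a - 1) * inner (fst v) (sgn (fst \<zeta>))
      = a * cmod (fst \<zeta>) powr (a - 2) * Re (cnj (fst \<zeta>) * fst v)" for v
  proof -
    have "cmod (fst \<zeta>) powr (a - 1) = cmod (fst \<zeta>) powr (a - 2) * cmod (fst \<zeta>)"
      using assms by (simp add: powr_mult_base mult.commute)
    then show ?thesis using assms
      by (simp add: sgn_div_norm inner_complex_def field_simps)
  qed
  show ?thesis
    using has_derivative_compose[OF n p] by (simp add: e)
qed

lemma del_rho:
  assumes "fst \<zeta> \<noteq> 0"
  shows "del (rho \<gamma>) \<zeta> v =
    (of_real (\<gamma> * cmod (fst \<zeta>) powr (\<gamma> - 2)) * cnj (fst \<zeta>) * fst v + \<i> * snd v) / 2"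
proof -
  have "(rho \<gamma> has_derivative (\<lambda>v. complex_of_real
      (\<gamma> * cmod (fst \<zeta>) powr (\<gamma> - 2) * Re (cnj (fst \<zeta>) * fst v) - Im (snd v)))) (at \<zeta>)"
    unfolding rho_def
    by (intro has_derivative_of_real has_derivative_diff has_derivative_norm_powr assms
        has_derivative_Im has_derivative_snd has_derivative_ident)
  then have D: "frechet_derivative (rho \<gamma>) (at \<zeta>) = (\<lambda>v. complex_of_real
      (\<gamma> * cmod (fst \<zeta>) powr (\<gamma> - 2) * Re (cnj (fst \<zeta>) * fst v) - Im (snd v)))"
    by (rule frechet_derivative_at[symmetric])
  show ?thesis
    unfolding del_def D mulI_def
    by (simp add: complex_eq_iff algebra_simps)
qed

lemma delbar_del_rho:
  assumes "fst \<zeta> \<noteq> 0"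
  shows "delbar (\<lambda>\<xi>. del (rho \<gamma>) \<xi> v) \<zeta> u =
    of_real (\<gamma>\<^sup>2 / 4 * cmod (fst \<zeta>) powr (\<gamma> - 2)) * fst v * cnj (fst u)"
proof -
  let ?r = "cmod (fst \<zeta>)"
  let ?D = "\<lambda>u. (of_real \<gamma> * fst v / 2) *
      (of_real (?r powr (\<gamma> - 2)) * cnj (fst u) +
       of_real ((\<gamma> - 2) * ?r powr (\<gamma> - 2 - 2) * Re (cnj (fst \<zeta>) * fst u)) * cnj (fst \<zeta>))"
  have "((\<lambda>\<xi>. (of_real \<gamma> * fst v / 2) * (of_real (cmod (fst \<xi>) powr (\<gamma> - 2)) * cnj (fst \<xi>))
      + \<i> * snd v / 2) has_derivative (\<lambda>u. ?D u + 0)) (at \<zeta>)"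
    by (intro has_derivative_add has_derivative_mult_right has_derivative_mult has_derivative_of_real
        has_derivative_norm_powr assms has_derivative_cnj has_derivative_fst has_derivative_ident
        has_derivative_const)
  moreover have "open {\<xi>::complex\<times>complex. fst \<xi> \<noteq> 0}"
    by (intro open_Collect_neq continuous_intros)
  ultimately have "((\<lambda>\<xi>. del (rho \<gamma>) \<xi> v) has_derivative (\<lambda>u. ?D u + 0)) (at \<zeta>)"
    by (rule has_derivative_transform_within_open)
      (use assms in \<open>auto simp: del_rho field_simps\<close>)
  then have D: "frechet_derivative (\<lambda>\<xi>. del (rho \<gamma>) \<xi> v) (at \<zeta>) = (\<lambda>u. ?D u + 0)"
    by (rule frechet_derivative_at[symmetric])
  have r: "?r powr (\<gamma> - 2) = ?r powr (\<gamma> - 2 - 2) * ((Re (fst \<zeta>))\<^sup>2 + (Im (fst \<zeta>))\<^sup>2)"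
  proof -
    have "?r powr (\<gamma> - 2) = ?r powr (\<gamma> - 2 - 2) * ?r powr 2"
      unfolding powr_add[symmetric] by simp
    moreover have "?r powr 2 = (Re (fst \<zeta>))\<^sup>2 + (Im (fst \<zeta>))\<^sup>2"
      using assms by (simp add: cmod_power2)
    ultimately show ?thesis by simp
  qed
  define A where "A = ?r powr (\<gamma> - 2 - 2)"
  show ?thesis
    unfolding delbar_def D mulI_def r unfolding A_def[symmetric]
    by (simp add: complex_eq_iff field_simps power2_eq_square)
qed

lemma frechet_derivative_par:
  assumes "r > 0"
  shows "frechet_derivative (par \<gamma>) (at (r, \<theta>, s)) = (\<lambda>(a, b, c).
     (of_real a * cis \<theta> + of_real (r * b) * \<i> * cis \<theta>, Complex c (\<gamma> * r powr (\<gamma> - 1) * a)))"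
proof -
  have q: "((\<lambda>x. x powr \<gamma>) has_derivative (*) (\<gamma> * r powr (\<gamma> - 1))) (at r)"
    using has_real_derivative_powr[of r \<gamma>] assms by (simp add: has_field_derivative_def)
  have q': "((\<lambda>p::real\<times>real\<times>real. fst p powr \<gamma>) has_derivative
      (\<lambda>v. \<gamma> * r powr (\<gamma> - 1) * fst v)) (at (r, \<theta>, s))"
    using has_derivative_compose[OF has_derivative_fst[OF has_derivative_ident], of "\<lambda>x. x powr \<gamma>" _ "(r, \<theta>, s)" UNIV] q
    by simp
  have c: "((\<lambda>p::real\<times>real\<times>real. cis (fst (snd p))) has_derivative
      (\<lambda>v. fst (snd v) *\<^sub>R (\<i> * cis \<theta>))) (at (r, \<theta>, s))"
    by (rule has_derivative_eq_rhs, rule has_derivative_cis)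
       (auto intro!: derivative_eq_intros)
  have "((\<lambda>p. (complex_of_real (fst p) * cis (fst (snd p)),
        complex_of_real (snd (snd p)) + \<i> * complex_of_real (fst p powr \<gamma>))) has_derivative
      (\<lambda>v. (complex_of_real (fst (r, \<theta>, s)) * (fst (snd v) *\<^sub>R (\<i> * cis \<theta>)) +
            complex_of_real (fst v) * cis (fst (snd (r, \<theta>, s))),
        complex_of_real (snd (snd v)) + \<i> * complex_of_real (\<gamma> * r powr (\<gamma> - 1) * fst v))))
      (at (r, \<theta>, s))"
    by (intro has_derivative_Pair has_derivative_mult has_derivative_of_real c q'
        has_derivative_fst has_derivative_snd has_derivative_ident has_derivative_add
        has_derivative_mult_right)
  moreover have "par \<gamma> = (\<lambda>p. (complex_of_real (fst p) * cis (fst (snd p)),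
      complex_of_real (snd (snd p)) + \<i> * complex_of_real (fst p powr \<gamma>)))"
    by (auto simp: par_def fun_eq_iff complex_eq_iff)
  ultimately have "(par \<gamma> has_derivative
      (\<lambda>v. (complex_of_real r * (fst (snd v) *\<^sub>R (\<i> * cis \<theta>)) + complex_of_real (fst v) * cis \<theta>,
        complex_of_real (snd (snd v)) + \<i> * complex_of_real (\<gamma> * r powr (\<gamma> - 1) * fst v))))
      (at (r, \<theta>, s))"
    by simp
  from frechet_derivative_at[OF this, symmetric] show ?thesis
    by (auto simp: fun_eq_iff complex_eq_iff algebra_simps)
qed

lemma leray_form_eq:
  assumes "r > 0"
  shows "leray_form \<gamma> (r, \<theta>, s) = - of_real (\<gamma>\<^sup>2 / 4 * r powr (\<gamma> - 1))"
proof -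
  have nz: "fst (par \<gamma> (r, \<theta>, s)) \<noteq> 0" and n: "cmod (fst (par \<gamma> (r, \<theta>, s))) = r"
    using assms by (auto simp: par_def norm_mult)
  have r: "r powr (\<gamma> - 1) = r powr (\<gamma> - 2) * r"
    using assms by (simp add: powr_mult_base mult.commute)
  have c': "cos \<theta> * (cos \<theta> * x) = x - sin \<theta> * (sin \<theta> * x)" for x :: real
    using sin_cos_squared_add[of \<theta>] by algebra
  show ?thesis
    unfolding leray_form_def wedge12_def delbar_form_def delbar_del_rho[OF nz] del_rho[OF nz] n
      frechet_derivative_par[OF assms] r
    by (simp add: par_def complex_eq_iff algebra_simps power2_eq_square c')
qed

lemma leray_eq:
  "leray \<gamma> f z = of_real (\<gamma>\<^sup>2 / (16 * pi\<^sup>2)) *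
    (LINT (r, \<theta>, s):pdom|lborel. f (par \<gamma> (r, \<theta>, s)) * of_real (r powr (\<gamma> - 1)) /
       (of_real (\<gamma> / 2) * (of_real (r powr \<gamma>) - of_real (r powr (\<gamma> - 1)) * cis (- \<theta>) * fst z)
        + \<i> / 2 * (Complex s (r powr \<gamma>) - snd z))\<^sup>2)"
proof -
  have "f (par \<gamma> (r, \<theta>, s)) * (1 / (2 * of_real pi * \<i>)\<^sup>2 * leray_form \<gamma> (r, \<theta>, s) /
         (del (rho \<gamma>) (par \<gamma> (r, \<theta>, s)) (par \<gamma> (r, \<theta>, s) - z))\<^sup>2) =
     of_real (\<gamma>\<^sup>2 / (16 * pi\<^sup>2)) * (f (par \<gamma> (r, \<theta>, s)) * of_real (r powr (\<gamma> - 1)) /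
       (of_real (\<gamma> / 2) * (of_real (r powr \<gamma>) - of_real (r powr (\<gamma> - 1)) * cis (- \<theta>) * fst z)
        + \<i> / 2 * (Complex s (r powr \<gamma>) - snd z))\<^sup>2)" if "r > 0" for r \<theta> s
  proof -
    have nz: "fst (par \<gamma> (r, \<theta>, s)) \<noteq> 0" and n: "cmod (fst (par \<gamma> (r, \<theta>, s))) = r"
      using that by (auto simp: par_def norm_mult)
    have r: "r powr (\<gamma> - 1) = r powr (\<gamma> - 2) * r"
      using that by (simp add: powr_mult_base mult.commute)
    have r2: "r powr \<gamma> = r powr (\<gamma> - 2) * r * r"
    proof -
      have "r powr \<gamma> = r powr (\<gamma> - 2) * r powr 2" unfolding powr_add[symmetric] by simp
      moreover have "r powr 2 = r * r" using that by (simp add: power2_eq_square)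
      ultimately show ?thesis by (metis mult.assoc)
    qed
    have c: "cis (- \<theta>) * cis \<theta> = 1" by (simp add: cis_mult)
    have c2: "cis (- \<theta>) * (cis \<theta> * x) = x" for x
      using c by (metis mult.assoc mult_1)
    have c3: "cis \<theta> * (a * (b * (e * (cis (- \<theta>) * x)))) = a * (b * (e * x))" for a b e x
      using c by algebra
    have pe: "par \<gamma> (r, \<theta>, s) = (of_real r * cis \<theta>, Complex s (r powr \<gamma>))"
      by (simp add: par_def)
    have d: "del (rho \<gamma>) (par \<gamma> (r, \<theta>, s)) (par \<gamma> (r, \<theta>, s) - z) =
      of_real (\<gamma> / 2) * (of_real (r powr \<gamma>) - of_real (r powr (\<gamma> - 1)) * cis (- \<theta>) * fst z)
        + \<i> / 2 * (Complex s (r powr \<gamma>) - snd z)"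
      unfolding del_rho[OF nz] n unfolding pe r2 r
      by (simp add: cis_cnj field_simps c c2 c3)
    show ?thesis
      unfolding d leray_form_eq[OF that] by (simp add: power2_eq_square field_simps)
  qed
  then have "leray \<gamma> f z = (LINT p:pdom|lborel. of_real (\<gamma>\<^sup>2 / (16 * pi\<^sup>2)) * (case p of (r, \<theta>, s) \<Rightarrow>
      f (par \<gamma> (r, \<theta>, s)) * of_real (r powr (\<gamma> - 1)) /
       (of_real (\<gamma> / 2) * (of_real (r powr \<gamma>) - of_real (r powr (\<gamma> - 1)) * cis (- \<theta>) * fst z)
        + \<i> / 2 * (Complex s (r powr \<gamma>) - snd z))\<^sup>2))"
    unfolding leray_def set_lebesgue_integral_def
    by (intro Bochner_Integration.integral_cong) (auto simp: indicator_def pdom_def)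
  then show ?thesis by simp
qed

end

theory Submission
  imports Defs "HOL-Probability.Probability" "HOL-Real_Asymp.Real_Asymp" "HOL-Computational_Algebra.Polynomial"
begin

text \<open>
  Write a point of the hypersurface as \<open>(r, \<theta>, s)\<close> and let \<open>(\<rho>, \<phi>, t)\<close> be the point at which
  the transform is evaluated. The kernel is then \<open>\<gamma>\<^sup>2 / (4\<pi>\<^sup>2) r\<^bsup>\<gamma>-1\<^esup> / w\<^sup>2\<close> with
  \<open>w = (\<gamma>-1) r\<^sup>\<gamma> + \<rho>\<^sup>\<gamma> - \<gamma> r\<^bsup>\<gamma>-1\<^esup> \<rho> e\<^bsup>i(\<phi>-\<theta>)\<^esup> + i (s - t)\<close>, so the operator commutes
  with rotations in \<open>\<theta>\<close> and translations in \<open>s\<close> and splits over the Fourier modes of these two groups.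
  Young's inequality gives \<open>Re w \<ge> 0\<close>, and \<open>1 / w\<^sup>2\<close> is the integral of \<open>x e\<^bsup>-xw\<^esup>\<close> over
  \<open>x > 0\<close>. Hence only frequencies \<open>x > 0\<close> in \<open>s\<close> survive, and expanding the exponential of
  \<open>x \<gamma> r\<^bsup>\<gamma>-1\<^esup> \<rho> e\<^bsup>i(\<phi>-\<theta>)\<^esup>\<close> shows that only angular modes \<open>k \<ge> 0\<close> do.

  On the mode \<open>(k, x)\<close> what remains has rank one: up to the factor \<open>\<gamma>\<^sup>2 x (x\<gamma>)\<^sup>k / k!\<close>, it sends a
  function \<open>u\<close> of \<open>r\<close> to
  \<open>\<rho>\<^sup>k exp (- x \<rho>\<^sup>\<gamma>)\<close> times the integral of
  \<open>r\<^bsup>(\<gamma>-1)(k+1)\<^esup> exp (- x (\<gamma>-1) r\<^sup>\<gamma>) u(r)\<close>.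
  Its norm on \<open>L\<^sup>2(r\<^sup>d dr)\<close> is a product of two Gamma integrals. With
  \<open>\<alpha> = (2k + d + 1) / \<gamma>\<close> and \<open>\<beta> = (2(\<gamma>-1)(k+1) - d + 1) / \<gamma>\<close> one has
  \<open>\<alpha> + \<beta> = 2k + 2\<close>, so that \<open>x\<close> cancels, in accordance with the dilation symmetry of the
  hypersurface, and the square of the norm is
  \<open>(\<gamma>/2)\<^bsup>2k+2\<^esup> (\<gamma>-1)\<^bsup>-\<beta>\<^esup> \<Gamma>(\<alpha>) \<Gamma>(\<beta>) / k!\<^sup>2\<close>, the quantity \<open>mode_normsq\<close> below. For
  \<open>- 1 < d < 2\<gamma> - 1\<close> both integrals converge for every \<open>k\<close>, and the operator norm is the square root
  of the supremum of these numbers over \<open>k\<close> (\<open>leray_opnorm_eq\<close>).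

  The upper bound \<open>opnorm_upper\<close> is Plancherel's identity in \<open>t\<close> and Parseval's in \<open>\<phi>\<close> for the output,
  the Cauchy-Schwarz inequality in \<open>r\<close>, and Bessel's inequality and Plancherel's identity for the
  input. The lower bound \<open>mode_normsq_le_opnorm\<close> uses products of \<open>e\<^bsup>ik\<theta>\<^esup>\<close>, a truncation of the
  function of \<open>r\<close> that is extremal at frequency 1, and a long wave packet in \<open>s\<close> whose spectrum
  concentrates at frequency 1.

  It remains to find the suprema. For \<open>\<gamma> = 2\<close> the quotient of consecutive terms is
  \<open>\<alpha>\<beta> / (k+1)\<^sup>2\<close>, at most 1 because \<open>\<alpha> + \<beta> = 2(k+1)\<close>; the largest term is the one of \<open>k = 0\<close>.
  For \<open>d = 1\<close>, with \<open>p = 1/\<gamma>\<close>, \<open>q = 1 - p\<close> and \<open>n = k + 1\<close>, one has \<open>\<alpha> = 2np\<close>, \<open>\<beta> = 2nq\<close>, and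
  the logarithm of the term is a function of real \<open>n > 0\<close> whose derivative is nonpositive
  because \<open>x \<psi>(x) - x ln x\<close> is concave, \<open>\<psi>\<close> being the digamma function; so again
  \<open>k = 0\<close> wins. For the pairing measure the terms with \<open>k \<ge> 1\<close> are the values of the same function at
  \<open>n = k\<close>, and the term with \<open>k = 0\<close> is its limit at \<open>n = 0\<close>, which is therefore the largest. For the preferred
  measure \<open>\<alpha>\<close>, \<open>\<beta>\<close> and \<open>k + 1\<close> are \<open>pm + 1/3\<close>, \<open>qm + 1/3\<close> and \<open>m/2 + 1/3\<close> with
  \<open>m = 2k + 4/3\<close>. Concavity of the error of Stirling's formula for \<open>ln \<Gamma>(x + 1/3)\<close> bounds every term by
  \<open>\<gamma> / (2 sqrt (\<gamma>-1))\<close>, and this bound is the limit of the terms for large \<open>k\<close>.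
\<close>

section \<open>Plancherel's identity on the line\<close>

definition fourier :: "(real \<Rightarrow> complex) \<Rightarrow> real \<Rightarrow> complex" where
  "fourier g x = (\<integral>s. g s * cis (- (x * s)) \<partial>lborel)"

lemma measurable_cis [measurable]: "cis \<in> borel_measurable borel"
  unfolding cis_conv_exp[abs_def] by measurable

lemma measurable_cnj [measurable]: "cnj \<in> borel_measurable borel"
  by (intro borel_measurable_continuous_onI continuous_intros)

lemma integral_normal_density_cis:
  assumes "\<delta> > 0"
  shows "(\<integral>x. cis (- (x * u)) * of_real (exp (- (\<delta> * x)\<^sup>2 / 2)) \<partial>lborel)
    = of_real (2 * pi * normal_density 0 \<delta> u)"
proof -
  have "exp (- ((u / \<delta>)\<^sup>2) / 2) = char std_normal_distribution (- u / \<delta>)"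
    by (simp add: char_std_normal_distribution)
  also have "\<dots> = (\<integral>x. std_normal_density x *\<^sub>R iexp (- u / \<delta> * x) \<partial>lborel)"
    unfolding char_def by (subst integral_density) (auto simp: normal_density_nonneg)
  also have "\<dots> = \<bar>\<delta>\<bar> *\<^sub>R (\<integral>x. std_normal_density (0 + \<delta> * x) *\<^sub>R iexp (- u / \<delta> * (0 + \<delta> * x)) \<partial>lborel)"
    using assms by (subst lborel_integral_real_affine[where c=\<delta> and t=0]) auto
  also have "(\<lambda>x. std_normal_density (0 + \<delta> * x) *\<^sub>R iexp (- u / \<delta> * (0 + \<delta> * x))) =
     (\<lambda>x. of_real (1 / sqrt (2 * pi)) * (cis (- (x * u)) * of_real (exp (- (\<delta> * x)\<^sup>2 / 2))))"
    using assms by (auto simp: fun_eq_iff std_normal_density_def cis_conv_exp scaleR_conv_of_real mult_ac)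
  finally have "of_real (exp (- ((u / \<delta>)\<^sup>2) / 2)) =
     of_real (\<delta> / sqrt (2 * pi)) * (\<integral>x. cis (- (x * u)) * of_real (exp (- (\<delta> * x)\<^sup>2 / 2)) \<partial>lborel)"
    using assms by (simp add: scaleR_conv_of_real)
  hence "(\<integral>x. cis (- (x * u)) * of_real (exp (- (\<delta> * x)\<^sup>2 / 2)) \<partial>lborel) =
     of_real (sqrt (2 * pi) / \<delta>) * of_real (exp (- ((u / \<delta>)\<^sup>2) / 2))"
    using assms by (simp add: field_simps)
  also have "\<dots> = of_real (2 * pi * normal_density 0 \<delta> u)"
  proof -
    have "sqrt (2 * pi * \<delta>\<^sup>2) = sqrt (2*pi) * \<delta>" using assms by (simp add: real_sqrt_mult)
    moreover have "2 * pi = sqrt (2*pi) * sqrt (2*pi)" by simp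
    ultimately have "sqrt (2 * pi) / \<delta> * exp (- ((u / \<delta>)\<^sup>2) / 2) = 2 * pi * normal_density 0 \<delta> u"
      using assms unfolding normal_density_def by (simp add: field_simps power2_eq_square)
    thus ?thesis by (metis of_real_mult)
  qed
  finally show ?thesis .
qed

lemma integrable_gauss:
  fixes \<delta> :: real
  assumes "\<delta> > 0"
  shows "integrable lborel (\<lambda>x. exp (- (\<delta> * x)\<^sup>2 / 2))"
proof -
  have "integrable lborel (\<lambda>x. sqrt (2 * pi * (1/\<delta>)^(2::nat)) * normal_density 0 (1/\<delta>) x)"
    using assms by (intro integrable_mult_right integrable_normal_density) auto
  thus ?thesis using assms by (simp add: normal_density_def power_mult_distrib power_divide mult.commute)
qed

lemma fourier_norm_le: "integrable lborel g \<Longrightarrow> norm (fourier g x) \<le> (\<integral>s. norm (g s) \<partial>lborel)"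
  unfolding fourier_def by (rule order_trans[OF integral_norm_bound]) (simp add: norm_mult)

lemma measurable_fourier [measurable]:
  assumes [measurable]: "g \<in> borel_measurable borel"
  shows "fourier g \<in> borel_measurable borel"
  unfolding fourier_def[abs_def] by measurable

text \<open>The Gaussian factor makes the integrand of the triple integral over \<open>x\<close>, \<open>s\<close> and \<open>s'\<close> absolutely
  integrable, so that the integral over \<open>x\<close> may be done first. It yields a normal density in
  \<open>s - s'\<close>, an approximate identity as \<open>\<delta>\<close> tends to 0.\<close>
lemma fourier_regularized:
  assumes g: "integrable lborel g" and b: "\<And>s. norm (g s) \<le> M" and "\<delta> > 0"
  shows "(\<integral>x. (cmod (fourier g x))\<^sup>2 * exp (- (\<delta> * x)\<^sup>2 / 2) \<partial>lborel) =
    2 * pi * Re (\<integral>s. g s * (\<integral>u. cnj (g (s + \<delta> * u)) * of_real (std_normal_density u) \<partial>lborel) \<partial>lborel)"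
proof -
  have [measurable]: "g \<in> borel_measurable borel" using borel_measurable_integrable[OF g] by simp
  let ?w = "\<lambda>x. exp (- (\<delta> * x)\<^sup>2 / 2)"
  let ?G = "\<lambda>s s'. g s * cnj (g s')"
  have gc: "integrable lborel (\<lambda>s. cnj (g s))" using g by simp
  have iG: "integrable (lborel \<Otimes>\<^sub>M lborel) (\<lambda>(s,s'). ?G s s')"
    using g gc by (intro lborel_pair.Fubini_integrable; measurable?) (auto simp: norm_mult intro!: integrable_mult_left integrable_mult_right)
  interpret P: pair_sigma_finite lborel "lborel \<Otimes>\<^sub>M lborel :: (real\<times>real) measure"
    by (simp add: pair_sigma_finite_def sigma_finite_lborel lborel_prod)
  have iw: "integrable lborel ?w" by (rule integrable_gauss[OF assms(3)])
  have i3: "integrable (lborel \<Otimes>\<^sub>M (lborel \<Otimes>\<^sub>M lborel)) (\<lambda>(x,(s,s')). ?G s s' * cis (- (x * (s - s'))) * of_real (?w x))"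
    (is "integrable _ ?f")
  proof (rule P.Fubini_integrable)
    have *: "(\<lambda>x. \<integral>y. norm (?f (x, y)) \<partial>(lborel \<Otimes>\<^sub>M lborel)) = (\<lambda>x. (\<integral>y. norm (case_prod ?G y) \<partial>(lborel \<Otimes>\<^sub>M lborel)) * ?w x)"
      by (subst integral_mult_left_zero[symmetric]) (simp add: norm_mult case_prod_unfold)
    show "integrable lborel (\<lambda>x. \<integral>y. norm (?f (x, y)) \<partial>(lborel \<Otimes>\<^sub>M lborel))"
      unfolding * using iw by simp
    show "AE x in lborel. integrable (lborel \<Otimes>\<^sub>M lborel) (\<lambda>y. ?f (x, y))"
    proof (rule AE_I2)
      fix x
      show "integrable (lborel \<Otimes>\<^sub>M lborel) (\<lambda>y. ?f (x, y))"
        by (rule Bochner_Integration.integrable_bound[OF integrable_mult_left[OF iG, of "of_real (?w x)"]])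
         (auto simp: norm_mult case_prod_unfold)
    qed
  qed measurable
  have "complex_of_real (\<integral>x. (cmod (fourier g x))\<^sup>2 * ?w x \<partial>lborel) =
    (\<integral>x. fourier g x * cnj (fourier g x) * of_real (?w x) \<partial>lborel)"
    by (simp add: complex_norm_square[symmetric] del: of_real_power flip: integral_complex_of_real)
  also have "\<dots> = (\<integral>x. \<integral>y. ?f (x,y) \<partial>(lborel \<Otimes>\<^sub>M lborel) \<partial>lborel)"
  proof (intro Bochner_Integration.integral_cong refl)
    fix x :: real
    have ix: "integrable (lborel \<Otimes>\<^sub>M lborel) (\<lambda>y. ?f (x, y))"
      by (rule Bochner_Integration.integrable_bound[OF integrable_mult_left[OF iG, of "of_real (?w x)"]])
         (auto simp: norm_mult case_prod_unfold)
    have "(\<integral>y. ?f (x,y) \<partial>(lborel \<Otimes>\<^sub>M lborel)) = (\<integral>s. \<integral>s'. ?f (x,(s,s')) \<partial>lborel \<partial>lborel)"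
      using lborel_pair.integral_fst'[OF ix] by simp
    also have "\<dots> = (\<integral>s. \<integral>s'. (of_real (?w x) * g s * cis (- (x * s))) * (cnj (g s') * cis (x * s')) \<partial>lborel \<partial>lborel)"
      by (intro Bochner_Integration.integral_cong refl) (simp add: mult_ac cis_mult algebra_simps)
    also have "\<dots> = (\<integral>s. of_real (?w x) * (g s * cis (- (x * s))) * (\<integral>s'. (cnj (g s') * cis (x * s')) \<partial>lborel) \<partial>lborel)"
      by (simp add: mult.assoc)
    also have "\<dots> = (of_real (?w x) * fourier g x) * (\<integral>s'. (cnj (g s') * cis (x * s')) \<partial>lborel)"
      unfolding fourier_def by simp
    also have "(\<integral>s'. (cnj (g s') * cis (x * s')) \<partial>lborel) = cnj (fourier g x)"
      unfolding fourier_def by (subst Bochner_Integration.integral_cnj[symmetric]) (simp add: cis_cnj)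
    finally show "fourier g x * cnj (fourier g x) * of_real (?w x) = (\<integral>y. ?f (x,y) \<partial>(lborel \<Otimes>\<^sub>M lborel))"
      by (simp add: mult_ac)
  qed
  also have "\<dots> = (\<integral>y. \<integral>x. ?f (x,y) \<partial>lborel \<partial>(lborel \<Otimes>\<^sub>M lborel))"
    by (rule P.Fubini_integral[symmetric]) (use i3 in \<open>simp add: case_prod_unfold\<close>)
  also have "\<dots> = (\<integral>y. (case y of (s, s') \<Rightarrow> ?G s s' * of_real (2 * pi * normal_density 0 \<delta> (s - s'))) \<partial>(lborel \<Otimes>\<^sub>M lborel))"
    by (intro Bochner_Integration.integral_cong refl)
       (simp only: case_prod_unfold prod.case fst_conv snd_conv mult.assoc integral_mult_right_zero integral_normal_density_cis[OF assms(3)])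
  also have "\<dots> = (\<integral>s. \<integral>s'. ?G s s' * of_real (2 * pi * normal_density 0 \<delta> (s - s')) \<partial>lborel \<partial>lborel)"
  proof (rule lborel_pair.integral_fst[symmetric])
    show "integrable (lborel \<Otimes>\<^sub>M lborel) (\<lambda>(s, s'). ?G s s' * of_real (2 * pi * normal_density 0 \<delta> (s - s')))"
    proof (rule Bochner_Integration.integrable_bound[OF integrable_mult_left[OF iG, of "of_real (2 * pi / sqrt (2 * pi * \<delta>\<^sup>2))"]])
      have "normal_density 0 \<delta> u \<le> 1 / sqrt (2 * pi * \<delta>\<^sup>2)" for u
        unfolding normal_density_def by (simp add: divide_right_mono)
      hence "2 * pi * normal_density 0 \<delta> u \<le> 2 * pi / sqrt (2 * pi * \<delta>\<^sup>2)" for u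
        using mult_left_mono[of "normal_density 0 \<delta> u" "1 / sqrt (2 * pi * \<delta>\<^sup>2)" "2*pi"] by simp
      hence normal_le: "\<bar>2 * pi * normal_density 0 \<delta> u\<bar> \<le> \<bar>2 * pi / sqrt (2 * pi * \<delta>\<^sup>2)\<bar>" for u
        by (simp add: normal_density_nonneg)
      show "AE x in lborel \<Otimes>\<^sub>M lborel.
       cmod (case x of (s, s') \<Rightarrow> g s * cnj (g s') * complex_of_real (2 * pi * normal_density 0 \<delta> (s - s')))
       \<le> cmod ((case x of (s, s') \<Rightarrow> g s * cnj (g s')) * of_real (2 * pi / sqrt (2 * pi * \<delta>\<^sup>2)))"
        apply (rule AE_I2)
        subgoal for x
          using mult_left_mono[OF normal_le[of "fst x - snd x"], of "cmod (g (fst x)) * cmod (g (snd x))"]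
          by (simp add: case_prod_unfold norm_mult norm_divide mult_ac)
        done
    qed measurable
  qed
  also have "\<dots> = (\<integral>s. of_real (2*pi) * (g s * (\<integral>u. cnj (g (s + \<delta> * u)) * of_real (std_normal_density u) \<partial>lborel)) \<partial>lborel)"
  proof (intro Bochner_Integration.integral_cong refl)
    fix s :: real
    have nd: "\<delta> * normal_density 0 \<delta> (- (\<delta> * u)) = std_normal_density u" for u
      using assms(3) by (simp add: normal_density_def real_sqrt_mult power_mult_distrib)
    have "(\<integral>s'. ?G s s' * of_real (2 * pi * normal_density 0 \<delta> (s - s')) \<partial>lborel) =
      \<bar>\<delta>\<bar> *\<^sub>R (\<integral>u. ?G s (s + \<delta> * u) * of_real (2 * pi * normal_density 0 \<delta> (s - (s + \<delta> * u))) \<partial>lborel)"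
      using assms(3) by (intro lborel_integral_real_affine) auto
    also have "\<dots> = (\<integral>u. ?G s (s + \<delta> * u) * of_real (2 * pi * (\<delta> * normal_density 0 \<delta> (- (\<delta> * u)))) \<partial>lborel)"
      using assms(3) by (subst integral_scaleR_right[symmetric]) (simp add: scaleR_conv_of_real mult_ac)
    also have "\<dots> = (\<integral>u. (of_real (2*pi) * g s) * (cnj (g (s + \<delta> * u)) * of_real (std_normal_density u)) \<partial>lborel)"
      unfolding nd by (simp add: mult_ac)
    also have "\<dots> = (of_real (2*pi) * g s) * (\<integral>u. (cnj (g (s + \<delta> * u)) * of_real (std_normal_density u)) \<partial>lborel)"
      by (rule integral_mult_right_zero)
    finally show "(\<integral>s'. ?G s s' * of_real (2 * pi * normal_density 0 \<delta> (s - s')) \<partial>lborel) =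
      of_real (2*pi) * (g s * (\<integral>u. cnj (g (s + \<delta> * u)) * of_real (std_normal_density u) \<partial>lborel))"
      by (simp add: mult_ac)
  qed
  also have "\<dots> = of_real (2*pi) * (\<integral>s. g s * (\<integral>u. cnj (g (s + \<delta> * u)) * of_real (std_normal_density u) \<partial>lborel) \<partial>lborel)"
    by (rule integral_mult_right_zero)
  finally have "Re (complex_of_real (\<integral>x. (cmod (fourier g x))\<^sup>2 * ?w x \<partial>lborel)) =
     Re (of_real (2*pi) * (\<integral>s. g s * (\<integral>u. cnj (g (s + \<delta> * u)) * of_real (std_normal_density u) \<partial>lborel) \<partial>lborel))"
    by simp
  thus ?thesis by (simp del: of_real_mult)
qed

text \<open>As \<open>\<delta>\<close> decreases to 0, the regularized left side of \<open>fourier_regularized\<close> increases to the integral of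
  \<open>|fourier g|\<^sup>2\<close>, while the right side converges by continuity of \<open>g\<close> and dominated convergence.\<close>
lemma plancherel:
  assumes g: "integrable lborel g" and b: "\<And>s. norm (g s) \<le> M" and c: "continuous_on UNIV g"
  shows "(\<integral>\<^sup>+x. ennreal ((cmod (fourier g x))\<^sup>2) \<partial>lborel) = ennreal (2 * pi) * (\<integral>\<^sup>+s. ennreal ((cmod (g s))\<^sup>2) \<partial>lborel)"
proof -
  have [measurable]: "g \<in> borel_measurable borel" using borel_measurable_integrable[OF g] by simp
  have M0: "0 \<le> M" using b[of 0] norm_ge_zero order_trans by blast
  let ?\<delta> = "\<lambda>n::nat. 1 / real (Suc n)"
  let ?w = "\<lambda>n x. exp (- (?\<delta> n * x)\<^sup>2 / 2)"
  let ?I = "\<lambda>s \<delta>. (\<integral>u. cnj (g (s + \<delta> * u)) * of_real (std_normal_density u) \<partial>lborel)"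
  have ig2: "integrable lborel (\<lambda>s. (cmod (g s))\<^sup>2)"
    using mult_right_mono[OF b norm_ge_zero]
    by (intro Bochner_Integration.integrable_bound[OF integrable_mult_right[OF integrable_norm[OF g], of M]])
       (auto simp: power2_eq_square M0)
  have isn: "integrable lborel (\<lambda>u. M * std_normal_density u)"
    by (intro integrable_mult_right integrable_normal_density) auto
  have sn1: "(\<integral>u. std_normal_density u \<partial>lborel) = 1" by (rule integral_normal_density) simp
  have \<delta>0: "?\<delta> \<longlonglongrightarrow> 0" using LIMSEQ_inverse_real_of_nat by (simp add: inverse_eq_divide)
  have bI: "norm (?I s \<delta>) \<le> M" for s \<delta>
  proof -
    have "norm (?I s \<delta>) \<le> (\<integral>u. norm (cnj (g (s + \<delta> * u)) * of_real (std_normal_density u)) \<partial>lborel)" by (rule integral_norm_bound)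
    also have "\<dots> \<le> (\<integral>u. M * std_normal_density u \<partial>lborel)"
      using isn by (intro Bochner_Integration.integral_mono Bochner_Integration.integrable_bound[OF isn])
         (auto simp: norm_mult normal_density_nonneg M0 intro!: mult_right_mono b)
    finally show ?thesis using sn1 by simp
  qed
  have lI: "(\<lambda>n. ?I s (?\<delta> n)) \<longlonglongrightarrow> cnj (g s)" for s
  proof -
    have "(\<lambda>n. ?I s (?\<delta> n)) \<longlonglongrightarrow> (\<integral>u. cnj (g s) * of_real (std_normal_density u) \<partial>lborel)"
    proof (rule integral_dominated_convergence[OF _ _ isn])
      have "(\<lambda>n. g (s + ?\<delta> n * u)) \<longlonglongrightarrow> g s" for u
      proof (rule continuous_on_tendsto_compose[OF c])
        have "(\<lambda>n. s + ?\<delta> n * u) \<longlonglongrightarrow> s + 0 * u" by (intro tendsto_intros \<delta>0)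
        thus "(\<lambda>n. s + ?\<delta> n * u) \<longlonglongrightarrow> s" by simp
      qed auto
      thus "AE u in lborel. (\<lambda>n. cnj (g (s + ?\<delta> n * u)) * of_real (std_normal_density u)) \<longlonglongrightarrow> cnj (g s) * of_real (std_normal_density u)"
        by (intro AE_I2 tendsto_mult tendsto_const tendsto_cnj)
      show "\<And>n. AE u in lborel. norm (cnj (g (s + ?\<delta> n * u)) * of_real (std_normal_density u)) \<le> M * std_normal_density u"
        by (auto simp: norm_mult normal_density_nonneg intro!: mult_right_mono b)
    qed measurable
    also have "(\<integral>u. cnj (g s) * of_real (std_normal_density u) \<partial>lborel) = cnj (g s)"
      by (simp add: sn1)
    finally show ?thesis .
  qed
  have lim: "(\<lambda>n. \<integral>s. g s * ?I s (?\<delta> n) \<partial>lborel) \<longlonglongrightarrow> (\<integral>s. g s * cnj (g s) \<partial>lborel)"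
  proof (rule integral_dominated_convergence[where w="\<lambda>s. norm (g s) * M"])
    show "integrable lborel (\<lambda>s. norm (g s) * M)" using g by simp
    show "AE s in lborel. (\<lambda>n. g s * ?I s (?\<delta> n)) \<longlonglongrightarrow> g s * cnj (g s)"
      by (intro AE_I2 tendsto_mult tendsto_const lI)
    show "\<And>n. AE s in lborel. norm (g s * ?I s (?\<delta> n)) \<le> norm (g s) * M"
      unfolding norm_mult by (intro AE_I2 mult_left_mono bI) auto
  qed measurable
  hence lim: "(\<lambda>n. 2 * pi * Re (\<integral>s. g s * ?I s (?\<delta> n) \<partial>lborel)) \<longlonglongrightarrow> 2 * pi * Re (\<integral>s. g s * cnj (g s) \<partial>lborel)"
    by (intro tendsto_intros)
  have "(\<integral>s. g s * cnj (g s) \<partial>lborel) = of_real (\<integral>s. (cmod (g s))\<^sup>2 \<partial>lborel)"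
    by (simp add: complex_norm_square[symmetric] del: of_real_power flip: integral_complex_of_real)
  hence lim: "(\<lambda>n. \<integral>x. (cmod (fourier g x))\<^sup>2 * ?w n x \<partial>lborel) \<longlonglongrightarrow> 2 * pi * (\<integral>s. (cmod (g s))\<^sup>2 \<partial>lborel)"
    using lim by (subst fourier_regularized[OF g b]) auto
  have iw: "integrable lborel (\<lambda>x. (cmod (fourier g x))\<^sup>2 * ?w n x)" for n
  proof (rule Bochner_Integration.integrable_bound[OF integrable_mult_right[OF integrable_gauss[of "?\<delta> n"], of "(\<integral>s. norm (g s) \<partial>lborel)\<^sup>2"]])
    show "AE x in lborel. norm ((cmod (fourier g x))\<^sup>2 * ?w n x) \<le> norm ((\<integral>s. norm (g s) \<partial>lborel)\<^sup>2 * ?w n x)"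
      using fourier_norm_le[OF g] by (auto simp: norm_mult intro!: mult_right_mono power_mono)
  qed auto
  have "(\<lambda>n. \<integral>\<^sup>+x. ennreal ((cmod (fourier g x))\<^sup>2 * ?w n x) \<partial>lborel) \<longlonglongrightarrow> (\<integral>\<^sup>+x. ennreal ((cmod (fourier g x))\<^sup>2) \<partial>lborel)"
  proof (rule nn_integral_LIMSEQ)
    show "incseq (\<lambda>n x. ennreal ((cmod (fourier g x))\<^sup>2 * ?w n x))"
    proof (intro incseq_SucI le_funI ennreal_leI mult_left_mono)
      fix n x
      have "(?\<delta> (Suc n) * x)\<^sup>2 \<le> (?\<delta> n * x)\<^sup>2"
        unfolding power_mult_distrib by (intro mult_right_mono power_mono) (auto simp: frac_le)
      thus "?w n x \<le> ?w (Suc n) x" by simp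
    qed auto
    show "(\<lambda>n. ennreal ((cmod (fourier g x))\<^sup>2 * ?w n x)) \<longlonglongrightarrow> ennreal ((cmod (fourier g x))\<^sup>2)" for x
    proof -
      have "(\<lambda>n. (cmod (fourier g x))\<^sup>2 * ?w n x) \<longlonglongrightarrow> (cmod (fourier g x))\<^sup>2 * exp (- (0 * x)\<^sup>2 / 2)"
        by (intro tendsto_intros \<delta>0) auto
      thus ?thesis by (intro tendsto_ennrealI) simp
    qed
  qed measurable
  moreover have "(\<lambda>n. \<integral>\<^sup>+x. ennreal ((cmod (fourier g x))\<^sup>2 * ?w n x) \<partial>lborel) = (\<lambda>n. ennreal (\<integral>x. (cmod (fourier g x))\<^sup>2 * ?w n x \<partial>lborel))"
    by (intro ext nn_integral_eq_integral iw) auto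
  ultimately have "(\<integral>\<^sup>+x. ennreal ((cmod (fourier g x))\<^sup>2) \<partial>lborel) = ennreal (2 * pi * (\<integral>s. (cmod (g s))\<^sup>2 \<partial>lborel))"
    using tendsto_ennrealI[OF lim] by (auto intro: LIMSEQ_unique)
  also have "\<dots> = ennreal (2 * pi) * (\<integral>\<^sup>+s. ennreal ((cmod (g s))\<^sup>2) \<partial>lborel)"
    using ig2 by (subst ennreal_mult) (auto simp: nn_integral_eq_integral)
  finally show ?thesis .
qed
section \<open>The half line and the circle as measures\<close>
definition half :: "real measure" where "half = density lborel (indicator {0<..})"
definition circ :: "real measure" where "circ = density lborel (indicator {0..<2 * pi})"

lemma sets_half [simp, measurable_cong]: "sets half = sets borel" by (simp add: half_def)
lemma sets_circ [simp, measurable_cong]: "sets circ = sets borel" by (simp add: circ_def)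
lemma space_half [simp]: "space half = UNIV" by (simp add: half_def)
lemma space_circ [simp]: "space circ = UNIV" by (simp add: circ_def)

abbreviation polar_normsq :: "real \<Rightarrow> (real \<Rightarrow> real \<Rightarrow> real \<Rightarrow> complex) \<Rightarrow> ennreal" where
  "polar_normsq d H \<equiv> (\<integral>\<^sup>+r. \<integral>\<^sup>+\<theta>. \<integral>\<^sup>+s. ennreal (r powr d) * ennreal ((cmod (H r \<theta> s))\<^sup>2) \<partial>lborel \<partial>circ \<partial>half)"

lemma nn_integral_half:
  assumes [measurable]: "f \<in> borel_measurable borel"
  shows "(\<integral>\<^sup>+x. f x \<partial>half) = (\<integral>\<^sup>+x. f x * indicator {0<..} x \<partial>lborel)"
  unfolding half_def by (subst nn_integral_density) (auto simp: mult.commute)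

lemma integral_half:
  fixes f :: "real \<Rightarrow> 'a::{banach,second_countable_topology}"
  assumes [measurable]: "f \<in> borel_measurable borel"
  shows "(\<integral>x. f x \<partial>half) = (\<integral>x. indicator {0<..} x *\<^sub>R f x \<partial>lborel)"
proof -
  have h: "half = density lborel (\<lambda>x. ennreal (indicator {0<..} x))" by (simp add: half_def ennreal_indicator)
  show ?thesis unfolding h by (subst integral_density) auto
qed

lemma integrable_half:
  fixes f :: "real \<Rightarrow> 'a::{banach,second_countable_topology}"
  assumes [measurable]: "f \<in> borel_measurable borel"
  shows "integrable half f \<longleftrightarrow> integrable lborel (\<lambda>x. indicator {0<..} x *\<^sub>R f x)"
proof -
  have h: "half = density lborel (\<lambda>x. ennreal (indicator {0<..} x))" by (simp add: half_def ennreal_indicator)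
  show ?thesis unfolding h by (subst integrable_density) auto
qed

lemma integral_circ:
  fixes f :: "real \<Rightarrow> 'a::{banach,second_countable_topology}"
  assumes [measurable]: "f \<in> borel_measurable borel"
  shows "(\<integral>x. f x \<partial>circ) = (\<integral>x. indicator {0..2*pi} x *\<^sub>R f x \<partial>lborel)"
proof -
  have h: "circ = density lborel (\<lambda>x. ennreal (indicator {0..<2*pi} x))" by (simp add: circ_def ennreal_indicator)
  have "(\<integral>x. f x \<partial>circ) = (\<integral>x. indicator {0..<2*pi} x *\<^sub>R f x \<partial>lborel)" unfolding h by (subst integral_density) auto
  also have "\<dots> = (\<integral>x. indicator {0..2*pi} x *\<^sub>R f x \<partial>lborel)"
  proof (rule integral_cong_AE)
    show "AE x in lborel. indicator {0..<2*pi} x *\<^sub>R f x = indicator {0..2*pi} x *\<^sub>R f x"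
      using AE_lborel_singleton[of "2*pi"] by eventually_elim (auto split: split_indicator)
  qed measurable
  finally show ?thesis .
qed

lemma sigma_finite_half [simp]: "sigma_finite_measure half"
  unfolding half_def by (subst sigma_finite_measure.sigma_finite_iff_density_finite[OF sigma_finite_lborel]) (auto simp: indicator_def)

lemma finite_circ [simp]: "finite_measure circ"
  by (rule finite_measureI) (simp add: circ_def emeasure_density)

lemma sigma_finite_circ [simp]: "sigma_finite_measure circ"
  using finite_circ by (rule finite_measure.sigma_finite_measure)

lemma AE_half: "AE x in half. 0 < x"
  unfolding half_def by (subst AE_density) (auto simp: indicator_def)

lemma integrable_circ_bounded:
  fixes f :: "real \<Rightarrow> 'a::{banach,second_countable_topology}"
  assumes "f \<in> borel_measurable borel" "\<And>x. norm (f x) \<le> B"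
  shows "integrable circ f"
  using assms by (intro finite_measure.integrable_const_bound[OF finite_circ, of _ B]) auto

lemma measure_circ: "measure circ UNIV = 2 * pi"
  by (simp add: measure_def circ_def emeasure_density)

section \<open>Fourier series on the circle\<close>

lemma integral_circ_cis:
  fixes m :: int
  shows "(\<integral>\<theta>. cis (of_int m * \<theta>) \<partial>circ) = (if m = 0 then of_real (2 * pi) else 0)"
proof (cases "m = 0")
  case False
  have "(\<integral>x. indicator {0..2*pi} x *\<^sub>R cis (of_int m * x) \<partial>lborel) =
     cis (of_int m * (2*pi)) / (\<i> * of_int m) - cis (of_int m * 0) / (\<i> * of_int m)"
    using False
  proof (intro integral_FTC_Icc)
    fix x :: real
    have "((\<lambda>z. exp (\<i> * (of_int m * z)) / (\<i> * of_int m)) has_field_derivative exp (\<i> * (of_int m * of_real x))) (at (of_real x))"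
      using False by (auto intro!: derivative_eq_intros simp: field_simps)
    from has_vector_derivative_real_field[OF this]
    show "((\<lambda>x. cis (of_int m * x) / (\<i> * of_int m)) has_vector_derivative cis (of_int m * x)) (at x within {0..2*pi})"
      by (simp add: cis_conv_exp mult_ac has_vector_derivative_at_within)
  qed (auto intro!: continuous_intros)
  also have "cis (of_int m * (2*pi)) = 1"
    using cos_int_2pin[of m] sin_int_2pin[of m] by (simp add: complex_eq_iff mult_ac)
  finally show ?thesis using False by (simp add: integral_circ)
qed (simp add: measure_circ scaleR_conv_of_real)

lemma parseval_finite:
  fixes a :: "nat \<Rightarrow> complex"
  shows "(\<integral>\<phi>. (cmod (\<Sum>k<n. a k * cis (real k * \<phi>)))\<^sup>2 \<partial>circ) = 2 * pi * (\<Sum>k<n. (cmod (a k))\<^sup>2)"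
proof -
  have i: "integrable circ (\<lambda>\<phi>. a k * cnj (a j) * cis (of_int (int k - int j) * \<phi>))" for k j
    by (rule integrable_circ_bounded[of _ "cmod (a k * cnj (a j))"]) (auto simp: norm_mult)
  have "complex_of_real (\<integral>\<phi>. (cmod (\<Sum>k<n. a k * cis (real k * \<phi>)))\<^sup>2 \<partial>circ) =
     (\<integral>\<phi>. (\<Sum>k<n. \<Sum>j<n. a k * cnj (a j) * cis (of_int (int k - int j) * \<phi>)) \<partial>circ)"
    unfolding integral_complex_of_real[symmetric]
  proof (intro Bochner_Integration.integral_cong refl)
    fix \<phi> :: real
    have e: "cis (real k * \<phi>) * cis (- (real j * \<phi>)) = cis (of_int (int k - int j) * \<phi>)" for k j
      by (simp add: cis_mult algebra_simps)
    show "complex_of_real ((cmod (\<Sum>k<n. a k * cis (real k * \<phi>)))\<^sup>2) =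
      (\<Sum>k<n. \<Sum>j<n. a k * cnj (a j) * cis (of_int (int k - int j) * \<phi>))"
      unfolding complex_norm_square cnj_sum sum_product e[symmetric]
      by (intro sum.cong refl) (simp add: cis_cnj)
  qed
  also have "\<dots> = (\<Sum>k<n. \<Sum>j<n. a k * cnj (a j) * (\<integral>\<phi>. cis (of_int (int k - int j) * \<phi>) \<partial>circ))"
    using i by (subst Bochner_Integration.integral_sum; (intro Bochner_Integration.integrable_sum)?; (subst Bochner_Integration.integral_sum)?; simp del: of_int_diff)
  also have "\<dots> = (\<Sum>k<n. \<Sum>j<n. if j = k then of_real (2 * pi) * (a k * cnj (a k)) else 0)"
    unfolding integral_circ_cis by (intro sum.cong) auto
  also have "\<dots> = (\<Sum>k<n. of_real (2 * pi) * (a k * cnj (a k)))"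
    by (intro sum.cong refl) (simp add: sum.delta)
  also have "\<dots> = complex_of_real (2 * pi * (\<Sum>k<n. (cmod (a k))\<^sup>2))"
    by (simp add: complex_norm_square sum_distrib_left del: of_real_power)
  finally show ?thesis using of_real_eq_iff by blast
qed

text \<open>The partial sums converge uniformly, so the finite identity passes to the limit.\<close>
lemma parseval:
  fixes a :: "nat \<Rightarrow> complex"
  assumes "summable (\<lambda>k. cmod (a k))"
  shows "(\<integral>\<^sup>+\<phi>. ennreal ((cmod (\<Sum>k. a k * cis (real k * \<phi>)))\<^sup>2) \<partial>circ) = ennreal (2 * pi) * (\<Sum>k. ennreal ((cmod (a k))\<^sup>2))"
proof -
  let ?S = "\<lambda>n \<phi>. \<Sum>k<n. a k * cis (real k * \<phi>)"
  let ?M = "\<Sum>k. cmod (a k)"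
  have sm: "summable (\<lambda>k. a k * cis (real k * \<phi>))" for \<phi>
    using assms by (subst summable_norm_cancel) (auto simp: norm_mult)
  have b: "cmod (?S n \<phi>) \<le> ?M" for n \<phi>
    by (rule order_trans[OF norm_sum]) (use assms in \<open>auto simp: norm_mult intro: sum_le_suminf\<close>)
  have l: "(\<lambda>n. ?S n \<phi>) \<longlonglongrightarrow> (\<Sum>k. a k * cis (real k * \<phi>))" for \<phi>
    using summable_LIMSEQ[OF sm] .
  have b': "cmod (\<Sum>k. a k * cis (real k * \<phi>)) \<le> ?M" for \<phi>
    by (rule tendsto_upperbound[OF tendsto_norm[OF l]]) (use b in auto)
  have "(\<lambda>n. \<integral>\<phi>. (cmod (?S n \<phi>))\<^sup>2 \<partial>circ) \<longlonglongrightarrow> (\<integral>\<phi>. (cmod (\<Sum>k. a k * cis (real k * \<phi>)))\<^sup>2 \<partial>circ)"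
  proof (rule integral_dominated_convergence[where w="\<lambda>_. ?M\<^sup>2"])
    show "integrable circ (\<lambda>_. ?M\<^sup>2)" using finite_circ by (simp add: finite_measure.integrable_const)
    show "AE x in circ. (\<lambda>n. (cmod (?S n x))\<^sup>2) \<longlonglongrightarrow> (cmod (\<Sum>k. a k * cis (real k * x)))\<^sup>2"
      by (intro AE_I2 tendsto_intros l)
  qed (auto intro!: power_mono b)
  moreover have "(\<integral>\<phi>. (cmod (\<Sum>k. a k * cis (real k * \<phi>)))\<^sup>2 \<partial>circ) \<ge> 0" by simp
  ultimately have "(\<lambda>n. ennreal (2 * pi * (\<Sum>k<n. (cmod (a k))\<^sup>2))) \<longlonglongrightarrow> ennreal (\<integral>\<phi>. (cmod (\<Sum>k. a k * cis (real k * \<phi>)))\<^sup>2 \<partial>circ)"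
    unfolding parseval_finite by (intro tendsto_ennrealI)
  also have "(\<lambda>n. ennreal (2 * pi * (\<Sum>k<n. (cmod (a k))\<^sup>2))) = (\<lambda>n. ennreal (2 * pi) * (\<Sum>k<n. ennreal ((cmod (a k))\<^sup>2)))"
    by (subst ennreal_mult) (auto simp: sum_nonneg sum_ennreal)
  finally have "(\<lambda>n. ennreal (2 * pi) * (\<Sum>k<n. ennreal ((cmod (a k))\<^sup>2))) \<longlonglongrightarrow> ennreal (\<integral>\<phi>. (cmod (\<Sum>k. a k * cis (real k * \<phi>)))\<^sup>2 \<partial>circ)" .
  moreover have "(\<lambda>n. ennreal (2 * pi) * (\<Sum>k<n. ennreal ((cmod (a k))\<^sup>2))) \<longlonglongrightarrow> ennreal (2 * pi) * (\<Sum>k. ennreal ((cmod (a k))\<^sup>2))"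
    by (intro ennreal_tendsto_cmult summable_LIMSEQ) auto
  ultimately have "ennreal (\<integral>\<phi>. (cmod (\<Sum>k. a k * cis (real k * \<phi>)))\<^sup>2 \<partial>circ) = ennreal (2 * pi) * (\<Sum>k. ennreal ((cmod (a k))\<^sup>2))"
    using LIMSEQ_unique by blast
  moreover have "(\<integral>\<^sup>+\<phi>. ennreal ((cmod (\<Sum>k. a k * cis (real k * \<phi>)))\<^sup>2) \<partial>circ) = ennreal (\<integral>\<phi>. (cmod (\<Sum>k. a k * cis (real k * \<phi>)))\<^sup>2 \<partial>circ)"
    by (intro nn_integral_eq_integral integrable_circ_bounded[of _ "?M\<^sup>2"]) (auto intro!: power_mono b')
  ultimately show ?thesis by simp
qed

text \<open>The negative frequencies are left out because the transform does not see them. The inequality expresses that the distance of \<open>\<Phi>\<close> to a partial Fourier sum is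
  nonnegative.\<close>
lemma bessel:
  assumes [measurable]: "\<Phi> \<in> borel_measurable borel" and b: "\<And>\<theta>. cmod (\<Phi> \<theta>) \<le> B"
  shows "(\<Sum>k. ennreal ((cmod (\<integral>\<theta>. \<Phi> \<theta> * cis (- (real k * \<theta>)) \<partial>circ))\<^sup>2)) \<le> ennreal (2 * pi) * (\<integral>\<^sup>+\<theta>. ennreal ((cmod (\<Phi> \<theta>))\<^sup>2) \<partial>circ)"
proof -
  define c where "c k = (\<integral>\<theta>. \<Phi> \<theta> * cis (- (real k * \<theta>)) \<partial>circ)" for k
  have i\<Phi>: "integrable circ (\<lambda>\<theta>. (cmod (\<Phi> \<theta>))\<^sup>2)"
    by (rule integrable_circ_bounded[of _ "B\<^sup>2"]) (auto intro!: power_mono b)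
  have nn: "(\<Sum>k<n. (cmod (c k))\<^sup>2) \<le> 2 * pi * (\<integral>\<theta>. (cmod (\<Phi> \<theta>))\<^sup>2 \<partial>circ)" for n
  proof -
    define P where "P \<theta> = (\<Sum>k<n. c k / (2 * pi) * cis (real k * \<theta>))" for \<theta>
    have [measurable]: "P \<in> borel_measurable borel" unfolding P_def[abs_def] by measurable
    have ik: "integrable circ (\<lambda>\<theta>. \<Phi> \<theta> * (cnj (c k / (2*pi)) * cis (- (real k * \<theta>))))" for k
      by (rule integrable_circ_bounded[of _ "B * cmod (c k / (2*pi))"]) (auto simp: norm_mult norm_divide intro!: divide_right_mono mult_right_mono b)
    have e: "\<Phi> \<theta> * cnj (P \<theta>) = (\<Sum>k<n. \<Phi> \<theta> * (cnj (c k / (2*pi)) * cis (- (real k * \<theta>))))" for \<theta>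
      by (simp add: P_def sum_distrib_left cis_cnj)
    have i1: "integrable circ (\<lambda>\<theta>. \<Phi> \<theta> * cnj (P \<theta>))" unfolding e by (rule Bochner_Integration.integrable_sum) (rule ik)
    have "(\<integral>\<theta>. \<Phi> \<theta> * cnj (P \<theta>) \<partial>circ) = (\<Sum>k<n. cnj (c k / (2*pi)) * c k)"
    proof -
      have "(\<integral>\<theta>. \<Phi> \<theta> * cnj (P \<theta>) \<partial>circ) = (\<Sum>k<n. (\<integral>\<theta>. cnj (c k / (2*pi)) * (\<Phi> \<theta> * cis (- (real k * \<theta>))) \<partial>circ))"
        unfolding e by (subst Bochner_Integration.integral_sum[OF ik]) (simp only: mult.left_commute)
      thus ?thesis by (simp only: integral_mult_right_zero c_def)
    qed
    also have "\<dots> = complex_of_real (\<Sum>k<n. (cmod (c k))\<^sup>2 / (2*pi))"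
      by (simp add: complex_norm_square mult.commute del: of_real_power)
    finally have m: "Re (\<integral>\<theta>. \<Phi> \<theta> * cnj (P \<theta>) \<partial>circ) = (\<Sum>k<n. (cmod (c k))\<^sup>2) / (2 * pi)"
      by (simp add: sum_divide_distrib)
    have PB: "cmod (P \<theta>) \<le> (\<Sum>k<n. cmod (c k / (2*pi)))" for \<theta>
      unfolding P_def by (rule order_trans[OF norm_sum]) (simp add: norm_mult norm_divide)
    have i2: "integrable circ (\<lambda>\<theta>. (cmod (P \<theta>))\<^sup>2)"
      by (rule integrable_circ_bounded[of _ "(\<Sum>k<n. cmod (c k / (2*pi)))\<^sup>2"]) (auto intro!: power_mono PB simp del: of_real_mult)
    have "0 \<le> (\<integral>\<theta>. (cmod (\<Phi> \<theta> - P \<theta>))\<^sup>2 \<partial>circ)" by simp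
    also have "\<dots> = (\<integral>\<theta>. (cmod (\<Phi> \<theta>))\<^sup>2 - 2 * Re (\<Phi> \<theta> * cnj (P \<theta>)) + (cmod (P \<theta>))\<^sup>2 \<partial>circ)"
      by (intro Bochner_Integration.integral_cong refl) (unfold cmod_power2, simp add: power2_eq_square algebra_simps)
    also have "\<dots> = (\<integral>\<theta>. (cmod (\<Phi> \<theta>))\<^sup>2 \<partial>circ) - 2 * Re (\<integral>\<theta>. \<Phi> \<theta> * cnj (P \<theta>) \<partial>circ) + (\<integral>\<theta>. (cmod (P \<theta>))\<^sup>2 \<partial>circ)"
    proof -
      have lin: "(\<integral>\<theta>. a \<theta> - 2 * b \<theta> + e \<theta> \<partial>circ) = (\<integral>\<theta>. a \<theta> \<partial>circ) - 2 * (\<integral>\<theta>. b \<theta> \<partial>circ) + (\<integral>\<theta>. e \<theta> \<partial>circ)"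
        if "integrable circ a" "integrable circ b" "integrable circ e" for a b e :: "real \<Rightarrow> real"
        using that by simp
      show ?thesis
        using lin[OF i\<Phi> integrable_Re[OF i1] i2] Bochner_Integration.integral_Re[OF i1] by simp
    qed
    also have "(\<integral>\<theta>. (cmod (P \<theta>))\<^sup>2 \<partial>circ) = (\<Sum>k<n. (cmod (c k))\<^sup>2) / (2 * pi)"
      unfolding P_def parseval_finite by (simp add: norm_divide power_divide sum_divide_distrib[symmetric] power2_eq_square)
    finally show ?thesis unfolding m by (simp add: field_simps)
  qed
  have "(\<Sum>k. ennreal ((cmod (c k))\<^sup>2)) \<le> ennreal (2 * pi * (\<integral>\<theta>. (cmod (\<Phi> \<theta>))\<^sup>2 \<partial>circ))"
    by (intro suminf_le_const) (auto simp: sum_ennreal intro!: ennreal_leI nn)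
  also have "\<dots> = ennreal (2 * pi) * (\<integral>\<^sup>+\<theta>. ennreal ((cmod (\<Phi> \<theta>))\<^sup>2) \<partial>circ)"
    using i\<Phi> by (subst ennreal_mult) (auto simp: nn_integral_eq_integral)
  finally show ?thesis unfolding c_def .
qed

section \<open>Two integrals over the half line\<close>

lemma powr_inject_pos: "\<gamma> > 0 \<Longrightarrow> x > 0 \<Longrightarrow> y > 0 \<Longrightarrow> x powr \<gamma> = y powr \<gamma> \<longleftrightarrow> x = (y::real)"
  by (metis less_irrefl linorder_neqE_linordered_idom powr_less_mono2 less_imp_le)

text \<open>The substitution \<open>t = c \<rho>\<^sup>\<gamma>\<close> turns Euler's integral into this one. Both radial integrals in the norm of
  a mode are of this form.\<close>
lemma nn_integral_powr_exp_powr: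
  fixes p c \<gamma> :: real
  assumes p: "p > -1" and c: "c > 0" and \<gamma>: "\<gamma> > 0"
  shows "(\<integral>\<^sup>+\<rho>. ennreal (\<rho> powr p * exp (- (c * \<rho> powr \<gamma>))) \<partial>half) =
    ennreal (c powr (- ((p + 1) / \<gamma>)) * Gamma ((p + 1) / \<gamma>) / \<gamma>)"
proof -
  define x where "x = (p + 1) / \<gamma>"
  have x: "x > 0" "\<gamma> * x = p + 1" using assms by (auto simp: x_def)
  define f where "f t = t powr (x - 1) / exp t" for t :: real
  define g where "g \<rho> = c * \<rho> powr \<gamma>" for \<rho>
  define g' where "g' \<rho> = c * (\<gamma> * \<rho> powr (\<gamma> - 1))" for \<rho>
  have img: "g ` {0<..} = {0<..}"
  proof safe
    fix y :: real assume "y > 0"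
    hence "y = g ((y / c) powr (1 / \<gamma>))" using c \<gamma> by (simp add: g_def powr_powr)
    thus "y \<in> g ` {0<..}" using \<open>y > 0\<close> c by (intro image_eqI[of _ _ "(y / c) powr (1 / \<gamma>)"]) auto
  qed (use c in \<open>auto simp: g_def\<close>)
  have inj: "inj_on g {0<..}"
    using c \<gamma> by (auto simp: inj_on_def g_def powr_inject_pos)
  have hi: "(f has_integral Gamma x) {0<..}"
  proof -
    have "((\<lambda>t. if t \<in> {0<..} then f t else 0) has_integral Gamma x) {0..}"
      unfolding f_def by (rule has_integral_spike[OF _ _ Gamma_integral_real[OF x(1)], of "{0}"]) auto
    thus ?thesis by (subst (asm) has_integral_restrict) auto
  qed
  hence ai: "f absolutely_integrable_on {0<..}"
    by (intro nonnegative_absolutely_integrable_1) (auto simp: f_def has_integral_integrable)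
  have der: "(g has_field_derivative g' \<rho>) (at \<rho> within {0<..})" if "\<rho> \<in> {0<..}" for \<rho>
  proof -
    have "((\<lambda>\<rho>. \<rho> powr \<gamma>) has_field_derivative \<gamma> * \<rho> powr (\<gamma> - 1)) (at \<rho>)"
      using that by (intro has_real_derivative_powr) auto
    from DERIV_cmult[OF this, of c] show ?thesis
      unfolding g_def g'_def by (rule has_field_derivative_at_within)
  qed
  have "(\<lambda>\<rho>. \<bar>g' \<rho>\<bar> * f (g \<rho>)) absolutely_integrable_on {0<..} \<and>
           integral {0<..} (\<lambda>\<rho>. \<bar>g' \<rho>\<bar> * f (g \<rho>)) = Gamma x"
    using has_absolute_integral_change_of_variables_1'[OF _ der inj, of f "Gamma x"] ai hi
    unfolding img by (auto simp: integral_unique)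
  hence "((\<lambda>\<rho>. \<bar>g' \<rho>\<bar> * f (g \<rho>)) has_integral Gamma x) {0<..}"
    using has_integral_iff absolutely_integrable_on_def by blast
  hence "((\<lambda>\<rho>. \<bar>g' \<rho>\<bar> * f (g \<rho>) * (c powr (-x) / \<gamma>)) has_integral Gamma x * (c powr (-x) / \<gamma>)) {0<..}"
    by (rule has_integral_mult_left)
  also have "?this \<longleftrightarrow> ((\<lambda>\<rho>. \<rho> powr p * exp (- (c * \<rho> powr \<gamma>))) has_integral Gamma x * (c powr (-x) / \<gamma>)) {0<..}"
  proof (rule has_integral_cong)
    fix \<rho> :: real assume "\<rho> \<in> {0<..}"
    hence \<rho>: "\<rho> > 0" by simp
    have "c * c powr (x - 1) * c powr (-x) = 1"
      using c by (simp add: powr_diff powr_minus)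
    moreover have "\<rho> powr (\<gamma> - 1) * \<rho> powr (\<gamma> * (x - 1)) = \<rho> powr p"
      using x(2) by (simp add: powr_add[symmetric] algebra_simps)
    moreover have "(c * \<rho> powr \<gamma>) powr (x - 1) = c powr (x - 1) * \<rho> powr (\<gamma> * (x - 1))"
      using c \<rho> by (simp add: powr_mult powr_powr)
    ultimately show "\<bar>g' \<rho>\<bar> * f (g \<rho>) * (c powr (-x) / \<gamma>) = \<rho> powr p * exp (- (c * \<rho> powr \<gamma>))"
      unfolding g_def g'_def f_def using c \<gamma> \<rho>
      by (simp add: exp_minus abs_mult field_simps)
  qed
  finally have "(\<integral>\<^sup>+\<rho>. ennreal (indicator {0<..} \<rho> * (\<rho> powr p * exp (- (c * \<rho> powr \<gamma>)))) \<partial>lborel) = Gamma x * (c powr (-x) / \<gamma>)"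
    by (intro nn_integral_has_integral_lebesgue) auto
  also have "(\<integral>\<^sup>+\<rho>. ennreal (indicator {0<..} \<rho> * (\<rho> powr p * exp (- (c * \<rho> powr \<gamma>)))) \<partial>lborel) =
    (\<integral>\<^sup>+\<rho>. ennreal (\<rho> powr p * exp (- (c * \<rho> powr \<gamma>))) \<partial>half)"
    by (subst nn_integral_half) (auto intro!: nn_integral_cong simp: ennreal_mult' ennreal_indicator mult.commute)
  finally show ?thesis unfolding x_def by (simp add: mult.commute)
qed

text \<open>This identity replaces the square in the denominator of the kernel by a superposition of
  exponentials, in which the variables \<open>s\<close> and \<open>t\<close> separate.\<close>
lemma integral_mult_exp_half:
  fixes w :: complex
  assumes w: "Re w > 0"
  shows "integrable half (\<lambda>x. x * exp (- (x * Re w)))"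
    and "(\<integral>x. of_real x * exp (- (of_real x * w)) \<partial>half) = 1 / w\<^sup>2"
proof -
  have "(\<integral>\<^sup>+\<rho>. ennreal (\<rho> powr 1 * exp (- (Re w * \<rho> powr 1))) \<partial>half) < \<infinity>"
    by (subst nn_integral_powr_exp_powr) (use w in auto)
  also have "(\<integral>\<^sup>+\<rho>. ennreal (\<rho> powr 1 * exp (- (Re w * \<rho> powr 1))) \<partial>half) = (\<integral>\<^sup>+x. ennreal (norm (x * exp (- (x * Re w)))) \<partial>half)"
    using AE_half by (intro nn_integral_cong_AE) (auto simp: mult.commute)
  finally show i1: "integrable half (\<lambda>x. x * exp (- (x * Re w)))"
    by (intro integrableI_bounded) auto
  let ?f = "\<lambda>x::real. of_real x * exp (- (of_real x * w))"
  let ?F = "\<lambda>x::real. - (of_real x / w + 1 / w\<^sup>2) * exp (- (of_real x * w))"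
  have w0: "w \<noteq> 0" using w by auto
  have i2: "set_integrable lborel {0<..} ?f"
    using i1 unfolding set_integrable_def by (subst (asm) integrable_half) (auto elim!: Bochner_Integration.integrable_bound simp: norm_mult)
  have "(LBINT x=ereal 0..\<infinity>. ?f x) = 0 - (- (1 / w\<^sup>2))"
  proof (rule interval_integral_FTC_integrable)
    show "(?F has_vector_derivative ?f x) (at x)" for x
    proof -
      have "((\<lambda>z. - (z / w + 1 / w\<^sup>2) * exp (- (z * w))) has_field_derivative of_real x * exp (- (of_real x * w))) (at (of_real x))"
        using w0 by (auto intro!: derivative_eq_intros simp: field_simps power2_eq_square)
      thus ?thesis by (rule has_vector_derivative_real_field)
    qed
    show "isCont ?f x" for x by (intro continuous_intros)
    show "set_integrable lborel (einterval (ereal 0) \<infinity>) ?f" using i2 by simp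
    have "isCont ?F 0" using w0 by (intro continuous_intros) auto
    hence "(?F \<longlongrightarrow> ?F 0) (at_right 0)" by (auto simp: isCont_def intro: filterlim_at_split[THEN iffD1, THEN conjunct2] tendsto_mono[OF at_le])
    thus "((?F \<circ> real_of_ereal) \<longlongrightarrow> - (1 / w\<^sup>2)) (at_right (ereal 0))"
      by (simp add: ereal_tendsto_simps)
    have "((\<lambda>x. (x / cmod w + 1 / (cmod w)\<^sup>2) * exp (- (x * Re w))) \<longlongrightarrow> 0) at_top"
      using w w0 by real_asymp
    hence "(?F \<longlongrightarrow> 0) at_top"
    proof (rule Lim_null_comparison[rotated])
      show "\<forall>\<^sub>F x in at_top. norm (?F x) \<le> (x / cmod w + 1 / (cmod w)\<^sup>2) * exp (- (x * Re w))"
        using eventually_ge_at_top[of 0]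
      proof eventually_elim
        fix x :: real assume x: "0 \<le> x"
        have "cmod (of_real x / w + 1 / w\<^sup>2) \<le> x / cmod w + 1 / (cmod w)\<^sup>2"
          using x by (intro order_trans[OF norm_triangle_ineq]) (simp add: norm_divide norm_power)
        thus "norm (?F x) \<le> (x / cmod w + 1 / (cmod w)\<^sup>2) * exp (- (x * Re w))"
          unfolding norm_mult norm_minus_cancel by (simp add: mult_right_mono)
      qed
    qed
    thus "((?F \<circ> real_of_ereal) \<longlongrightarrow> 0) (at_left \<infinity>)"
      by (simp add: ereal_tendsto_simps)
  qed auto
  also have "(LBINT x=ereal 0..\<infinity>. ?f x) = (\<integral>x. ?f x \<partial>half)"
    by (subst integral_half) (auto simp: interval_lebesgue_integral_def set_lebesgue_integral_def)
  finally show "(\<integral>x. ?f x \<partial>half) = 1 / w\<^sup>2" by simp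
qed

section \<open>The Leray integral in the frequency variable\<close>
definition ival :: "real \<Rightarrow> real \<Rightarrow> real measure" where "ival a b = density lborel (indicator {a..b})"

lemma sets_ival [simp, measurable_cong]: "sets (ival a b) = sets borel" by (simp add: ival_def)
lemma space_ival [simp]: "space (ival a b) = UNIV" by (simp add: ival_def)
lemma finite_ival [simp]: "finite_measure (ival a b)"
  by (rule finite_measureI) (simp add: ival_def emeasure_density emeasure_lborel_Icc_eq)

text \<open>Nonnegativity of the real part of the denominator at boundary points, that is, convexity of
  the domain in the form in which it is needed.\<close>
lemma young_powr:
  fixes r \<rho> \<gamma> :: real
  assumes "1 < \<gamma>" "0 \<le> r" "0 \<le> \<rho>"
  shows "\<gamma> * r powr (\<gamma> - 1) * \<rho> \<le> (\<gamma> - 1) * r powr \<gamma> + \<rho> powr \<gamma>"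
proof (cases "r = 0 \<or> \<rho> = 0")
  case False
  have "(r powr \<gamma>) powr ((\<gamma> - 1) / \<gamma>) * (\<rho> powr \<gamma>) powr (1 / \<gamma>) \<le> (\<gamma> - 1) / \<gamma> * r powr \<gamma> + 1 / \<gamma> * \<rho> powr \<gamma>"
    using assms False by (intro Youngs_inequality_0) (auto simp: field_simps)
  also have "(r powr \<gamma>) powr ((\<gamma> - 1) / \<gamma>) * (\<rho> powr \<gamma>) powr (1 / \<gamma>) = r powr (\<gamma> - 1) * \<rho>"
    using assms by (simp add: powr_powr)
  finally show ?thesis using assms by (simp add: field_simps)
qed (use assms in auto)

lemma integrable_bounded:
  fixes f :: "'a \<Rightarrow> 'b::{banach,second_countable_topology}"
  assumes "finite_measure M" "f \<in> borel_measurable M" "\<And>x. norm (f x) \<le> C"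
  shows "integrable M f"
  using assms by (intro finite_measure.integrable_const_bound[of M f C]) auto

lemma integral_density_support:
  fixes f :: "'a::euclidean_space \<Rightarrow> 'b::{banach,second_countable_topology}"
  assumes [measurable]: "f \<in> borel_measurable borel" "A \<in> sets borel" and s: "\<And>x. f x \<noteq> 0 \<Longrightarrow> x \<in> A"
  shows "(\<integral>x. f x \<partial>(density lborel (indicator A))) = (\<integral>x. f x \<partial>lborel)"
proof -
  have h: "density lborel (indicator A) = density lborel (\<lambda>x. ennreal (indicator A x))" by (simp add: ennreal_indicator)
  have "(\<integral>x. f x \<partial>(density lborel (indicator A))) = (\<integral>x. indicator A x *\<^sub>R f x \<partial>lborel)"
    unfolding h by (subst integral_density) auto
  also have "\<dots> = (\<integral>x. f x \<partial>lborel)"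
    by (intro Bochner_Integration.integral_cong refl) (use s in \<open>auto simp: indicator_def\<close>)
  finally show ?thesis .
qed

lemma integral_ival:
  fixes f :: "real \<Rightarrow> 'b::{banach,second_countable_topology}"
  assumes "f \<in> borel_measurable borel" and "\<And>x. f x \<noteq> 0 \<Longrightarrow> a \<le> x \<and> x \<le> b"
  shows "(\<integral>x. f x \<partial>ival a b) = (\<integral>x. f x \<partial>lborel)"
  unfolding ival_def by (rule integral_density_support) (use assms in auto)

lemma box_measure:
  "ival a b \<Otimes>\<^sub>M (circ \<Otimes>\<^sub>M ival c d) = density lborel (indicator ({a..b} \<times> {0..<2*pi} \<times> {c..d}))"
proof -
  have sfi: "sigma_finite_measure (ival u v)" for u v by (intro finite_measure.sigma_finite_measure) simp
  have 1: "circ \<Otimes>\<^sub>M ival c d = density (lborel \<Otimes>\<^sub>M lborel) (\<lambda>(x,y). indicator {0..<2*pi} x * indicator {c..d} y)"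
    unfolding circ_def ival_def
    by (rule pair_measure_density) (use sfi in \<open>auto simp: ival_def sigma_finite_lborel\<close>)
  have m: "(\<lambda>(x,y). indicator {0..<2*pi} x * indicator {c..d} y :: ennreal) \<in> borel_measurable (borel :: (real \<times> real) measure)"
    unfolding borel_prod[symmetric] by measurable
  have sf: "sigma_finite_measure (circ \<Otimes>\<^sub>M ival c d)"
    by (rule sigma_finite_pair_measure) (auto simp: sfi)
  have "ival a b \<Otimes>\<^sub>M (circ \<Otimes>\<^sub>M ival c d) = density (lborel \<Otimes>\<^sub>M (lborel \<Otimes>\<^sub>M lborel)) (\<lambda>(x,y). indicator {a..b} x * (case y of (x,y) \<Rightarrow> indicator {0..<2*pi} x * indicator {c..d} y))"
    using sf unfolding 1 unfolding ival_def
    by (intro pair_measure_density) (use m in \<open>auto simp: lborel_prod sigma_finite_lborel\<close>)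
  also have "(\<lambda>(x,y). indicator {a..b} x * (case y of (x,y) \<Rightarrow> indicator {0..<2*pi} x * indicator {c..d} y))
     = (indicator ({a..b} \<times> {0..<2*pi} \<times> {c..d}) :: real \<times> real \<times> real \<Rightarrow> ennreal)"
    by (auto simp: fun_eq_iff indicator_def)
  finally show ?thesis unfolding lborel_prod .
qed

lemma integrable_x_over_cube: "integrable half (\<lambda>x. x / (1 + \<bar>x\<bar> ^ 3))"
proof -
  have "set_integrable lborel UNIV (\<lambda>x::real. inverse (1 + x\<^sup>2))"
    using integrable_inverse_1_plus_square by simp
  hence i: "integrable lborel (\<lambda>x::real. inverse (1 + x\<^sup>2))"
    by (simp only: set_integrable_def indicator_UNIV scaleR_one)
  have "integrable lborel (\<lambda>x::real. 2 * (indicator {0<..} x *\<^sub>R inverse (1 + x\<^sup>2)))"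
    by (intro integrable_mult_right Bochner_Integration.integrable_bound[OF i]) (auto split: split_indicator)
  hence "integrable lborel (\<lambda>x::real. indicator {0<..} x *\<^sub>R (x / (1 + \<bar>x\<bar> ^ 3)))"
  proof (rule Bochner_Integration.integrable_bound)
    have "x / (1 + x ^ 3) \<le> 2 / (1 + x\<^sup>2)" if "x > 0" for x :: real
    proof -
      have "x \<le> 1 + x ^ 3"
      proof (cases "x \<le> 1")
        case False
        thus ?thesis using power_increasing[of 1 3 x] by simp
      qed (use that in \<open>auto intro: order_trans\<close>)
      hence "x * (1 + x\<^sup>2) \<le> 2 * (1 + x ^ 3)" by (simp add: power2_eq_square power3_eq_cube algebra_simps)
      moreover have "0 < 1 + x ^ 3" "0 < 1 + x\<^sup>2" using that by (auto simp: add_pos_pos)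
      ultimately show ?thesis by (simp add: divide_simps)
    qed
    thus "AE x in lborel. norm (indicator {0<..} x *\<^sub>R (x / (1 + \<bar>x\<bar> ^ 3))) \<le> norm (2 * (indicator {0<..} x *\<^sub>R inverse (1 + x\<^sup>2)) :: real)"
      by (auto simp: indicator_def inverse_eq_divide)
  qed auto
  thus ?thesis by (subst integrable_half) auto
qed

text \<open>\<open>F\<close> is a test function in the coordinates \<open>(r, \<theta>, s)\<close>, extended by 0 to \<open>r \<le> 0\<close>. Beyond
  continuity, smoothness enters only through \<open>decay\<close>: a cubic rate makes \<open>x\<close> times the Fourier transform integrable over the
  half line, so the frequency integral converges absolutely up to the boundary of the domain. The constant
  \<open>B\<close> serves for both bounds.\<close>
locale leray_data =
  fixes \<gamma> :: real and F :: "real \<Rightarrow> real \<Rightarrow> real \<Rightarrow> complex" and r0 R S B :: real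
  assumes \<gamma>: "\<gamma> > 1" and r0: "0 < r0"
    and meas: "(\<lambda>(r,\<theta>,s). F r \<theta> s) \<in> borel_measurable (borel \<Otimes>\<^sub>M (borel \<Otimes>\<^sub>M borel))"
    and bound: "\<And>r \<theta> s. cmod (F r \<theta> s) \<le> B"
    and supp: "\<And>r \<theta> s. F r \<theta> s \<noteq> 0 \<Longrightarrow> r0 \<le> r \<and> r \<le> R \<and> - S \<le> s \<and> s \<le> S"
    and cont: "\<And>r \<theta>. continuous_on UNIV (F r \<theta>)"
    and decay: "\<And>r \<theta> x. cmod (fourier (F r \<theta>) x) * (1 + \<bar>x\<bar> ^ 3) \<le> B"
begin

lemma measurable_F [measurable (raw)]:
  assumes [measurable]: "a \<in> borel_measurable M" "b \<in> borel_measurable M" "c \<in> borel_measurable M"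
  shows "(\<lambda>x. F (a x) (b x) (c x)) \<in> borel_measurable M"
  using measurable_compose[OF _ meas, of "\<lambda>x. (a x, b x, c x)" M] by simp

lemma B_nonneg: "0 \<le> B"
  using bound[of 0 0 0] norm_ge_zero order_trans by blast

definition F_hat :: "real \<Rightarrow> real \<Rightarrow> real \<Rightarrow> complex" where "F_hat r \<theta> x = fourier (F r \<theta>) x"

lemma measurable_F_hat [measurable (raw)]:
  assumes [measurable]: "a \<in> borel_measurable M" "b \<in> borel_measurable M" "c \<in> borel_measurable M"
  shows "(\<lambda>x. F_hat (a x) (b x) (c x)) \<in> borel_measurable M"
  unfolding F_hat_def fourier_def by measurable

lemma F_hat_decay: "cmod (F_hat r \<theta> x) \<le> B / (1 + \<bar>x\<bar> ^ 3)"
proof -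
  have "0 < 1 + \<bar>x\<bar> ^ 3" by (simp add: add_pos_nonneg)
  thus ?thesis using decay[of r \<theta> x] by (simp add: F_hat_def pos_le_divide_eq)
qed

lemma F_hat_bound: "cmod (F_hat r \<theta> x) \<le> B"
  by (rule order_trans[OF F_hat_decay]) (use B_nonneg in \<open>simp add: divide_le_eq add_pos_nonneg mult_le_cancel_left1\<close>)

lemma F_hat_supp: "F_hat r \<theta> x \<noteq> 0 \<Longrightarrow> r0 \<le> r \<and> r \<le> R"
  using supp[of r \<theta>] unfolding F_hat_def fourier_def
  by (metis (no_types, lifting) Bochner_Integration.integral_cong integral_zero mult_zero_left)

lemma integrable_F: "integrable lborel (F r \<theta>)"
proof -
  have "integrable lborel (\<lambda>s. B * indicator {-S..S} s)"
    by (intro integrable_mult_right integrable_real_indicator) (auto simp: emeasure_lborel_Icc_eq)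
  thus ?thesis
    by (rule Bochner_Integration.integrable_bound) (use supp[of r \<theta>] bound[of r \<theta>] B_nonneg in \<open>auto simp: indicator_def\<close>)
qed

lemma fourier_ival: "(\<integral>s. F r \<theta> s * cis (- (x * s)) \<partial>ival (-S) S) = F_hat r \<theta> x"
  unfolding F_hat_def fourier_def by (rule integral_ival) (use supp[of r \<theta>] in auto)

text \<open>
  Integrating over a box that contains the support makes the measures finite, so bounded
  measurable functions are integrable and Fubini's theorem applies to them.\<close>
definition polar_box :: "(real \<times> real) measure" where "polar_box = ival r0 R \<Otimes>\<^sub>M circ"

lemma sets_polar_box [simp, measurable_cong]: "sets polar_box = sets (borel \<Otimes>\<^sub>M borel)"
  unfolding polar_box_def by (intro sets_pair_measure_cong) auto

lemma finite_polar_box [simp]: "finite_measure polar_box"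
  unfolding polar_box_def by (intro finite_measure_pair_measure) auto

text \<open>
  The factor \<open>r\<^bsup>\<gamma>-1\<^esup> e\<^bsup>-xw\<^esup>\<close> with the part of \<open>w\<close> that depends on \<open>s\<close>, \<open>t\<close> and \<open>\<epsilon>\<close> removed.\<close>
definition kernel :: "real \<Rightarrow> real \<Rightarrow> real \<Rightarrow> real \<times> real \<Rightarrow> complex" where
  "kernel x \<rho> \<phi> = (\<lambda>(r, \<theta>). of_real (r powr (\<gamma> - 1) * exp (- (x * ((\<gamma> - 1) * r powr \<gamma> + \<rho> powr \<gamma>)))) *
     exp (of_real (x * \<gamma> * r powr (\<gamma> - 1) * \<rho>) * cis (\<phi> - \<theta>)))"

lemma kernel_bound:
  assumes "x \<ge> 0" "\<rho> \<ge> 0" "r \<ge> 0" shows "cmod (kernel x \<rho> \<phi> (r, \<theta>)) \<le> r powr (\<gamma> - 1)"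
proof -
  have "cos (\<phi> - \<theta>) * (x * (\<gamma> * r powr (\<gamma> - 1) * \<rho>)) \<le> 1 * (x * (\<gamma> * r powr (\<gamma> - 1) * \<rho>))"
    using assms \<gamma> by (intro mult_right_mono) auto
  also have "\<dots> \<le> x * ((\<gamma> - 1) * r powr \<gamma> + \<rho> powr \<gamma>)"
    using young_powr[OF \<gamma> assms(3,2)] assms by (simp add: mult_left_mono)
  finally have "exp (- (x * ((\<gamma> - 1) * r powr \<gamma> + \<rho> powr \<gamma>))) * exp (x * \<gamma> * r powr (\<gamma> - 1) * \<rho> * cos (\<phi> - \<theta>)) \<le> 1"
    unfolding exp_add[symmetric] by (simp add: mult_ac)
  hence "r powr (\<gamma> - 1) * (exp (- (x * ((\<gamma> - 1) * r powr \<gamma> + \<rho> powr \<gamma>))) * exp (x * \<gamma> * r powr (\<gamma> - 1) * \<rho> * cos (\<phi> - \<theta>))) \<le> r powr (\<gamma> - 1) * 1"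
    by (intro mult_left_mono) auto
  thus ?thesis unfolding kernel_def by (simp add: norm_mult mult_ac)
qed

text \<open>
  The frequency \<open>x\<close> part of the transform at \<open>(\<rho>, \<phi>)\<close>, without the factor \<open>x\<close> and the constant.\<close>
definition slice :: "real \<Rightarrow> real \<Rightarrow> real \<Rightarrow> complex" where
  "slice x \<rho> \<phi> = (\<integral>q. kernel x \<rho> \<phi> q * F_hat (fst q) (snd q) x \<partial>polar_box)"

lemma measurable_kernel [measurable (raw)]:
  assumes [measurable]: "a \<in> borel_measurable M" "b \<in> borel_measurable M" "c \<in> borel_measurable M" "d \<in> borel_measurable M" "e \<in> borel_measurable M"
  shows "(\<lambda>x. kernel (a x) (b x) (c x) (d x, e x)) \<in> borel_measurable M"
  unfolding kernel_def by measurable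

lemma measurable_kernel_F_hat [measurable (raw)]:
  assumes [measurable]: "a \<in> borel_measurable M" "b \<in> borel_measurable M" "c \<in> borel_measurable M" "d \<in> borel_measurable M" "q \<in> M \<rightarrow>\<^sub>M borel \<Otimes>\<^sub>M borel"
  shows "(\<lambda>x. kernel (a x) (b x) (c x) (q x) * F_hat (fst (q x)) (snd (q x)) (d x)) \<in> borel_measurable M"
proof -
  have "(\<lambda>x. kernel (a x) (b x) (c x) (fst (q x), snd (q x)) * F_hat (fst (q x)) (snd (q x)) (d x)) \<in> borel_measurable M"
    by measurable
  thus ?thesis by simp
qed

lemma measurable_slice [measurable (raw)]:
  assumes [measurable]: "a \<in> borel_measurable M" "b \<in> borel_measurable M" "c \<in> borel_measurable M"
  shows "(\<lambda>x. slice (a x) (b x) (c x)) \<in> borel_measurable M"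
proof -
  interpret polar_box: finite_measure polar_box by simp
  show ?thesis unfolding slice_def by measurable
qed

lemma kernel_F_hat_bound:
  assumes "x \<ge> 0" "\<rho> \<ge> 0"
  shows "cmod (kernel x \<rho> \<phi> q * F_hat (fst q) (snd q) x) \<le> R powr (\<gamma> - 1) * (B / (1 + \<bar>x\<bar> ^ 3))"
proof (cases "F_hat (fst q) (snd q) x = 0")
  case True
  thus ?thesis using B_nonneg by (simp add: add_nonneg_nonneg)
next
  case False
  from F_hat_supp[OF this] r0 have r: "0 \<le> fst q" "fst q \<le> R" by auto
  have "cmod (kernel x \<rho> \<phi> q) \<le> fst q powr (\<gamma> - 1)"
    using kernel_bound[OF assms r(1), of \<phi> "snd q"] by simp
  also have "\<dots> \<le> R powr (\<gamma> - 1)" using r \<gamma> by (intro powr_mono2) auto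
  finally show ?thesis unfolding norm_mult using F_hat_decay[of "fst q" "snd q" x] by (intro mult_mono) auto
qed

lemma kernel_F_hat_integrable:
  assumes "x \<ge> 0" "\<rho> \<ge> 0"
  shows "integrable polar_box (\<lambda>q. kernel x \<rho> \<phi> q * F_hat (fst q) (snd q) x)"
  by (rule integrable_bounded[OF finite_polar_box _ kernel_F_hat_bound[OF assms]]) measurable

definition slice_const :: real where "slice_const = measure polar_box UNIV * (R powr (\<gamma> - 1) * B)"

lemma space_polar_box [simp]: "space polar_box = UNIV" by (simp add: polar_box_def space_pair_measure)

lemma slice_bound:
  assumes "x \<ge> 0" "\<rho> \<ge> 0"
  shows "cmod (slice x \<rho> \<phi>) \<le> slice_const / (1 + \<bar>x\<bar> ^ 3)"
proof -
  have "cmod (slice x \<rho> \<phi>) \<le> (\<integral>q. cmod (kernel x \<rho> \<phi> q * F_hat (fst q) (snd q) x) \<partial>polar_box)"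
    unfolding slice_def by (rule integral_norm_bound)
  also have "\<dots> \<le> (\<integral>q. R powr (\<gamma> - 1) * (B / (1 + \<bar>x\<bar> ^ 3)) \<partial>polar_box)"
    using finite_polar_box by (intro Bochner_Integration.integral_mono integrable_norm kernel_F_hat_integrable kernel_F_hat_bound assms) (simp add: finite_measure.integrable_const)
  also have "\<dots> = slice_const / (1 + \<bar>x\<bar> ^ 3)" by (simp add: slice_const_def)
  finally show ?thesis .
qed

definition full_box :: "(real \<times> real \<times> real) measure" where
  "full_box = ival r0 R \<Otimes>\<^sub>M (circ \<Otimes>\<^sub>M ival (-S) S)"

lemma sets_full_box [simp, measurable_cong]: "sets full_box = sets (borel \<Otimes>\<^sub>M (borel \<Otimes>\<^sub>M borel))"
  unfolding full_box_def by (intro sets_pair_measure_cong) auto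

lemma finite_full_box [simp]: "finite_measure full_box"
  unfolding full_box_def by (intro finite_measure_pair_measure) auto

lemma integral_full_box:
  fixes h :: "real \<times> real \<times> real \<Rightarrow> complex"
  assumes i: "integrable full_box h"
  shows "(\<integral>p. h p \<partial>full_box) = (\<integral>r. \<integral>\<theta>. \<integral>s. h (r, \<theta>, s) \<partial>ival (-S) S \<partial>circ \<partial>ival r0 R)"
proof -
  have fp: "finite_measure (circ \<Otimes>\<^sub>M ival (-S) S)" by (intro finite_measure_pair_measure) auto
  interpret I: pair_sigma_finite circ "ival (-S) S"
    by (simp add: pair_sigma_finite_def finite_measure.sigma_finite_measure)
  interpret O: pair_sigma_finite "ival r0 R" "circ \<Otimes>\<^sub>M ival (-S) S"
    using fp by (simp add: pair_sigma_finite_def finite_measure.sigma_finite_measure)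
  have "(\<integral>p. h p \<partial>full_box) = (\<integral>r. \<integral>y. h (r, y) \<partial>(circ \<Otimes>\<^sub>M ival (-S) S) \<partial>ival r0 R)"
    using O.integral_fst'[of h] i unfolding full_box_def by simp
  also have "\<dots> = (\<integral>r. \<integral>\<theta>. \<integral>s. h (r, \<theta>, s) \<partial>ival (-S) S \<partial>circ \<partial>ival r0 R)"
  proof (rule integral_cong_AE)
    have [measurable]: "h \<in> borel_measurable (borel \<Otimes>\<^sub>M (borel \<Otimes>\<^sub>M borel))"
      using borel_measurable_integrable[OF i] by (simp cong: measurable_cong_sets)
    show "AE r in ival r0 R. (\<integral>y. h (r, y) \<partial>(circ \<Otimes>\<^sub>M ival (-S) S)) = (\<integral>\<theta>. \<integral>s. h (r, \<theta>, s) \<partial>ival (-S) S \<partial>circ)"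
      using O.AE_integrable_fst'[OF i[unfolded full_box_def]]
    proof eventually_elim
      case (elim r)
      show ?case using I.integral_fst'[OF elim] by simp
    qed
    interpret C: sigma_finite_measure "circ \<Otimes>\<^sub>M ival (-S) S" using fp by (rule finite_measure.sigma_finite_measure)
    interpret D: sigma_finite_measure circ by simp
    interpret E: sigma_finite_measure "ival (-S) S" by (simp add: finite_measure.sigma_finite_measure)
    show "(\<lambda>r. \<integral>y. h (r, y) \<partial>(circ \<Otimes>\<^sub>M ival (-S) S)) \<in> borel_measurable (ival r0 R)" by measurable
    show "(\<lambda>r. \<integral>\<theta>. \<integral>s. h (r, \<theta>, s) \<partial>ival (-S) S \<partial>circ) \<in> borel_measurable (ival r0 R)" by measurable
  qed
  finally show ?thesis .
qed

lemma integral_polar_box: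
  fixes h :: "real \<times> real \<Rightarrow> complex"
  assumes i: "integrable polar_box h"
  shows "(\<integral>q. h q \<partial>polar_box) = (\<integral>r. \<integral>\<theta>. h (r, \<theta>) \<partial>circ \<partial>ival r0 R)"
proof -
  interpret I: pair_sigma_finite "ival r0 R" circ
    by (simp add: pair_sigma_finite_def finite_measure.sigma_finite_measure)
  show ?thesis using I.integral_fst'[of h] i unfolding polar_box_def by simp
qed

text \<open>
  Twice the denominator of the Leray kernel (before squaring) at the point
  \<open>(\<rho>, \<phi>, t)\<close> raised by \<open>\<epsilon>\<close>.\<close>
definition phase :: "real \<Rightarrow> real \<Rightarrow> real \<Rightarrow> real \<Rightarrow> real \<times> real \<times> real \<Rightarrow> complex" where
  "phase \<epsilon> \<rho> \<phi> t = (\<lambda>(r, \<theta>, s). of_real ((\<gamma> - 1) * r powr \<gamma> + \<rho> powr \<gamma> + \<epsilon>)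
     - of_real (\<gamma> * r powr (\<gamma> - 1) * \<rho>) * cis (\<phi> - \<theta>) + \<i> * of_real (s - t))"

lemma Re_phase:
  assumes "0 \<le> r" "0 \<le> \<rho>" shows "Re (phase \<epsilon> \<rho> \<phi> t (r, \<theta>, s)) \<ge> \<epsilon>"
proof -
  have "\<gamma> * r powr (\<gamma> - 1) * \<rho> * cos (\<phi> - \<theta>) \<le> \<gamma> * r powr (\<gamma> - 1) * \<rho> * 1"
    using assms \<gamma> by (intro mult_left_mono) auto
  thus ?thesis using young_powr[OF \<gamma> assms] by (simp add: phase_def)
qed

lemma exp_phase:
  "of_real (r powr (\<gamma> - 1)) * exp (- (of_real x * phase \<epsilon> \<rho> \<phi> t (r, \<theta>, s))) =
     of_real (exp (- (x * \<epsilon>))) * cis (x * t) * kernel x \<rho> \<phi> (r, \<theta>) * cis (- (x * s))"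
proof -
  have "- (of_real x * phase \<epsilon> \<rho> \<phi> t (r, \<theta>, s)) = of_real (- (x * \<epsilon>)) + \<i> * of_real (x * t)
     + of_real (- (x * ((\<gamma> - 1) * r powr \<gamma> + \<rho> powr \<gamma>))) + of_real (x * \<gamma> * r powr (\<gamma> - 1) * \<rho>) * cis (\<phi> - \<theta>) + \<i> * of_real (- (x * s))"
    unfolding phase_def prod.case by (simp add: algebra_simps)
  thus ?thesis unfolding kernel_def prod.case
    by (simp only: exp_add cis_conv_exp of_real_mult exp_of_real mult_ac)
qed

lemma leray_eq_full_box:
  assumes f: "\<And>r \<theta> s. 0 < r \<Longrightarrow> 0 \<le> \<theta> \<Longrightarrow> \<theta> < 2 * pi \<Longrightarrow> f (par \<gamma> (r, \<theta>, s)) = F r \<theta> s"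
  shows "leray \<gamma> f (of_real \<rho> * cis \<phi>, Complex t (\<rho> powr \<gamma>) + \<i> * of_real \<epsilon>) =
    of_real (\<gamma>\<^sup>2 / (4 * pi\<^sup>2)) * (\<integral>p. (case p of (r, \<theta>, s) \<Rightarrow> F r \<theta> s * of_real (r powr (\<gamma> - 1)) / (phase \<epsilon> \<rho> \<phi> t p)\<^sup>2) \<partial>full_box)"
proof -
  let ?h = "\<lambda>p. case p of (r, \<theta>, s) \<Rightarrow> F r \<theta> s * of_real (r powr (\<gamma> - 1)) / (phase \<epsilon> \<rho> \<phi> t p)\<^sup>2"
  let ?z = "(of_real \<rho> * cis \<phi>, Complex t (\<rho> powr \<gamma>) + \<i> * of_real \<epsilon>)"
  let ?A = "{r0..R} \<times> {0..<2*pi} \<times> {-S..S}"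
  have D: "of_real (\<gamma> / 2) * (of_real (r powr \<gamma>) - of_real (r powr (\<gamma> - 1)) * cis (- \<theta>) * fst ?z)
        + \<i> / 2 * (Complex s (r powr \<gamma>) - snd ?z) = phase \<epsilon> \<rho> \<phi> t (r, \<theta>, s) / 2" for r \<theta> s
  proof -
    have c: "cis (- \<theta>) * (of_real \<rho> * cis \<phi>) = of_real \<rho> * cis (\<phi> - \<theta>)"
      by (simp add: mult.left_commute cis_mult)
    have c1: "of_real (r powr (\<gamma> - 1)) * cis (- \<theta>) * fst ?z = of_real (r powr (\<gamma> - 1) * \<rho>) * cis (\<phi> - \<theta>)"
      unfolding mult.assoc fst_conv c by simp
    have c2: "\<i> / 2 * (Complex s (r powr \<gamma>) - snd ?z) = of_real ((\<rho> powr \<gamma> + \<epsilon> - r powr \<gamma>) / 2) + \<i> * of_real ((s - t) / 2)"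
      by (simp add: complex_eq_iff)
    show ?thesis unfolding c1 c2 phase_def prod.case
      by (simp add: field_simps)
  qed
  have pt: "indicator pdom p *\<^sub>R (case p of (r, \<theta>, s) \<Rightarrow> f (par \<gamma> (r, \<theta>, s)) * of_real (r powr (\<gamma> - 1)) /
       (of_real (\<gamma> / 2) * (of_real (r powr \<gamma>) - of_real (r powr (\<gamma> - 1)) * cis (- \<theta>) * fst ?z)
        + \<i> / 2 * (Complex s (r powr \<gamma>) - snd ?z))\<^sup>2) = 4 * (indicator ?A p *\<^sub>R ?h p)" for p
  proof (cases p)
    case (fields r \<theta> s)
    show ?thesis
    proof (cases "0 < r \<and> 0 \<le> \<theta> \<and> \<theta> < 2 * pi")
      case True
      show ?thesis
      proof (cases "F r \<theta> s = 0")
        case True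
        thus ?thesis using \<open>0 < r \<and> _\<close> by (simp add: fields f)
      next
        case False
        from supp[OF this] True have "p \<in> ?A" "p \<in> pdom" by (auto simp: fields pdom_def)
        thus ?thesis using True unfolding fields prod.case D by (simp add: f power_divide)
      qed
    next
      case False
      hence "p \<notin> pdom" "p \<notin> ?A" using r0 by (auto simp: fields pdom_def)
      thus ?thesis by simp
    qed
  qed
  have [measurable]: "?h \<in> borel_measurable (borel :: (real \<times> real \<times> real) measure)"
    unfolding borel_prod[symmetric] phase_def by measurable
  have "(\<integral>p. ?h p \<partial>full_box) = (\<integral>p. indicator ?A p *\<^sub>R ?h p \<partial>lborel)"
  proof -
    have "full_box = density lborel (\<lambda>p. ennreal (indicator ?A p))" unfolding full_box_def box_measure by (simp add: ennreal_indicator)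
    moreover have "?A \<in> sets borel" unfolding borel_prod[symmetric] by measurable
    ultimately show ?thesis by (simp only:) (subst integral_density, auto)
  qed
  thus ?thesis unfolding leray_eq set_lebesgue_integral_def pt integral_mult_right_zero by simp
qed

text \<open>Inserting the exponential representation of \<open>1 / w\<^sup>2\<close> and integrating over \<open>s\<close> first produces the
  Fourier transform of \<open>F\<close>. Raising the point by \<open>\<epsilon>\<close> keeps \<open>Re w \<ge> \<epsilon>\<close>, which is what makes
  the double integral absolutely convergent.\<close>
lemma leray_shifted:
  assumes f: "\<And>r \<theta> s. 0 < r \<Longrightarrow> 0 \<le> \<theta> \<Longrightarrow> \<theta> < 2 * pi \<Longrightarrow> f (par \<gamma> (r, \<theta>, s)) = F r \<theta> s"
    and \<rho>: "0 \<le> \<rho>" and \<epsilon>: "0 < \<epsilon>"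
  shows "leray \<gamma> f (of_real \<rho> * cis \<phi>, Complex t (\<rho> powr \<gamma>) + \<i> * of_real \<epsilon>) =
    of_real (\<gamma>\<^sup>2 / (4 * pi\<^sup>2)) * (\<integral>x. of_real (x * exp (- (x * \<epsilon>))) * cis (x * t) * slice x \<rho> \<phi> \<partial>half)"
proof -
  let ?w = "phase \<epsilon> \<rho> \<phi> t"
  let ?G = "\<lambda>(r, \<theta>, s). F r \<theta> s * of_real (r powr (\<gamma> - 1))"
  let ?H = "\<lambda>(p, x). ?G p * (of_real x * exp (- (of_real x * ?w p)))"
  interpret P: pair_sigma_finite full_box half by (simp add: pair_sigma_finite_def finite_measure.sigma_finite_measure)
  have Gb: "cmod (?G p) \<le> B * R powr (\<gamma> - 1)" for p
  proof (cases p)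
    case (fields r \<theta> s)
    show ?thesis
    proof (cases "F r \<theta> s = 0")
      case False
      from supp[OF this] r0 \<gamma> have "r powr (\<gamma> - 1) \<le> R powr (\<gamma> - 1)" by (intro powr_mono2) auto
      thus ?thesis using bound[of r \<theta> s] B_nonneg by (auto simp: fields norm_mult intro!: mult_mono)
    qed (use B_nonneg in \<open>simp add: fields\<close>)
  qed
  have Gr: "0 \<le> fst p" if "?G p \<noteq> 0" for p
    using supp r0 that by (cases p) force
  have Rw: "\<epsilon> \<le> Re (?w p)" if "?G p \<noteq> 0" for p
    using Gr[OF that] Re_phase[OF _ \<rho>] by (cases p) auto
  have Gm [measurable]: "?G \<in> borel_measurable (borel \<Otimes>\<^sub>M (borel \<Otimes>\<^sub>M borel))" by measurable
  have wm [measurable]: "?w \<in> borel_measurable (borel \<Otimes>\<^sub>M (borel \<Otimes>\<^sub>M borel))" unfolding phase_def by measurable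
  have Hm [measurable]: "?H \<in> borel_measurable ((borel \<Otimes>\<^sub>M (borel \<Otimes>\<^sub>M borel)) \<Otimes>\<^sub>M borel)" by measurable
  have ex: "x * exp (- (x * \<epsilon>)) = x * exp (- (x * Re (of_real \<epsilon>)))" for x by simp
  have ie: "integrable half (\<lambda>x. x * exp (- (x * \<epsilon>)))"
    using integral_mult_exp_half(1)[of "of_real \<epsilon>"] \<epsilon> by simp
  have Hb: "cmod (?H (p, x)) \<le> (B * R powr (\<gamma> - 1)) * (x * exp (- (x * \<epsilon>)))" if "x > 0" for p x
  proof (cases "?G p = 0")
    case False
    have "exp (- (x * Re (?w p))) \<le> exp (- (x * \<epsilon>))" using Rw[OF False] that by simp
    thus ?thesis using Gb[of p] that B_nonneg unfolding norm_mult prod.case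
      by (intro mult_mono) (auto simp: norm_mult)
  qed (use B_nonneg that in simp)
  have ipx: "integrable half (\<lambda>x. ?H (p, x))" for p
  proof (rule Bochner_Integration.integrable_bound[OF integrable_mult_right[OF ie, of "B * R powr (\<gamma> - 1)"]])
    show "AE x in half. norm (?H (p, x)) \<le> norm (B * R powr (\<gamma> - 1) * (x * exp (- (x * \<epsilon>))))"
      using AE_half by eventually_elim (use Hb B_nonneg in \<open>auto intro: order_trans\<close>)
    show "(\<lambda>x. ?H (p, x)) \<in> borel_measurable half"
      using measurable_compose[OF measurable_Pair1'[of p] Hm]
      by (simp add: space_pair_measure cong: measurable_cong_sets)
  qed
  have iH: "integrable (full_box \<Otimes>\<^sub>M half) ?H"
  proof (rule P.Fubini_integrable)
    show "?H \<in> borel_measurable (full_box \<Otimes>\<^sub>M half)" by measurable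
    show "AE p in full_box. integrable half (\<lambda>x. ?H (p, x))" using ipx by simp
    show "integrable full_box (\<lambda>p. \<integral>x. norm (?H (p, x)) \<partial>half)"
    proof (rule integrable_bounded[OF finite_full_box])
      interpret hs: sigma_finite_measure half by simp
      show "(\<lambda>p. \<integral>x. norm (?H (p, x)) \<partial>half) \<in> borel_measurable full_box" by measurable
      fix p
      have "(\<integral>x. norm (?H (p, x)) \<partial>half) \<le> (\<integral>x. (B * R powr (\<gamma> - 1)) * (x * exp (- (x * \<epsilon>))) \<partial>half)"
        by (rule integral_mono_AE[OF integrable_norm[OF ipx] integrable_mult_right[OF ie]])
           (use AE_half in \<open>eventually_elim, use Hb in auto\<close>)
      thus "norm (\<integral>x. norm (?H (p, x)) \<partial>half) \<le> (\<integral>x. (B * R powr (\<gamma> - 1)) * (x * exp (- (x * \<epsilon>))) \<partial>half)"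
        by (subst real_norm_def, subst abs_of_nonneg) auto
    qed
  qed
  have "(\<integral>p. (case p of (r, \<theta>, s) \<Rightarrow> F r \<theta> s * of_real (r powr (\<gamma> - 1)) / (?w p)\<^sup>2) \<partial>full_box) = (\<integral>p. \<integral>x. ?H (p, x) \<partial>half \<partial>full_box)"
  proof (intro Bochner_Integration.integral_cong refl)
    fix p
    have "(\<integral>x. ?H (p, x) \<partial>half) = ?G p * (\<integral>x. of_real x * exp (- (of_real x * ?w p)) \<partial>half)" by simp
    also have "\<dots> = ?G p / (?w p)\<^sup>2"
      using integral_mult_exp_half(2)[of "?w p"] Rw[of p] \<epsilon> by (cases "?G p = 0") auto
    finally show "(case p of (r, \<theta>, s) \<Rightarrow> F r \<theta> s * of_real (r powr (\<gamma> - 1)) / (?w p)\<^sup>2) = (\<integral>x. ?H (p, x) \<partial>half)"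
      by (simp add: case_prod_unfold)
  qed
  also have "\<dots> = (\<integral>x. \<integral>p. ?H (p, x) \<partial>full_box \<partial>half)"
    by (rule P.Fubini_integral[symmetric]) (use iH in \<open>simp add: case_prod_unfold\<close>)
  also have "\<dots> = (\<integral>x. of_real (x * exp (- (x * \<epsilon>))) * cis (x * t) * slice x \<rho> \<phi> \<partial>half)"
  proof (rule integral_cong_AE)
    interpret polar_box: sigma_finite_measure polar_box by (simp add: finite_measure.sigma_finite_measure)
    interpret Q: sigma_finite_measure full_box by (simp add: finite_measure.sigma_finite_measure)
    show "(\<lambda>x. of_real (x * exp (- (x * \<epsilon>))) * cis (x * t) * slice x \<rho> \<phi>) \<in> borel_measurable half" by measurable
    show "(\<lambda>x. \<integral>p. ?H (p, x) \<partial>full_box) \<in> borel_measurable half" by measurable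
    show "AE x in half. (\<integral>p. ?H (p, x) \<partial>full_box) = of_real (x * exp (- (x * \<epsilon>))) * cis (x * t) * slice x \<rho> \<phi>"
      using AE_half
    proof eventually_elim
      fix x :: real assume x: "0 < x"
      have iQ: "integrable full_box (\<lambda>p. ?H (p, x))"
        using measurable_compose[OF measurable_Pair2'[of x] Hm]
        by (intro integrable_bounded[OF finite_full_box _ Hb[OF x]])  (simp cong: measurable_cong_sets)
      have "(\<integral>p. ?H (p, x) \<partial>full_box) = (\<integral>r. \<integral>\<theta>. \<integral>s. ?H ((r, \<theta>, s), x) \<partial>ival (-S) S \<partial>circ \<partial>ival r0 R)"
        by (rule integral_full_box[OF iQ])
      also have "\<dots> = (\<integral>r. \<integral>\<theta>. (of_real (x * exp (- (x * \<epsilon>))) * cis (x * t)) * (kernel x \<rho> \<phi> (r, \<theta>) * F_hat r \<theta> x) \<partial>circ \<partial>ival r0 R)"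
      proof (intro Bochner_Integration.integral_cong refl)
        fix r \<theta>
        have "?H ((r, \<theta>, s), x) = (of_real (x * exp (- (x * \<epsilon>))) * cis (x * t)) * kernel x \<rho> \<phi> (r, \<theta>) * (F r \<theta> s * cis (- (x * s)))" for s
        proof -
          have "?H ((r, \<theta>, s), x) = F r \<theta> s * of_real x * (of_real (r powr (\<gamma> - 1)) * exp (- (of_real x * ?w (r, \<theta>, s))))"
            by (simp add: mult_ac)
          thus ?thesis unfolding exp_phase by (simp add: mult_ac)
        qed
        thus "(\<integral>s. ?H ((r, \<theta>, s), x) \<partial>ival (-S) S) = (of_real (x * exp (- (x * \<epsilon>))) * cis (x * t)) * (kernel x \<rho> \<phi> (r, \<theta>) * F_hat r \<theta> x)"
          by (simp only: integral_mult_right_zero fourier_ival mult.assoc)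
      qed
      also have "\<dots> = of_real (x * exp (- (x * \<epsilon>))) * cis (x * t) * slice x \<rho> \<phi>"
        using integral_polar_box[OF kernel_F_hat_integrable[of x \<rho> \<phi>]] x \<rho> unfolding slice_def by simp
      finally show "(\<integral>p. ?H (p, x) \<partial>full_box) = of_real (x * exp (- (x * \<epsilon>))) * cis (x * t) * slice x \<rho> \<phi>" .
    qed
  qed
  finally have fin: "(\<integral>p. (case p of (r, \<theta>, s) \<Rightarrow> F r \<theta> s * of_real (r powr (\<gamma> - 1)) / (?w p)\<^sup>2) \<partial>full_box) =
    (\<integral>x. of_real (x * exp (- (x * \<epsilon>))) * cis (x * t) * slice x \<rho> \<phi> \<partial>half)" .
  have "leray \<gamma> f (of_real \<rho> * cis \<phi>, Complex t (\<rho> powr \<gamma>) + \<i> * of_real \<epsilon>) =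
    of_real (\<gamma>\<^sup>2 / (4 * pi\<^sup>2)) * (\<integral>p. (case p of (r, \<theta>, s) \<Rightarrow> F r \<theta> s * of_real (r powr (\<gamma> - 1)) / (?w p)\<^sup>2) \<partial>full_box)"
    using f by (rule leray_eq_full_box)
  thus ?thesis by (simp only: fin)
qed

end

section \<open>Boundary values\<close>
lemma continuous_fourier:
  assumes g: "integrable lborel g" shows "continuous_on UNIV (fourier g)"
  unfolding continuous_on_sequentially
proof (intro allI ballI impI, elim conjE)
  fix X x assume X: "X \<longlonglongrightarrow> (x::real)"
  have [measurable]: "g \<in> borel_measurable borel" using borel_measurable_integrable[OF g] by simp
  show "(fourier g \<circ> X) \<longlonglongrightarrow> fourier g x"
    unfolding fourier_def o_def
  proof (rule integral_dominated_convergence[where w="\<lambda>s. norm (g s)"])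
    show "AE s in lborel. (\<lambda>n. g s * cis (- (X n * s))) \<longlonglongrightarrow> g s * cis (- (x * s))"
      unfolding cis_conv_exp by (intro AE_I2 tendsto_intros X)
  qed (use g in \<open>auto simp: norm_mult\<close>)
qed

context leray_data begin

lemma slice_tendsto:
  assumes \<rho>: "\<rho> \<ge> 0" and X: "X \<longlonglongrightarrow> x" and nn: "\<And>n. X n \<ge> 0"
  shows "(\<lambda>n. slice (X n) \<rho> \<phi>) \<longlonglongrightarrow> slice x \<rho> \<phi>"
  unfolding slice_def
proof (rule integral_dominated_convergence[where w="\<lambda>_. R powr (\<gamma> - 1) * B"])
  show "AE q in polar_box. (\<lambda>n. kernel (X n) \<rho> \<phi> q * F_hat (fst q) (snd q) (X n)) \<longlonglongrightarrow> kernel x \<rho> \<phi> q * F_hat (fst q) (snd q) x"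
  proof (rule AE_I2)
    fix q
    have "(\<lambda>n. F_hat (fst q) (snd q) (X n)) \<longlonglongrightarrow> F_hat (fst q) (snd q) x"
      unfolding F_hat_def by (rule continuous_on_tendsto_compose[OF continuous_fourier[OF integrable_F] X]) auto
    thus "(\<lambda>n. kernel (X n) \<rho> \<phi> q * F_hat (fst q) (snd q) (X n)) \<longlonglongrightarrow> kernel x \<rho> \<phi> q * F_hat (fst q) (snd q) x"
      unfolding kernel_def case_prod_unfold by (intro tendsto_intros X)
  qed
  show "AE q in polar_box. norm (kernel (X n) \<rho> \<phi> q * F_hat (fst q) (snd q) (X n)) \<le> R powr (\<gamma> - 1) * B" for n
  proof (rule AE_I2)
    fix q
    have "B / (1 + \<bar>X n\<bar> ^ 3) \<le> B" using B_nonneg by (simp add: divide_le_eq add_pos_nonneg mult_le_cancel_left1)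
    thus "norm (kernel (X n) \<rho> \<phi> q * F_hat (fst q) (snd q) (X n)) \<le> R powr (\<gamma> - 1) * B"
      by (intro order_trans[OF kernel_F_hat_bound[OF nn \<rho>]] mult_left_mono) auto
  qed
  show "integrable polar_box (\<lambda>_. R powr (\<gamma> - 1) * B)" using finite_polar_box by (simp add: finite_measure.integrable_const)
qed measurable

text \<open>
  What \<open>leray_shifted\<close> becomes for \<open>\<epsilon> = 0\<close>.\<close>
definition bd :: "real \<Rightarrow> real \<Rightarrow> real \<Rightarrow> complex" where
  "bd \<rho> \<phi> t = of_real (\<gamma>\<^sup>2 / (4 * pi\<^sup>2)) * (\<integral>x. of_real x * cis (x * t) * slice x \<rho> \<phi> \<partial>half)"

lemma x_slice_bound:
  assumes "\<rho> \<ge> 0" "0 \<le> x" shows "cmod (of_real x * slice x \<rho> \<phi>) \<le> slice_const * (x / (1 + \<bar>x\<bar> ^ 3))"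
  using mult_left_mono[OF slice_bound[OF assms(2,1), of \<phi>] assms(2)] assms(2) by (simp add: norm_mult mult_ac)

text \<open>The cubic decay of the slices dominates the frequency integrals uniformly in \<open>\<epsilon>\<close>, so the limit exists at
  every boundary point.\<close>
lemma leray_bd_eq:
  assumes f: "\<And>r \<theta> s. 0 < r \<Longrightarrow> 0 \<le> \<theta> \<Longrightarrow> \<theta> < 2 * pi \<Longrightarrow> f (par \<gamma> (r, \<theta>, s)) = F r \<theta> s"
    and \<rho>: "0 \<le> \<rho>"
  shows "leray_bd \<gamma> f (par \<gamma> (\<rho>, \<phi>, t)) = bd \<rho> \<phi> t"
proof -
  let ?L = "\<lambda>\<epsilon>. leray \<gamma> f (fst (par \<gamma> (\<rho>, \<phi>, t)), snd (par \<gamma> (\<rho>, \<phi>, t)) + \<i> * of_real \<epsilon>)"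
  have L: "?L \<epsilon> = of_real (\<gamma>\<^sup>2 / (4 * pi\<^sup>2)) * (\<integral>x. of_real (x * exp (- (x * \<epsilon>))) * cis (x * t) * slice x \<rho> \<phi> \<partial>half)" if "\<epsilon> > 0" for \<epsilon>
    using leray_shifted[OF f \<rho> that, of \<phi> t] by (simp add: par_def)
  have "(?L \<longlongrightarrow> bd \<rho> \<phi> t) (at_right 0)"
    unfolding tendsto_at_iff_sequentially
  proof (intro allI impI)
    fix e :: "nat \<Rightarrow> real" assume e: "\<forall>i. e i \<in> {0<..} - {0}" and lim: "e \<longlonglongrightarrow> 0"
    have e0: "e n > 0" for n using e by auto
    have "(\<lambda>n. \<integral>x. of_real (x * exp (- (x * e n))) * cis (x * t) * slice x \<rho> \<phi> \<partial>half) \<longlonglongrightarrow> (\<integral>x. of_real x * cis (x * t) * slice x \<rho> \<phi> \<partial>half)"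
    proof (rule integral_dominated_convergence[where w="\<lambda>x. slice_const * (x / (1 + \<bar>x\<bar> ^ 3))"])
      show "integrable half (\<lambda>x. slice_const * (x / (1 + \<bar>x\<bar> ^ 3)))" by (intro integrable_mult_right integrable_x_over_cube)
      show "AE x in half. (\<lambda>n. of_real (x * exp (- (x * e n))) * cis (x * t) * slice x \<rho> \<phi>) \<longlonglongrightarrow> of_real x * cis (x * t) * slice x \<rho> \<phi>"
      proof (rule AE_I2)
        fix x
        have "(\<lambda>n. of_real (x * exp (- (x * e n))) * cis (x * t) * slice x \<rho> \<phi>) \<longlonglongrightarrow> of_real (x * exp (- (x * 0))) * cis (x * t) * slice x \<rho> \<phi>"
          by (intro tendsto_intros lim)
        thus "(\<lambda>n. of_real (x * exp (- (x * e n))) * cis (x * t) * slice x \<rho> \<phi>) \<longlonglongrightarrow> of_real x * cis (x * t) * slice x \<rho> \<phi>" by simp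
      qed
      show "AE x in half. norm (of_real (x * exp (- (x * e n))) * cis (x * t) * slice x \<rho> \<phi>) \<le> slice_const * (x / (1 + \<bar>x\<bar> ^ 3))" for n
        using AE_half
      proof eventually_elim
        fix x :: real assume x: "x > 0"
        have "norm (of_real (x * exp (- (x * e n))) * cis (x * t) * slice x \<rho> \<phi>) = exp (- (x * e n)) * cmod (of_real x * slice x \<rho> \<phi>)"
          using x by (simp add: norm_mult)
        also have "\<dots> \<le> 1 * cmod (of_real x * slice x \<rho> \<phi>)"
          using x e0[of n] by (intro mult_right_mono) auto
        also have "\<dots> \<le> slice_const * (x / (1 + \<bar>x\<bar> ^ 3))" using x_slice_bound[OF \<rho>, of x \<phi>] x by simp
        finally show "norm (of_real (x * exp (- (x * e n))) * cis (x * t) * slice x \<rho> \<phi>) \<le> slice_const * (x / (1 + \<bar>x\<bar> ^ 3))" .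
      qed
    qed measurable
    hence "(\<lambda>n. of_real (\<gamma>\<^sup>2 / (4 * pi\<^sup>2)) * (\<integral>x. of_real (x * exp (- (x * e n))) * cis (x * t) * slice x \<rho> \<phi> \<partial>half)) \<longlonglongrightarrow> bd \<rho> \<phi> t"
      unfolding bd_def by (rule tendsto_mult_left)
    moreover have "?L \<circ> e = (\<lambda>n. of_real (\<gamma>\<^sup>2 / (4 * pi\<^sup>2)) * (\<integral>x. of_real (x * exp (- (x * e n))) * cis (x * t) * slice x \<rho> \<phi> \<partial>half))"
      unfolding o_def by (intro ext L e0)
    ultimately show "(?L \<circ> e) \<longlonglongrightarrow> bd \<rho> \<phi> t" by (simp only:)
  qed
  thus ?thesis unfolding leray_bd_def by (intro tendsto_Lim) auto
qed

text \<open>As a function of \<open>t\<close>, the boundary value is an inverse Fourier transform of \<open>x\<close> times the slice, cut off to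
  positive frequencies. The factor \<open>x\<close> makes the cut-off continuous at 0, as \<open>plancherel\<close> demands.\<close>
lemma plancherel_bd:
  assumes \<rho>: "0 \<le> \<rho>"
  shows "(\<integral>\<^sup>+t. ennreal ((cmod (bd \<rho> \<phi> t))\<^sup>2) \<partial>lborel) =
     ennreal (\<gamma> ^ 4 / (8 * pi ^ 3)) * (\<integral>\<^sup>+x. ennreal (x\<^sup>2 * (cmod (slice x \<rho> \<phi>))\<^sup>2) \<partial>half)"
proof -
  \<comment> \<open>Replacing \<open>x\<close> by \<open>max x 0\<close> extends the integrand by 0 and keeps it continuous.\<close>
  define g where "g x = of_real (max x 0) * slice (max x 0) \<rho> \<phi>" for x
  have [measurable]: "g \<in> borel_measurable borel" unfolding g_def by measurable
  have gi: "indicator {0<..} x *\<^sub>R (of_real x * slice x \<rho> \<phi>) = g x" for x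
    by (auto simp: g_def indicator_def max_def)
  have gb: "cmod (g x) \<le> slice_const * (max x 0 / (1 + \<bar>max x 0\<bar> ^ 3))" for x
    unfolding g_def by (rule x_slice_bound[OF \<rho>]) simp
  have slice_const_nonneg: "slice_const \<ge> 0" unfolding slice_const_def using B_nonneg by simp
  have i: "integrable lborel g"
  proof -
    have "integrable half (\<lambda>x. of_real x * slice x \<rho> \<phi>)"
    proof (rule Bochner_Integration.integrable_bound)
      show "integrable half (\<lambda>x. slice_const * (x / (1 + \<bar>x\<bar> ^ 3)))" by (intro integrable_mult_right integrable_x_over_cube)
      show "AE x in half. norm (of_real x * slice x \<rho> \<phi>) \<le> norm (slice_const * (x / (1 + \<bar>x\<bar> ^ 3)))"
        using AE_half
      proof eventually_elim
        fix x :: real assume "x > 0"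
        thus "norm (of_real x * slice x \<rho> \<phi>) \<le> norm (slice_const * (x / (1 + \<bar>x\<bar> ^ 3)))"
          using x_slice_bound[OF \<rho>, of x \<phi>] slice_const_nonneg by (simp add: abs_mult)
      qed
    qed measurable
    thus ?thesis by (subst (asm) integrable_half) (auto simp: gi)
  qed
  have bnd: "cmod (g x) \<le> slice_const" for x
  proof -
    have "y / (1 + \<bar>y\<bar> ^ 3) \<le> 1" if "y \<ge> 0" for y :: real
    proof -
      have "y \<le> 1 + y ^ 3"
      proof (cases "y \<le> 1")
        case False thus ?thesis using power_increasing[of 1 3 y] by simp
      qed (use that in \<open>auto intro: order_trans\<close>)
      thus ?thesis using that by (simp add: divide_le_eq add_pos_nonneg)
    qed
    from mult_left_mono[OF this[of "max x 0"] slice_const_nonneg] gb[of x] show ?thesis by simp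
  qed
  have cg: "continuous_on UNIV g"
    unfolding continuous_on_sequentially
  proof (intro allI ballI impI, elim conjE)
    fix X x assume X: "X \<longlonglongrightarrow> (x::real)"
    have "(\<lambda>n. max (X n) 0) \<longlonglongrightarrow> max x 0" by (intro tendsto_intros X)
    thus "(g \<circ> X) \<longlonglongrightarrow> g x"
      unfolding g_def o_def by (intro tendsto_intros slice_tendsto \<rho> X) auto
  qed
  have bd: "bd \<rho> \<phi> t = of_real (\<gamma>\<^sup>2 / (4 * pi\<^sup>2)) * fourier g (- t)" for t
  proof -
    have "(\<integral>x. of_real x * cis (x * t) * slice x \<rho> \<phi> \<partial>half) = (\<integral>x. indicator {0<..} x *\<^sub>R (of_real x * cis (x * t) * slice x \<rho> \<phi>) \<partial>lborel)"
      by (rule integral_half) measurable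
    also have "\<dots> = fourier g (- t)"
      unfolding fourier_def by (intro Bochner_Integration.integral_cong refl) (simp add: gi[symmetric] scaleR_conv_of_real mult_ac)
    finally show ?thesis by (simp add: bd_def)
  qed
  have "(\<integral>\<^sup>+t. ennreal ((cmod (bd \<rho> \<phi> t))\<^sup>2) \<partial>lborel) = (\<integral>\<^sup>+t. ennreal ((\<gamma>\<^sup>2 / (4 * pi\<^sup>2))\<^sup>2) * ennreal ((cmod (fourier g (- t)))\<^sup>2) \<partial>lborel)"
    unfolding bd using \<gamma> by (intro nn_integral_cong) (simp add: norm_mult power_mult_distrib power_divide ennreal_mult[symmetric] norm_divide norm_power)
  also have "\<dots> = ennreal ((\<gamma>\<^sup>2 / (4 * pi\<^sup>2))\<^sup>2) * (\<integral>\<^sup>+t. ennreal ((cmod (fourier g (- t)))\<^sup>2) \<partial>lborel)"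
    by (rule nn_integral_cmult) measurable
  also have "(\<integral>\<^sup>+t. ennreal ((cmod (fourier g (- t)))\<^sup>2) \<partial>lborel) = (\<integral>\<^sup>+t. ennreal ((cmod (fourier g t))\<^sup>2) \<partial>lborel)"
    by (subst (2) nn_integral_real_affine[where c="-1" and t=0]) (auto simp: one_ennreal_def[symmetric])
  also have "\<dots> = ennreal (2 * pi) * (\<integral>\<^sup>+s. ennreal ((cmod (g s))\<^sup>2) \<partial>lborel)"
    by (rule plancherel[OF i bnd cg])
  also have "(\<integral>\<^sup>+s. ennreal ((cmod (g s))\<^sup>2) \<partial>lborel) = (\<integral>\<^sup>+x. ennreal (x\<^sup>2 * (cmod (slice x \<rho> \<phi>))\<^sup>2) \<partial>half)"
    by (subst nn_integral_half) (auto intro!: nn_integral_cong simp: gi[symmetric] norm_mult power_mult_distrib indicator_def)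
  also have "ennreal ((\<gamma>\<^sup>2 / (4 * pi\<^sup>2))\<^sup>2) * (ennreal (2 * pi) * (\<integral>\<^sup>+x. ennreal (x\<^sup>2 * (cmod (slice x \<rho> \<phi>))\<^sup>2) \<partial>half)) =
     ennreal (\<gamma> ^ 4 / (8 * pi ^ 3)) * (\<integral>\<^sup>+x. ennreal (x\<^sup>2 * (cmod (slice x \<rho> \<phi>))\<^sup>2) \<partial>half)"
  proof -
    have "(\<gamma>\<^sup>2 / (4 * pi\<^sup>2))\<^sup>2 * (2 * pi) = \<gamma> ^ 4 / (8 * pi ^ 3)"
      by (simp add: power_divide field_simps eval_nat_numeral)
    hence "ennreal ((\<gamma>\<^sup>2 / (4 * pi\<^sup>2))\<^sup>2) * ennreal (2 * pi) = ennreal (\<gamma> ^ 4 / (8 * pi ^ 3))"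
      by (subst ennreal_mult[symmetric]) auto
    thus ?thesis by (simp only: mult.assoc[symmetric])
  qed
  finally show ?thesis .
qed

section \<open>Angular modes of the boundary values\<close>
definition F_mode :: "nat \<Rightarrow> real \<Rightarrow> real \<Rightarrow> complex" where
  "F_mode k r x = (\<integral>\<theta>. F_hat r \<theta> x * cis (- (real k * \<theta>)) \<partial>circ)"

text \<open>
  Apart from the factor \<open>exp (- x \<rho>\<^sup>\<gamma>)\<close>, a slice is a power series in \<open>\<rho> e\<^bsup>i\<phi>\<^esup>\<close>; these are its
  coefficients. The \<open>k\<close>-th one depends only on the \<open>k\<close>-th angular mode of the data, through an
  integral against a fixed function of \<open>r\<close>.\<close>
definition taylor_coeff :: "nat \<Rightarrow> real \<Rightarrow> complex" where
  "taylor_coeff k x = of_real ((x * \<gamma>) ^ k / fact k) *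
     (\<integral>r. of_real (r powr (\<gamma> - 1) * (r powr (\<gamma> - 1)) ^ k * exp (- (x * ((\<gamma> - 1) * r powr \<gamma>)))) * F_mode k r x \<partial>ival r0 R)"

lemma measurable_F_mode [measurable (raw)]:
  assumes [measurable]: "a \<in> borel_measurable M" "b \<in> borel_measurable M"
  shows "(\<lambda>x. F_mode k (a x) (b x)) \<in> borel_measurable M"
proof -
  interpret sigma_finite_measure circ by simp
  show ?thesis unfolding F_mode_def by measurable
qed

lemma measurable_taylor_coeff [measurable (raw)]:
  assumes [measurable]: "a \<in> borel_measurable M"
  shows "(\<lambda>x. taylor_coeff k (a x)) \<in> borel_measurable M"
proof -
  interpret sigma_finite_measure "ival r0 R" by (simp add: finite_measure.sigma_finite_measure)
  show ?thesis unfolding taylor_coeff_def by measurable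
qed

text \<open>The exponential series of \<open>x \<gamma> r\<^bsup>\<gamma>-1\<^esup> \<rho> e\<^bsup>i(\<phi>-\<theta>)\<^esup>\<close> may be integrated term by term, since \<open>r \<le> R\<close> on the support
  dominates it by a convergent exponential series.\<close>
lemma slice_expansion:
  assumes x: "0 \<le> x" and \<rho>: "0 \<le> \<rho>"
  shows "summable (\<lambda>k. cmod (taylor_coeff k x * of_real (\<rho> ^ k)))"
    and "slice x \<rho> \<phi> = of_real (exp (- (x * \<rho> powr \<gamma>))) * (\<Sum>k. taylor_coeff k x * of_real (\<rho> ^ k) * cis (real k * \<phi>))"
proof -
  let ?e = "exp (- (x * \<rho> powr \<gamma>))"
  let ?Y = "\<lambda>r. x * \<gamma> * r powr (\<gamma> - 1) * \<rho>"
  define T where "T \<phi> k q = of_real (fst q powr (\<gamma> - 1) * exp (- (x * ((\<gamma> - 1) * fst q powr \<gamma> + \<rho> powr \<gamma>)))) *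
      (of_real (?Y (fst q) ^ k / fact k) * cis (real k * (\<phi> - snd q))) * F_hat (fst q) (snd q) x" for \<phi> k q
  have [measurable]: "T \<phi> k \<in> borel_measurable (borel \<Otimes>\<^sub>M borel)" for \<phi> k unfolding T_def by measurable
  let ?c = "R powr (\<gamma> - 1) * B"
  have T_bound: "cmod (T \<phi> k q) \<le> ?c * (?Y R ^ k / fact k)" for \<phi> k q
  proof (cases "F_hat (fst q) (snd q) x = 0")
    case True thus ?thesis using B_nonneg \<gamma> x \<rho> by (simp add: T_def)
  next
    case False
    from F_hat_supp[OF this] r0 have r: "0 \<le> fst q" "fst q \<le> R" by auto
    have p: "fst q powr (\<gamma> - 1) \<le> R powr (\<gamma> - 1)" using r \<gamma> by (intro powr_mono2) auto
    have e1: "exp (- (x * ((\<gamma> - 1) * fst q powr \<gamma> + \<rho> powr \<gamma>))) \<le> 1" using x \<gamma> by simp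
    have Y: "?Y (fst q) \<le> ?Y R" "0 \<le> ?Y (fst q)" using p x \<rho> \<gamma> by (auto intro!: mult_left_mono mult_right_mono)
    have "cmod (T \<phi> k q) = (fst q powr (\<gamma> - 1) * exp (- (x * ((\<gamma> - 1) * fst q powr \<gamma> + \<rho> powr \<gamma>)))) * (?Y (fst q) ^ k / fact k) * cmod (F_hat (fst q) (snd q) x)"
      using Y(2) unfolding T_def norm_mult norm_cis norm_of_real by simp
    also have "\<dots> \<le> (R powr (\<gamma> - 1) * 1) * (?Y R ^ k / fact k) * B"
      using p e1 Y F_hat_bound[of "fst q" "snd q" x] B_nonneg x \<rho> \<gamma> by (intro mult_mono divide_right_mono power_mono) auto
    finally show ?thesis by (simp add: mult_ac)
  qed
  have sY: "summable (\<lambda>k. ?c * (?Y R ^ k / fact k))"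
    using summable_exp[of "?Y R"] by (intro summable_mult) (simp add: field_simps)
  have iT: "integrable polar_box (T \<phi> k)" for \<phi> k
    by (rule integrable_bounded[OF finite_polar_box _ T_bound]) measurable
  have ITb: "(\<integral>q. norm (T \<phi> k q) \<partial>polar_box) \<le> measure polar_box UNIV * (?c * (?Y R ^ k / fact k))" for \<phi> k
  proof -
    have "(\<integral>q. norm (T \<phi> k q) \<partial>polar_box) \<le> (\<integral>q. ?c * (?Y R ^ k / fact k) \<partial>polar_box)"
      using finite_polar_box by (intro Bochner_Integration.integral_mono integrable_norm iT T_bound) (simp add: finite_measure.integrable_const)
    thus ?thesis by simp
  qed
  have sI: "summable (\<lambda>k. \<integral>q. norm (T \<phi> k q) \<partial>polar_box)" for \<phi>
    by (rule summable_comparison_test[OF _ summable_mult[OF sY, of "measure polar_box UNIV"]])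
       (use ITb in \<open>auto intro!: exI[of _ 0]\<close>)
  have sums: "(\<lambda>k. \<integral>q. T \<phi> k q \<partial>polar_box) sums (\<integral>q. (\<Sum>k. T \<phi> k q) \<partial>polar_box)" for \<phi>
  proof (rule sums_integral[OF iT _ sI])
    show "AE q in polar_box. summable (\<lambda>k. norm (T \<phi> k q))"
      by (intro AE_I2 summable_comparison_test[OF _ sY]) (use T_bound in \<open>auto intro!: exI[of _ 0]\<close>)
  qed
  have IT: "(\<integral>q. T \<phi> k q \<partial>polar_box) = of_real ?e * (taylor_coeff k x * of_real (\<rho> ^ k) * cis (real k * \<phi>))" for \<phi> k
  proof -
    have "(\<integral>q. T \<phi> k q \<partial>polar_box) = (\<integral>r. \<integral>\<theta>. T \<phi> k (r, \<theta>) \<partial>circ \<partial>ival r0 R)" by (rule integral_polar_box[OF iT])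
    also have "\<dots> = (\<integral>r. (of_real ?e * of_real ((x * \<gamma>) ^ k / fact k) * of_real (\<rho> ^ k) * cis (real k * \<phi>)) *
        (of_real (r powr (\<gamma> - 1) * (r powr (\<gamma> - 1)) ^ k * exp (- (x * ((\<gamma> - 1) * r powr \<gamma>)))) * F_mode k r x) \<partial>ival r0 R)"
    proof (intro Bochner_Integration.integral_cong refl)
      fix r
      have "T \<phi> k (r, \<theta>) = (of_real ?e * of_real ((x * \<gamma>) ^ k / fact k) * of_real (\<rho> ^ k) * cis (real k * \<phi>)) *
        (of_real (r powr (\<gamma> - 1) * (r powr (\<gamma> - 1)) ^ k * exp (- (x * ((\<gamma> - 1) * r powr \<gamma>)))) * (F_hat r \<theta> x * cis (- (real k * \<theta>))))" for \<theta>
      proof -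
        have "cis (real k * (\<phi> - \<theta>)) = cis (real k * \<phi>) * cis (- (real k * \<theta>))" by (simp add: cis_mult algebra_simps)
        moreover have "exp (- (x * ((\<gamma> - 1) * r powr \<gamma> + \<rho> powr \<gamma>))) = ?e * exp (- (x * ((\<gamma> - 1) * r powr \<gamma>)))"
          by (simp add: exp_add[symmetric] algebra_simps)
        moreover have "?Y r ^ k / fact k = (x * \<gamma>) ^ k / fact k * \<rho> ^ k * (r powr (\<gamma> - 1)) ^ k" by (simp add: power_mult_distrib)
        ultimately show ?thesis unfolding T_def fst_conv snd_conv by (simp only: of_real_mult mult_ac)
      qed
      thus "(\<integral>\<theta>. T \<phi> k (r, \<theta>) \<partial>circ) = (of_real ?e * of_real ((x * \<gamma>) ^ k / fact k) * of_real (\<rho> ^ k) * cis (real k * \<phi>)) *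
        (of_real (r powr (\<gamma> - 1) * (r powr (\<gamma> - 1)) ^ k * exp (- (x * ((\<gamma> - 1) * r powr \<gamma>)))) * F_mode k r x)"
        unfolding F_mode_def by (simp only: integral_mult_right_zero)
    qed
    also have "\<dots> = of_real ?e * (taylor_coeff k x * of_real (\<rho> ^ k) * cis (real k * \<phi>))"
      unfolding taylor_coeff_def integral_mult_right_zero by (simp only: mult_ac)
    finally show ?thesis .
  qed
  have ST: "(\<Sum>k. T \<phi> k q) = kernel x \<rho> \<phi> q * F_hat (fst q) (snd q) x" for \<phi> q
  proof -
    have "(\<lambda>k. (of_real (?Y (fst q)) * cis (\<phi> - snd q)) ^ k /\<^sub>R fact k) sums exp (of_real (?Y (fst q)) * cis (\<phi> - snd q))"
      by (rule exp_converges)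
    also have "(\<lambda>k. (of_real (?Y (fst q)) * cis (\<phi> - snd q)) ^ k /\<^sub>R fact k) = (\<lambda>k. of_real (?Y (fst q) ^ k / fact k) * cis (real k * (\<phi> - snd q)))"
      by (simp add: fun_eq_iff power_mult_distrib Complex.DeMoivre scaleR_conv_of_real divide_inverse mult_ac)
    finally have "(\<lambda>k. of_real (?Y (fst q) ^ k / fact k) * cis (real k * (\<phi> - snd q))) sums exp (of_real (?Y (fst q)) * cis (\<phi> - snd q))" .
    from sums_mult2[OF sums_mult[OF this, of "of_real (fst q powr (\<gamma> - 1) * exp (- (x * ((\<gamma> - 1) * fst q powr \<gamma> + \<rho> powr \<gamma>))))"], of "F_hat (fst q) (snd q) x"]
    show ?thesis unfolding T_def kernel_def by (simp add: case_prod_unfold sums_unique[symmetric])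
  qed
  have S: "(\<lambda>k. of_real ?e * (taylor_coeff k x * of_real (\<rho> ^ k) * cis (real k * \<phi>))) sums slice x \<rho> \<phi>" for \<phi>
    using sums[of \<phi>] unfolding IT ST slice_def .
  have "summable (\<lambda>k. cmod (\<integral>q. T 0 k q \<partial>polar_box))"
    by (rule summable_comparison_test[OF _ sI[of 0]]) (auto intro!: exI[of _ 0] integral_norm_bound)
  hence "summable (\<lambda>k. ?e * cmod (taylor_coeff k x * of_real (\<rho> ^ k)))"
    unfolding IT by (simp add: norm_mult)
  thus 1: "summable (\<lambda>k. cmod (taylor_coeff k x * of_real (\<rho> ^ k)))"
    by (simp add: summable_cmult_iff)
  have s2: "summable (\<lambda>k. taylor_coeff k x * of_real (\<rho> ^ k) * cis (real k * \<phi>))"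
    using 1 by (rule summable_norm_cancel[OF summable_cong[THEN iffD1, rotated]]) (simp add: norm_mult)
  show "slice x \<rho> \<phi> = of_real ?e * (\<Sum>k. taylor_coeff k x * of_real (\<rho> ^ k) * cis (real k * \<phi>))"
    using sums_unique[OF S[of \<phi>]] suminf_mult[OF s2, of "of_real ?e"] by simp
qed

lemma parseval_slice:
  assumes x: "0 \<le> x" and \<rho>: "0 \<le> \<rho>"
  shows "(\<integral>\<^sup>+\<phi>. ennreal ((cmod (slice x \<rho> \<phi>))\<^sup>2) \<partial>circ) =
     ennreal (2 * pi) * (\<Sum>k. ennreal ((cmod (taylor_coeff k x))\<^sup>2 * (\<rho> ^ (2 * k) * exp (- (2 * x * \<rho> powr \<gamma>)))))"
proof -
  let ?e = "exp (- (x * \<rho> powr \<gamma>))"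
  let ?a = "\<lambda>k. of_real ?e * (taylor_coeff k x * of_real (\<rho> ^ k))"
  have s: "summable (\<lambda>k. cmod (?a k))"
    using slice_expansion(1)[OF x \<rho>] summable_mult[of "\<lambda>k. cmod (taylor_coeff k x * of_real (\<rho> ^ k))" ?e] by (simp add: norm_mult)
  have s2: "summable (\<lambda>k. taylor_coeff k x * of_real (\<rho> ^ k) * cis (real k * \<phi>))" for \<phi>
    using slice_expansion(1)[OF x \<rho>] by (rule summable_norm_cancel[OF summable_cong[THEN iffD1, rotated]]) (simp add: norm_mult)
  have "slice x \<rho> \<phi> = (\<Sum>k. ?a k * cis (real k * \<phi>))" for \<phi>
    unfolding slice_expansion(2)[OF x \<rho>] by (subst suminf_mult[OF s2, symmetric]) (simp add: mult_ac)
  hence "(\<integral>\<^sup>+\<phi>. ennreal ((cmod (slice x \<rho> \<phi>))\<^sup>2) \<partial>circ) = ennreal (2 * pi) * (\<Sum>k. ennreal ((cmod (?a k))\<^sup>2))"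
    using parseval[OF s] by simp
  also have "(\<lambda>k. ennreal ((cmod (?a k))\<^sup>2)) = (\<lambda>k. ennreal ((cmod (taylor_coeff k x))\<^sup>2 * (\<rho> ^ (2 * k) * exp (- (2 * x * \<rho> powr \<gamma>)))))"
  proof (intro ext arg_cong[where f=ennreal])
    fix k
    have "?e\<^sup>2 = exp (- (2 * x * \<rho> powr \<gamma>))" by (simp add: power2_eq_square exp_add[symmetric])
    thus "(cmod (?a k))\<^sup>2 = (cmod (taylor_coeff k x))\<^sup>2 * (\<rho> ^ (2 * k) * exp (- (2 * x * \<rho> powr \<gamma>)))"
      using \<rho> by (simp add: norm_mult power_mult_distrib mult_ac power_mult norm_power power_even_eq)
  qed
  finally show ?thesis .
qed

text \<open>
  The Gamma argument produced by the radial integral of the output.\<close>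
definition alpha :: "real \<Rightarrow> nat \<Rightarrow> real" where "alpha d k = (2 * real k + d + 1) / \<gamma>"

text \<open>
  The contribution of the mode \<open>(k, x)\<close> to the squared norm of the boundary value in \<open>L\<^sup>2(r\<^sup>d dr d\<theta> ds)\<close>.\<close>
abbreviation mode_energy :: "real \<Rightarrow> nat \<Rightarrow> real \<Rightarrow> real" where
  "mode_energy d k x \<equiv> \<gamma> ^ 3 / (4 * pi\<^sup>2) * (x\<^sup>2 * (cmod (taylor_coeff k x))\<^sup>2 * ((2 * x) powr (- alpha d k) * Gamma (alpha d k)))"

text \<open>Plancherel in \<open>t\<close>, Parseval in \<open>\<phi>\<close>, and finally the \<open>\<rho>\<close>-integrals of
  \<open>\<rho>\<^bsup>2k+d\<^esup> exp (- 2x \<rho>\<^sup>\<gamma>)\<close>, which are Gamma values. All terms are nonnegative, so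
  sums and integrals may be interchanged freely.\<close>
theorem normsq_bd:
  assumes d: "d > -1"
  shows "polar_normsq d bd =
    (\<integral>\<^sup>+x. (\<Sum>k. ennreal (mode_energy d k x)) \<partial>half)"
proof -
  interpret polar_box: sigma_finite_measure polar_box by (simp add: finite_measure.sigma_finite_measure)
  interpret H: sigma_finite_measure half by simp
  interpret C: sigma_finite_measure circ by simp
  interpret HC: pair_sigma_finite half circ by (simp add: pair_sigma_finite_def)
  interpret HH: pair_sigma_finite half half by (simp add: pair_sigma_finite_def)
  have [measurable]: "(\<lambda>x. bd (a x) (b x) (c x)) \<in> borel_measurable M"
    if [measurable]: "a \<in> borel_measurable M" "b \<in> borel_measurable M" "c \<in> borel_measurable M" for a b c M
    unfolding bd_def by measurable
  let ?c1 = "\<gamma> ^ 4 / (8 * pi ^ 3)"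
  let ?c = "\<gamma> ^ 4 / (4 * pi\<^sup>2)"
  define T where "T k x \<rho> = (?c * (x\<^sup>2 * (cmod (taylor_coeff k x))\<^sup>2)) * (\<rho> powr (d + 2 * real k) * exp (- (2 * x * \<rho> powr \<gamma>)))" for k x \<rho>
  have [measurable]: "(\<lambda>z. T k (a z) (b z)) \<in> borel_measurable M"
    if [measurable]: "a \<in> borel_measurable M" "b \<in> borel_measurable M" for k a b M
    unfolding T_def by measurable
  have A: "(\<integral>\<^sup>+\<phi>. \<integral>\<^sup>+t. ennreal (\<rho> powr d) * ennreal ((cmod (bd \<rho> \<phi> t))\<^sup>2) \<partial>lborel \<partial>circ) = (\<integral>\<^sup>+x. (\<Sum>k. ennreal (T k x \<rho>)) \<partial>half)"
    if \<rho>: "\<rho> > 0" for \<rho>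
  proof -
    have "(\<integral>\<^sup>+\<phi>. \<integral>\<^sup>+t. ennreal (\<rho> powr d) * ennreal ((cmod (bd \<rho> \<phi> t))\<^sup>2) \<partial>lborel \<partial>circ) =
      (\<integral>\<^sup>+\<phi>. ennreal (\<rho> powr d) * (ennreal ?c1 * (\<integral>\<^sup>+x. ennreal (x\<^sup>2 * (cmod (slice x \<rho> \<phi>))\<^sup>2) \<partial>half)) \<partial>circ)"
      using \<rho> by (simp add: nn_integral_cmult plancherel_bd)
    also have "\<dots> = ennreal (\<rho> powr d) * (ennreal ?c1 * (\<integral>\<^sup>+\<phi>. \<integral>\<^sup>+x. ennreal (x\<^sup>2 * (cmod (slice x \<rho> \<phi>))\<^sup>2) \<partial>half \<partial>circ))"
      by (simp add: nn_integral_cmult)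
    also have "(\<integral>\<^sup>+\<phi>. \<integral>\<^sup>+x. ennreal (x\<^sup>2 * (cmod (slice x \<rho> \<phi>))\<^sup>2) \<partial>half \<partial>circ) = (\<integral>\<^sup>+x. \<integral>\<^sup>+\<phi>. ennreal (x\<^sup>2 * (cmod (slice x \<rho> \<phi>))\<^sup>2) \<partial>circ \<partial>half)"
      by (rule HC.Fubini') measurable
    also have "ennreal (\<rho> powr d) * (ennreal ?c1 * \<dots>) = (\<integral>\<^sup>+x. ennreal (\<rho> powr d) * (ennreal ?c1 * (\<integral>\<^sup>+\<phi>. ennreal (x\<^sup>2 * (cmod (slice x \<rho> \<phi>))\<^sup>2) \<partial>circ)) \<partial>half)"
      by (simp add: nn_integral_cmult)
    also have "\<dots> = (\<integral>\<^sup>+x. (\<Sum>k. ennreal (T k x \<rho>)) \<partial>half)"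
    proof (rule nn_integral_cong_AE)
      show "AE x in half. ennreal (\<rho> powr d) * (ennreal ?c1 * (\<integral>\<^sup>+\<phi>. ennreal (x\<^sup>2 * (cmod (slice x \<rho> \<phi>))\<^sup>2) \<partial>circ)) = (\<Sum>k. ennreal (T k x \<rho>))"
        using AE_half
      proof eventually_elim
        fix x :: real assume x: "x > 0"
        let ?P = "\<lambda>k. (cmod (taylor_coeff k x))\<^sup>2 * (\<rho> ^ (2 * k) * exp (- (2 * x * \<rho> powr \<gamma>)))"
        have "(\<integral>\<^sup>+\<phi>. ennreal (x\<^sup>2 * (cmod (slice x \<rho> \<phi>))\<^sup>2) \<partial>circ) = ennreal (x\<^sup>2) * (\<integral>\<^sup>+\<phi>. ennreal ((cmod (slice x \<rho> \<phi>))\<^sup>2) \<partial>circ)"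
          by (simp add: ennreal_mult nn_integral_cmult)
        also have "\<dots> = ennreal (x\<^sup>2) * (ennreal (2 * pi) * (\<Sum>k. ennreal (?P k)))"
          by (subst parseval_slice) (use x \<rho> in auto)
        finally have S: "(\<integral>\<^sup>+\<phi>. ennreal (x\<^sup>2 * (cmod (slice x \<rho> \<phi>))\<^sup>2) \<partial>circ) = ennreal (x\<^sup>2) * (ennreal (2 * pi) * (\<Sum>k. ennreal (?P k)))" .
        have "ennreal (\<rho> powr d) * (ennreal ?c1 * (\<integral>\<^sup>+\<phi>. ennreal (x\<^sup>2 * (cmod (slice x \<rho> \<phi>))\<^sup>2) \<partial>circ)) =
          ennreal (\<rho> powr d * (?c1 * (x\<^sup>2 * (2 * pi)))) * (\<Sum>k. ennreal (?P k))"
        proof -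
          have c10: "0 \<le> ?c1" using \<gamma> by simp
          have "ennreal (\<rho> powr d * (?c1 * (x\<^sup>2 * (2 * pi)))) = ennreal (\<rho> powr d) * (ennreal ?c1 * (ennreal (x\<^sup>2) * ennreal (2 * pi)))"
            by (subst ennreal_mult, simp, use c10 in simp)
               (subst ennreal_mult, use c10 in simp, simp, subst ennreal_mult, simp, simp, rule refl)
          thus ?thesis unfolding S by (simp only: mult.assoc)
        qed
        also have "\<dots> = (\<Sum>k. ennreal (\<rho> powr d * (?c1 * (x\<^sup>2 * (2 * pi)))) * ennreal (?P k))"
          by (rule ennreal_suminf_cmult[symmetric])
        also have "(\<lambda>k. ennreal (\<rho> powr d * (?c1 * (x\<^sup>2 * (2 * pi)))) * ennreal (?P k)) = (\<lambda>k. ennreal (T k x \<rho>))"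
        proof
          fix k
          have pw: "\<rho> powr (d + 2 * real k) = \<rho> powr d * \<rho> ^ (2 * k)"
            using \<rho> by (simp add: powr_add powr_realpow[symmetric])
          have cc: "?c = ?c1 * (2 * pi)" by (simp add: power3_eq_cube power2_eq_square)
          have "\<rho> powr d * (?c1 * (x\<^sup>2 * (2 * pi))) * ?P k = T k x \<rho>"
            unfolding T_def pw cc by (simp only: mult_ac)
          thus "ennreal (\<rho> powr d * (?c1 * (x\<^sup>2 * (2 * pi)))) * ennreal (?P k) = ennreal (T k x \<rho>)"
            using \<rho> \<gamma> by (subst ennreal_mult[symmetric]) auto
        qed
        finally show "ennreal (\<rho> powr d) * (ennreal ?c1 * (\<integral>\<^sup>+\<phi>. ennreal (x\<^sup>2 * (cmod (slice x \<rho> \<phi>))\<^sup>2) \<partial>circ)) = (\<Sum>k. ennreal (T k x \<rho>))" .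
      qed
    qed
    finally show ?thesis .
  qed
  have "polar_normsq d bd =
    (\<integral>\<^sup>+\<rho>. \<integral>\<^sup>+x. (\<Sum>k. ennreal (T k x \<rho>)) \<partial>half \<partial>half)"
    by (rule nn_integral_cong_AE) (use AE_half in \<open>eventually_elim, use A in auto\<close>)
  also have "\<dots> = (\<integral>\<^sup>+x. \<integral>\<^sup>+\<rho>. (\<Sum>k. ennreal (T k x \<rho>)) \<partial>half \<partial>half)"
    by (rule HH.Fubini') measurable
  also have "\<dots> = (\<integral>\<^sup>+x. (\<Sum>k. ennreal (mode_energy d k x)) \<partial>half)"
  proof (rule nn_integral_cong_AE)
    show "AE x in half. (\<integral>\<^sup>+\<rho>. (\<Sum>k. ennreal (T k x \<rho>)) \<partial>half) = (\<Sum>k. ennreal (mode_energy d k x))"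
      using AE_half
    proof eventually_elim
      fix x :: real assume x: "x > 0"
      have "(\<integral>\<^sup>+\<rho>. (\<Sum>k. ennreal (T k x \<rho>)) \<partial>half) = (\<Sum>k. \<integral>\<^sup>+\<rho>. ennreal (T k x \<rho>) \<partial>half)"
        by (rule nn_integral_suminf) measurable
      also have "(\<lambda>k. \<integral>\<^sup>+\<rho>. ennreal (T k x \<rho>) \<partial>half) = (\<lambda>k. ennreal (mode_energy d k x))"
      proof
        fix k
        have alpha: "(d + 2 * real k + 1) / \<gamma> = alpha d k" by (simp add: alpha_def add_ac)
        have ap: "alpha d k > 0" using d \<gamma> by (simp add: alpha_def)
        have "(\<integral>\<^sup>+\<rho>. ennreal (T k x \<rho>) \<partial>half) = (\<integral>\<^sup>+\<rho>. ennreal (?c * (x\<^sup>2 * (cmod (taylor_coeff k x))\<^sup>2)) * ennreal (\<rho> powr (d + 2 * real k) * exp (- (2 * x * \<rho> powr \<gamma>))) \<partial>half)"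
          unfolding T_def by (intro nn_integral_cong ennreal_mult) (use \<gamma> in auto)
        also have "\<dots> = ennreal (?c * (x\<^sup>2 * (cmod (taylor_coeff k x))\<^sup>2)) * ennreal ((2 * x) powr (- alpha d k) * Gamma (alpha d k) / \<gamma>)"
          using nn_integral_powr_exp_powr[of "d + 2 * real k" "2 * x" \<gamma>] d x \<gamma> by (simp add: nn_integral_cmult alpha)
        also have "\<dots> = ennreal (?c * (x\<^sup>2 * (cmod (taylor_coeff k x))\<^sup>2) * ((2 * x) powr (- alpha d k) * Gamma (alpha d k) / \<gamma>))"
          using \<gamma> x ap by (intro ennreal_mult[symmetric]) (auto intro!: mult_nonneg_nonneg divide_nonneg_nonneg less_imp_le[OF Gamma_real_pos])
        also have "?c * (x\<^sup>2 * (cmod (taylor_coeff k x))\<^sup>2) * ((2 * x) powr (- alpha d k) * Gamma (alpha d k) / \<gamma>) = mode_energy d k x"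
          using \<gamma> by (simp add: field_simps eval_nat_numeral)
        finally show "(\<integral>\<^sup>+\<rho>. ennreal (T k x \<rho>) \<partial>half) = ennreal (mode_energy d k x)" .
      qed
      finally show "(\<integral>\<^sup>+\<rho>. (\<Sum>k. ennreal (T k x \<rho>)) \<partial>half) = (\<Sum>k. ennreal (mode_energy d k x))" .
    qed
  qed
  finally show ?thesis .
qed

end

section \<open>The upper bound\<close>
text \<open>
  The squared norm of the rank one operator by which the transform acts on any mode \<open>(k, x)\<close>.\<close>
definition mode_normsq :: "real \<Rightarrow> real \<Rightarrow> nat \<Rightarrow> real" where
  "mode_normsq \<gamma> d k = (\<gamma> / 2) ^ (2 * k + 2) * (\<gamma> - 1) powr (- ((2 * (\<gamma> - 1) * (real k + 1) - d + 1) / \<gamma>)) *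
     Gamma ((2 * real k + d + 1) / \<gamma>) * Gamma ((2 * (\<gamma> - 1) * (real k + 1) - d + 1) / \<gamma>) / (fact k)\<^sup>2"

lemma AE_ival: "AE x in ival a b. a \<le> x \<and> x \<le> b"
  unfolding ival_def by (subst AE_density) (auto simp: indicator_def)

lemma nn_integral_ival_le_half:
  assumes [measurable]: "f \<in> borel_measurable borel" and "0 < a"
  shows "(\<integral>\<^sup>+x. f x \<partial>ival a b) \<le> (\<integral>\<^sup>+x. f x \<partial>half)"
proof -
  have "(\<integral>\<^sup>+x. f x \<partial>ival a b) = (\<integral>\<^sup>+x. indicator {a..b} x * f x \<partial>lborel)"
    unfolding ival_def by (subst nn_integral_density) auto
  also have "\<dots> \<le> (\<integral>\<^sup>+x. f x * indicator {0<..} x \<partial>lborel)"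
    using assms(2) by (intro nn_integral_mono) (auto simp: indicator_def)
  also have "\<dots> = (\<integral>\<^sup>+x. f x \<partial>half)" by (rule nn_integral_half[symmetric]) measurable
  finally show ?thesis .
qed

context leray_data begin

text \<open>
  The Gamma argument produced by the radial integral of the input.\<close>
definition beta :: "real \<Rightarrow> nat \<Rightarrow> real" where "beta d k = (2 * (\<gamma> - 1) * (real k + 1) - d + 1) / \<gamma>"

lemma alpha_plus_beta: "alpha d k + beta d k = 2 * real k + 2"
  using \<gamma> by (simp add: alpha_def beta_def field_simps)

lemma beta_pos:
  assumes "d < 2 * \<gamma> - 1" shows "beta d k > 0"
proof -
  define t where "t = 2 * (\<gamma> - 1) * (real k + 1)"
  have "t \<ge> 2 * (\<gamma> - 1) * 1" unfolding t_def using \<gamma> by (intro mult_left_mono) auto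
  hence "t - d + 1 > 0" using assms by simp
  thus ?thesis unfolding beta_def t_def[symmetric] using \<gamma> by (intro divide_pos_pos) auto
qed

text \<open>The powers of \<open>x\<close> cancel because the two Gamma arguments sum to \<open>2k + 2\<close>. The operator norm is
  thereby a supremum over \<open>k\<close> alone.\<close>
lemma mode_normsq_constant:
  assumes x: "x > 0"
  shows "\<gamma> ^ 3 * (x\<^sup>2 * (((x * \<gamma>) ^ k / fact k)\<^sup>2 * ((2 * x * (\<gamma> - 1)) powr (- beta d k) * Gamma (beta d k) / \<gamma>)) * ((2 * x) powr (- alpha d k) * Gamma (alpha d k)))
     = mode_normsq \<gamma> d k"
proof -
  have "(2 * x * (\<gamma> - 1)) powr (- beta d k) * (2 * x) powr (- alpha d k) = (\<gamma> - 1) powr (- beta d k) * ((2 * x) powr (- beta d k) * (2 * x) powr (- alpha d k))"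
    using x \<gamma> by (simp add: powr_mult)
  also have "(2 * x) powr (- beta d k) * (2 * x) powr (- alpha d k) = (2 * x) powr (- (2 * real k + 2))"
  proof -
    have "- beta d k + - alpha d k = - (2 * real k + 2)" using alpha_plus_beta[of d k] by simp
    thus ?thesis unfolding powr_add[symmetric] by (simp only:)
  qed
  also have "\<dots> = 1 / (2 * x) ^ (2 * k + 2)"
  proof -
    have e: "2 * real k + 2 = real (2 * k + 2)" by simp
    show ?thesis unfolding e powr_minus_divide using x by (subst powr_realpow) auto
  qed
  finally have p: "(2 * x * (\<gamma> - 1)) powr (- beta d k) * (2 * x) powr (- alpha d k) = (\<gamma> - 1) powr (- beta d k) / (2 * x) ^ (2 * k + 2)" by simp
  have q: "\<gamma> ^ 3 * (x\<^sup>2 * ((x * \<gamma>) ^ k)\<^sup>2) / \<gamma> / (2 * x) ^ (2 * k + 2) = (\<gamma> / 2) ^ (2 * k + 2)"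
    using x \<gamma> by (simp add: power_mult_distrib power_divide power_add power_mult field_simps eval_nat_numeral)
  have "\<gamma> ^ 3 * (x\<^sup>2 * (((x * \<gamma>) ^ k / fact k)\<^sup>2 * ((2 * x * (\<gamma> - 1)) powr (- beta d k) * Gamma (beta d k) / \<gamma>)) * ((2 * x) powr (- alpha d k) * Gamma (alpha d k)))
    = (\<gamma> ^ 3 * (x\<^sup>2 * ((x * \<gamma>) ^ k)\<^sup>2) / \<gamma>) * ((2 * x * (\<gamma> - 1)) powr (- beta d k) * (2 * x) powr (- alpha d k)) * Gamma (alpha d k) * Gamma (beta d k) / (fact k)\<^sup>2"
    by (simp add: power_divide mult_ac)
  also have "\<dots> = (\<gamma> ^ 3 * (x\<^sup>2 * ((x * \<gamma>) ^ k)\<^sup>2) / \<gamma> / (2 * x) ^ (2 * k + 2)) * (\<gamma> - 1) powr (- beta d k) * Gamma (alpha d k) * Gamma (beta d k) / (fact k)\<^sup>2"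
    unfolding p by simp
  also have "\<dots> = mode_normsq \<gamma> d k" unfolding q by (simp add: mode_normsq_def alpha_def beta_def)
  finally show ?thesis .
qed

text \<open>Cauchy-Schwarz, with the weight distributed as \<open>r\<^bsup>-d/2\<^esup>\<close> on the fixed function and
  \<open>r\<^bsup>d/2\<^esup>\<close> on the data.\<close>
lemma taylor_coeff_bound:
  assumes x: "x > 0" and d: "d < 2 * \<gamma> - 1"
  shows "ennreal ((cmod (taylor_coeff k x))\<^sup>2) \<le> ennreal (((x * \<gamma>) ^ k / fact k)\<^sup>2 * ((2 * x * (\<gamma> - 1)) powr (- beta d k) * Gamma (beta d k) / \<gamma>)) *
     (\<integral>\<^sup>+r. ennreal (r powr d) * ennreal ((cmod (F_mode k r x))\<^sup>2) \<partial>half)"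
proof -
  define h where "h r = r powr (\<gamma> - 1) * (r powr (\<gamma> - 1)) ^ k * exp (- (x * ((\<gamma> - 1) * r powr \<gamma>)))" for r
  have h0: "h r \<ge> 0" for r unfolding h_def by simp
  have [measurable]: "h \<in> borel_measurable borel" unfolding h_def by measurable
  let ?I = "\<integral>r. of_real (h r) * F_mode k r x \<partial>ival r0 R"
  let ?N = "\<integral>\<^sup>+r. ennreal (r powr d) * ennreal ((cmod (F_mode k r x))\<^sup>2) \<partial>half"
  have "ennreal (cmod ?I) \<le> (\<integral>\<^sup>+r. ennreal (cmod (of_real (h r) * F_mode k r x)) \<partial>ival r0 R)"
    by (cases "integrable (ival r0 R) (\<lambda>r. of_real (h r) * F_mode k r x)")
       (auto intro: integral_norm_bound_ennreal simp: not_integrable_integral_eq)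
  also have "\<dots> = (\<integral>\<^sup>+r. ennreal (h r * r powr (- d / 2)) * ennreal (r powr (d / 2) * cmod (F_mode k r x)) \<partial>ival r0 R)"
  proof (rule nn_integral_cong_AE)
    show "AE r in ival r0 R. ennreal (cmod (of_real (h r) * F_mode k r x)) = ennreal (h r * r powr (- d / 2)) * ennreal (r powr (d / 2) * cmod (F_mode k r x))"
      using AE_ival
    proof eventually_elim
      fix r assume "r0 \<le> r \<and> r \<le> R"
      hence "r > 0" using r0 by simp
      hence "r powr (- d / 2) * r powr (d / 2) = 1" unfolding powr_add[symmetric] by simp
      hence "cmod (of_real (h r) * F_mode k r x) = (h r * r powr (- d / 2)) * (r powr (d / 2) * cmod (F_mode k r x))"
        using h0[of r] by (simp add: norm_mult)
      thus "ennreal (cmod (of_real (h r) * F_mode k r x)) = ennreal (h r * r powr (- d / 2)) * ennreal (r powr (d / 2) * cmod (F_mode k r x))"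
        by (simp add: ennreal_mult h0)
    qed
  qed
  finally have "(ennreal (cmod ?I))\<^sup>2 \<le> (\<integral>\<^sup>+r. ennreal (h r * r powr (- d / 2)) * ennreal (r powr (d / 2) * cmod (F_mode k r x)) \<partial>ival r0 R)\<^sup>2"
    by (intro power_mono) auto
  also have "\<dots> \<le> (\<integral>\<^sup>+r. (ennreal (h r * r powr (- d / 2)))\<^sup>2 \<partial>ival r0 R) * (\<integral>\<^sup>+r. (ennreal (r powr (d / 2) * cmod (F_mode k r x)))\<^sup>2 \<partial>ival r0 R)"
    by (rule Cauchy_Schwarz_nn_integral) measurable
  also have "\<dots> \<le> (\<integral>\<^sup>+r. (ennreal (h r * r powr (- d / 2)))\<^sup>2 \<partial>half) * (\<integral>\<^sup>+r. (ennreal (r powr (d / 2) * cmod (F_mode k r x)))\<^sup>2 \<partial>half)"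
    by (intro mult_mono nn_integral_ival_le_half r0) auto
  also have "(\<integral>\<^sup>+r. (ennreal (r powr (d / 2) * cmod (F_mode k r x)))\<^sup>2 \<partial>half) = ?N"
  proof (rule nn_integral_cong)
    fix r
    have "(r powr (d / 2))\<^sup>2 = r powr d" by (simp add: power2_eq_square powr_add[symmetric])
    thus "(ennreal (r powr (d / 2) * cmod (F_mode k r x)))\<^sup>2 = ennreal (r powr d) * ennreal ((cmod (F_mode k r x))\<^sup>2)"
      by (simp add: ennreal_power power_mult_distrib flip: ennreal_mult)
  qed
  also have "(\<integral>\<^sup>+r. (ennreal (h r * r powr (- d / 2)))\<^sup>2 \<partial>half) = (\<integral>\<^sup>+r. ennreal (r powr (2 * (\<gamma> - 1) * (real k + 1) - d) * exp (- (2 * x * (\<gamma> - 1) * r powr \<gamma>))) \<partial>half)"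
  proof (rule nn_integral_cong_AE)
    show "AE r in half. (ennreal (h r * r powr (- d / 2)))\<^sup>2 = ennreal (r powr (2 * (\<gamma> - 1) * (real k + 1) - d) * exp (- (2 * x * (\<gamma> - 1) * r powr \<gamma>)))"
      using AE_half
    proof eventually_elim
      fix r :: real assume r: "r > 0"
      have "r powr (2 * (\<gamma> - 1) * (real k + 1) - d) = ((r powr (\<gamma> - 1) * (r powr (\<gamma> - 1)) ^ k) * r powr (- d / 2))\<^sup>2"
      proof -
        have p1: "r powr (\<gamma> - 1) * (r powr (\<gamma> - 1)) ^ k = r powr ((\<gamma> - 1) * (real k + 1))"
          using r by (simp add: powr_power powr_add[symmetric] algebra_simps)
        have e: "2 * (\<gamma> - 1) * (real k + 1) - d = ((\<gamma> - 1) * (real k + 1) + - d / 2) + ((\<gamma> - 1) * (real k + 1) + - d / 2)"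
          by (simp add: algebra_simps)
        show ?thesis unfolding p1 power2_eq_square powr_add[symmetric] e ..
      qed
      moreover have "exp (- (2 * x * (\<gamma> - 1) * r powr \<gamma>)) = (exp (- (x * ((\<gamma> - 1) * r powr \<gamma>))))\<^sup>2"
        by (simp add: power2_eq_square exp_add[symmetric])
      ultimately have "r powr (2 * (\<gamma> - 1) * (real k + 1) - d) * exp (- (2 * x * (\<gamma> - 1) * r powr \<gamma>)) = (h r * r powr (- d / 2))\<^sup>2"
        unfolding h_def by (simp add: power_mult_distrib mult_ac)
      thus "(ennreal (h r * r powr (- d / 2)))\<^sup>2 = ennreal (r powr (2 * (\<gamma> - 1) * (real k + 1) - d) * exp (- (2 * x * (\<gamma> - 1) * r powr \<gamma>)))"
        by (simp add: ennreal_power h0)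
    qed
  qed
  also have "\<dots> = ennreal ((2 * x * (\<gamma> - 1)) powr (- beta d k) * Gamma (beta d k) / \<gamma>)"
  proof -
    have "0 < 2 * (\<gamma> - 1) * (real k + 1) - d + 1"
      using beta_pos[OF d, of k] \<gamma> unfolding beta_def zero_less_divide_iff by linarith
    hence "-1 < 2 * (\<gamma> - 1) * (real k + 1) - d" by linarith
    thus ?thesis unfolding beta_def by (rule nn_integral_powr_exp_powr) (use x \<gamma> in auto)
  qed
  finally have CS: "(ennreal (cmod ?I))\<^sup>2 \<le> ennreal ((2 * x * (\<gamma> - 1)) powr (- beta d k) * Gamma (beta d k) / \<gamma>) * ?N" .
  have G0: "(2 * x * (\<gamma> - 1)) powr (- beta d k) * Gamma (beta d k) / \<gamma> \<ge> 0"
    using \<gamma> beta_pos[OF d, of k] by (simp add: less_imp_le[OF Gamma_real_pos])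
  have "(cmod (taylor_coeff k x))\<^sup>2 = ((x * \<gamma>) ^ k / fact k)\<^sup>2 * (cmod ?I)\<^sup>2"
    unfolding taylor_coeff_def h_def norm_mult norm_of_real by (subst power_mult_distrib) (simp only: power2_abs)
  hence "ennreal ((cmod (taylor_coeff k x))\<^sup>2) = ennreal (((x * \<gamma>) ^ k / fact k)\<^sup>2) * (ennreal (cmod ?I))\<^sup>2"
    by (simp add: ennreal_mult ennreal_power)
  also have "\<dots> \<le> ennreal (((x * \<gamma>) ^ k / fact k)\<^sup>2) * (ennreal ((2 * x * (\<gamma> - 1)) powr (- beta d k) * Gamma (beta d k) / \<gamma>) * ?N)"
    by (intro mult_left_mono CS) auto
  finally show ?thesis by (subst ennreal_mult[OF zero_le_power2 G0]) (simp only: mult.assoc)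
qed

text \<open>Combining \<open>taylor_coeff_bound\<close> with the energy identity bounds each mode by \<open>C\<close>; Bessel's
  inequality in \<open>\<theta>\<close> and Plancherel's identity in \<open>s\<close> reassemble the norm of the data.\<close>
lemma normsq_upper:
  assumes d: "-1 < d" "d < 2 * \<gamma> - 1" and C: "\<And>k. mode_normsq \<gamma> d k \<le> C"
  shows "polar_normsq d bd \<le>
    ennreal C * polar_normsq d F"
proof -
  interpret H: sigma_finite_measure half by simp
  interpret C: sigma_finite_measure circ by simp
  interpret HC: pair_sigma_finite half circ by (simp add: pair_sigma_finite_def)
  interpret HH: pair_sigma_finite half half by (simp add: pair_sigma_finite_def)
  have apos: "alpha d k > 0" for k using d \<gamma> by (simp add: alpha_def)
  have bpos: "beta d k > 0" for k by (rule beta_pos[OF d(2)])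
  have Cs0: "mode_normsq \<gamma> d k \<ge> 0" for k
    using apos[of k] bpos[of k] \<gamma> unfolding mode_normsq_def alpha_def beta_def
    by (intro divide_nonneg_nonneg mult_nonneg_nonneg less_imp_le[OF Gamma_real_pos]) auto
  have C0: "C \<ge> 0" using C[of 0] Cs0[of 0] by simp
  have termb: "ennreal (mode_energy d k x) \<le>
    ennreal (C / (4 * pi\<^sup>2)) * (\<integral>\<^sup>+r. ennreal (r powr d) * ennreal ((cmod (F_mode k r x))\<^sup>2) \<partial>half)" (is "_ \<le> _ * ?N") if x: "x > 0" for x k
  proof -
    let ?A = "\<gamma> ^ 3 / (4 * pi\<^sup>2) * (x\<^sup>2 * ((2 * x) powr (- alpha d k) * Gamma (alpha d k)))"
    let ?B = "((x * \<gamma>) ^ k / fact k)\<^sup>2 * ((2 * x * (\<gamma> - 1)) powr (- beta d k) * Gamma (beta d k) / \<gamma>)"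
    have A0: "?A \<ge> 0" using \<gamma> apos by (simp add: less_imp_le[OF Gamma_real_pos])
    have B0': "?B \<ge> 0" using \<gamma> bpos by (simp add: less_imp_le[OF Gamma_real_pos])
    have "ennreal (mode_energy d k x) = ennreal ?A * ennreal ((cmod (taylor_coeff k x))\<^sup>2)"
      by (subst ennreal_mult[OF A0, symmetric]) (auto simp: mult_ac)
    also have "\<dots> \<le> ennreal ?A * (ennreal ?B * ?N)"
      by (intro mult_left_mono taylor_coeff_bound x d) auto
    also have "\<dots> = ennreal (?A * ?B) * ?N" by (subst ennreal_mult[OF A0 B0']) (rule mult.assoc[symmetric])
    also have "?A * ?B = mode_normsq \<gamma> d k / (4 * pi\<^sup>2)" unfolding mode_normsq_constant[OF x, of k d, symmetric] by (simp add: mult_ac)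
    also have "ennreal \<dots> * ?N \<le> ennreal (C / (4 * pi\<^sup>2)) * ?N"
      by (intro mult_right_mono ennreal_leI divide_right_mono C) auto
    finally show ?thesis .
  qed
  let ?J = "\<lambda>x. \<integral>\<^sup>+r. \<integral>\<^sup>+\<theta>. ennreal (r powr d) * ennreal ((cmod (F_hat r \<theta> x))\<^sup>2) \<partial>circ \<partial>half"
  have sumk: "(\<Sum>k. ennreal (mode_energy d k x)) \<le>
     ennreal (C / (2 * pi)) * ?J x" if x: "x > 0" for x
  proof -
    have st: "(\<Sum>k. ennreal (mode_energy d k x)) \<le>
      (\<Sum>k. ennreal (C / (4 * pi\<^sup>2)) * (\<integral>\<^sup>+r. ennreal (r powr d) * ennreal ((cmod (F_mode k r x))\<^sup>2) \<partial>half))"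
      by (intro suminf_le termb x) auto
    have st2: "(\<Sum>k. ennreal (C / (4 * pi\<^sup>2)) * (\<integral>\<^sup>+r. ennreal (r powr d) * ennreal ((cmod (F_mode k r x))\<^sup>2) \<partial>half)) = ennreal (C / (4 * pi\<^sup>2)) * (\<Sum>k. (\<integral>\<^sup>+r. ennreal (r powr d) * ennreal ((cmod (F_mode k r x))\<^sup>2) \<partial>half))"
      by (rule ennreal_suminf_cmult)
    have "(\<Sum>k. (\<integral>\<^sup>+r. ennreal (r powr d) * ennreal ((cmod (F_mode k r x))\<^sup>2) \<partial>half)) = (\<integral>\<^sup>+r. (\<Sum>k. ennreal (r powr d) * ennreal ((cmod (F_mode k r x))\<^sup>2)) \<partial>half)"
      by (rule nn_integral_suminf[symmetric]) measurable
    also have "\<dots> = (\<integral>\<^sup>+r. ennreal (r powr d) * (\<Sum>k. ennreal ((cmod (F_mode k r x))\<^sup>2)) \<partial>half)"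
      by (simp only: ennreal_suminf_cmult)
    also have "\<dots> \<le> (\<integral>\<^sup>+r. ennreal (2 * pi) * (\<integral>\<^sup>+\<theta>. ennreal (r powr d) * ennreal ((cmod (F_hat r \<theta> x))\<^sup>2) \<partial>circ) \<partial>half)"
    proof (rule nn_integral_mono)
      fix r
      have "(\<Sum>k. ennreal ((cmod (F_mode k r x))\<^sup>2)) \<le> ennreal (2 * pi) * (\<integral>\<^sup>+\<theta>. ennreal ((cmod (F_hat r \<theta> x))\<^sup>2) \<partial>circ)"
        unfolding F_mode_def by (rule bessel[OF _ F_hat_bound]) measurable
      hence "ennreal (r powr d) * (\<Sum>k. ennreal ((cmod (F_mode k r x))\<^sup>2)) \<le> ennreal (r powr d) * (ennreal (2 * pi) * (\<integral>\<^sup>+\<theta>. ennreal ((cmod (F_hat r \<theta> x))\<^sup>2) \<partial>circ))"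
        by (intro mult_left_mono) auto
      also have "\<dots> = ennreal (2 * pi) * (\<integral>\<^sup>+\<theta>. ennreal (r powr d) * ennreal ((cmod (F_hat r \<theta> x))\<^sup>2) \<partial>circ)"
        by (subst nn_integral_cmult) (auto simp: mult.left_commute)
      finally show "ennreal (r powr d) * (\<Sum>k. ennreal ((cmod (F_mode k r x))\<^sup>2)) \<le> ennreal (2 * pi) * (\<integral>\<^sup>+\<theta>. ennreal (r powr d) * ennreal ((cmod (F_hat r \<theta> x))\<^sup>2) \<partial>circ)" .
    qed
    also have "\<dots> = ennreal (2 * pi) * ?J x" by (rule nn_integral_cmult) measurable
    finally have M: "(\<Sum>k. (\<integral>\<^sup>+r. ennreal (r powr d) * ennreal ((cmod (F_mode k r x))\<^sup>2) \<partial>half)) \<le> ennreal (2 * pi) * ?J x" .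
    note st
    also note st2
    also have "ennreal (C / (4 * pi\<^sup>2)) * (\<Sum>k. (\<integral>\<^sup>+r. ennreal (r powr d) * ennreal ((cmod (F_mode k r x))\<^sup>2) \<partial>half)) \<le>
      ennreal (C / (4 * pi\<^sup>2)) * (ennreal (2 * pi) * ?J x)" by (intro mult_left_mono M) auto
    also have "\<dots> = ennreal (C / (2 * pi)) * ?J x"
    proof -
      have "C / (4 * pi\<^sup>2) * (2 * pi) = C / (2 * pi)" by (simp add: power2_eq_square)
      hence "ennreal (C / (4 * pi\<^sup>2)) * ennreal (2 * pi) = ennreal (C / (2 * pi))" using C0 by (subst ennreal_mult[symmetric]) auto
      thus ?thesis by (simp only: mult.assoc[symmetric])
    qed
    finally show ?thesis .
  qed
  have "polar_normsq d bd \<le> (\<integral>\<^sup>+x. ennreal (C / (2 * pi)) * ?J x \<partial>half)"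
    unfolding normsq_bd[OF d(1)]
    by (rule nn_integral_mono_AE) (use AE_half in \<open>eventually_elim, use sumk in auto\<close>)
  also have "\<dots> = ennreal (C / (2 * pi)) * (\<integral>\<^sup>+x. ?J x \<partial>half)" by (rule nn_integral_cmult) measurable
  finally have st: "polar_normsq d bd \<le> ennreal (C / (2 * pi)) * (\<integral>\<^sup>+x. ?J x \<partial>half)" .
  have "(\<integral>\<^sup>+x. ?J x \<partial>half) = (\<integral>\<^sup>+r. \<integral>\<^sup>+x. \<integral>\<^sup>+\<theta>. ennreal (r powr d) * ennreal ((cmod (F_hat r \<theta> x))\<^sup>2) \<partial>circ \<partial>half \<partial>half)"
    by (rule HH.Fubini') measurable
  also have "\<dots> = (\<integral>\<^sup>+r. \<integral>\<^sup>+\<theta>. \<integral>\<^sup>+x. ennreal (r powr d) * ennreal ((cmod (F_hat r \<theta> x))\<^sup>2) \<partial>half \<partial>circ \<partial>half)"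
    by (intro nn_integral_cong HC.Fubini'[symmetric]) measurable
  also have "\<dots> \<le> (\<integral>\<^sup>+r. \<integral>\<^sup>+\<theta>. ennreal (2 * pi) * (\<integral>\<^sup>+s. ennreal (r powr d) * ennreal ((cmod (F r \<theta> s))\<^sup>2) \<partial>lborel) \<partial>circ \<partial>half)"
  proof (intro nn_integral_mono)
    fix r \<theta>
    have "(\<integral>\<^sup>+x. ennreal (r powr d) * ennreal ((cmod (F_hat r \<theta> x))\<^sup>2) \<partial>half) \<le> (\<integral>\<^sup>+x. ennreal (r powr d) * ennreal ((cmod (F_hat r \<theta> x))\<^sup>2) \<partial>lborel)"
      by (subst nn_integral_half) (auto intro!: nn_integral_mono simp: indicator_def)
    also have "\<dots> = ennreal (r powr d) * (\<integral>\<^sup>+x. ennreal ((cmod (F_hat r \<theta> x))\<^sup>2) \<partial>lborel)" by (rule nn_integral_cmult) measurable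
    also have "(\<integral>\<^sup>+x. ennreal ((cmod (F_hat r \<theta> x))\<^sup>2) \<partial>lborel) = ennreal (2 * pi) * (\<integral>\<^sup>+s. ennreal ((cmod (F r \<theta> s))\<^sup>2) \<partial>lborel)"
      unfolding F_hat_def by (rule plancherel[OF integrable_F bound cont])
    also have "ennreal (r powr d) * \<dots> = ennreal (2 * pi) * (\<integral>\<^sup>+s. ennreal (r powr d) * ennreal ((cmod (F r \<theta> s))\<^sup>2) \<partial>lborel)"
      by (subst nn_integral_cmult) (auto simp: mult.left_commute)
    finally show "(\<integral>\<^sup>+x. ennreal (r powr d) * ennreal ((cmod (F_hat r \<theta> x))\<^sup>2) \<partial>half) \<le> ennreal (2 * pi) * (\<integral>\<^sup>+s. ennreal (r powr d) * ennreal ((cmod (F r \<theta> s))\<^sup>2) \<partial>lborel)" .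
  qed
  also have "\<dots> = ennreal (2 * pi) * polar_normsq d F"
    by (simp add: nn_integral_cmult)
  finally have M: "(\<integral>\<^sup>+x. ?J x \<partial>half) \<le> ennreal (2 * pi) * polar_normsq d F" .
  note st
  also have "ennreal (C / (2 * pi)) * (\<integral>\<^sup>+x. ?J x \<partial>half) \<le> ennreal (C / (2 * pi)) * (ennreal (2 * pi) * polar_normsq d F)"
    by (intro mult_left_mono M) auto
  also have "ennreal (C / (2 * pi)) * (ennreal (2 * pi) * polar_normsq d F) =
     ennreal C * polar_normsq d F"
  proof -
    have "ennreal (C / (2 * pi)) * ennreal (2 * pi) = ennreal C" using C0 by (subst ennreal_mult[symmetric]) auto
    thus ?thesis by (simp only: mult.assoc[symmetric])
  qed
  finally show ?thesis .
qed

end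

section \<open>Smooth functions\<close>

lemma Ck_on_cong:
  assumes S: "open S" and eq: "\<And>x. x \<in> S \<Longrightarrow> f x = g x"
  shows "Ck_on k S f \<longleftrightarrow> Ck_on k S g"
  using eq
proof (induction k arbitrary: f g)
  case 0 thus ?case by (simp cong: continuous_on_cong)
next
  case (Suc k)
  have hd: "(f has_derivative D) (at x) \<longleftrightarrow> (g has_derivative D) (at x)" if "x \<in> S" for x D
    using has_derivative_transform_within_open[OF _ S that, of f D UNIV g]
      has_derivative_transform_within_open[OF _ S that, of g D UNIV f] Suc.prems by auto
  have d: "f differentiable (at x) \<longleftrightarrow> g differentiable (at x)" if "x \<in> S" for x
    unfolding differentiable_def using hd[OF that] by simp
  have fd: "frechet_derivative f (at x) = frechet_derivative g (at x)" if "x \<in> S" for x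
    unfolding frechet_derivative_def using hd[OF that] by simp
  have "Ck_on k S (\<lambda>x. frechet_derivative f (at x) v) \<longleftrightarrow> Ck_on k S (\<lambda>x. frechet_derivative g (at x) v)" for v
    by (rule Suc.IH) (simp add: fd)
  thus ?case using d by simp
qed

text \<open>On an open set any known derivative may replace the chosen \<^const>\<open>frechet_derivative\<close>.\<close>
lemma Ck_on_SucI:
  assumes S: "open S" and D: "\<And>x. x \<in> S \<Longrightarrow> (f has_derivative D x) (at x)" and C: "\<And>v. Ck_on k S (\<lambda>x. D x v)"
  shows "Ck_on (Suc k) S f"
proof -
  have "Ck_on k S (\<lambda>x. frechet_derivative f (at x) v)" for v
    using C[of v] by (subst Ck_on_cong[OF S]) (auto simp: frechet_derivative_at[OF D, symmetric])
  thus ?thesis using D by (auto simp: differentiable_def)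
qed

lemma Ck_on_Suc_continuous: "Ck_on (Suc k) S f \<Longrightarrow> continuous_on S f"
  by (auto simp: continuous_on_eq_continuous_within intro!: differentiable_imp_continuous_within intro: differentiable_at_withinI)

lemma Ck_on_Suc_imp: "Ck_on (Suc k) S f \<Longrightarrow> Ck_on k S f"
proof (induction k arbitrary: f)
  case 0 thus ?case using Ck_on_Suc_continuous[of 0 S f] by simp
qed simp

lemma Ck_on_const: "Ck_on k S (\<lambda>_. c)"
  by (induction k arbitrary: c) (auto simp: frechet_derivative_const)

lemma Ck_on_linear:
  assumes "bounded_linear f" "open S" shows "Ck_on k S f"
proof (cases k)
  case 0 thus ?thesis using assms by (simp add: linear_continuous_on)
next
  case (Suc j)
  show ?thesis unfolding Suc
    by (rule Ck_on_SucI[OF assms(2)]) (auto intro: bounded_linear_imp_has_derivative assms Ck_on_const)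
qed

lemma Ck_on_add:
  assumes "open S" "Ck_on k S f" "Ck_on k S g" shows "Ck_on k S (\<lambda>x. f x + g x)"
  using assms(2,3)
proof (induction k arbitrary: f g)
  case 0 thus ?case by (auto intro: continuous_on_add)
next
  case (Suc k)
  show ?case
  proof (rule Ck_on_SucI[OF assms(1)])
    show "((\<lambda>x. f x + g x) has_derivative (\<lambda>v. frechet_derivative f (at x) v + frechet_derivative g (at x) v)) (at x)" if "x \<in> S" for x
      using Suc.prems that by (intro has_derivative_add) (auto simp: frechet_derivative_works)
    show "Ck_on k S (\<lambda>x. frechet_derivative f (at x) v + frechet_derivative g (at x) v)" for v
      using Suc.prems by (intro Suc.IH) auto
  qed
qed

lemma Ck_on_bilinear:
  assumes b: "bounded_bilinear pr" and S: "open S" and "Ck_on k S f" "Ck_on k S g"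
  shows "Ck_on k S (\<lambda>x. pr (f x) (g x))"
  using assms(3,4)
proof (induction k arbitrary: f g)
  case 0 thus ?case by (auto intro: bounded_bilinear.continuous_on[OF b])
next
  case (Suc k)
  show ?case
  proof (rule Ck_on_SucI[OF S])
    show "((\<lambda>x. pr (f x) (g x)) has_derivative (\<lambda>v. pr (f x) (frechet_derivative g (at x) v) + pr (frechet_derivative f (at x) v) (g x))) (at x)" if "x \<in> S" for x
      using Suc.prems that by (intro bounded_bilinear.FDERIV[OF b]) (auto simp: frechet_derivative_works)
    show "Ck_on k S (\<lambda>x. pr (f x) (frechet_derivative g (at x) v) + pr (frechet_derivative f (at x) v) (g x))" for v
      using Suc.prems Ck_on_Suc_imp[OF Suc.prems(1)] Ck_on_Suc_imp[OF Suc.prems(2)]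
      by (intro Ck_on_add S Suc.IH) auto
  qed
qed

lemmas Ck_on_mult = Ck_on_bilinear[OF bounded_bilinear_mult]
lemmas Ck_on_scaleR = Ck_on_bilinear[OF bounded_bilinear_scaleR]

lemma Ck_on_power:
  fixes f :: "_ \<Rightarrow> complex"
  assumes "open S" "Ck_on k S f" shows "Ck_on k S (\<lambda>x. f x ^ n)"
proof (induction n)
  case 0 show ?case by (simp add: Ck_on_const)
next
  case (Suc n) show ?case using Ck_on_mult[OF assms Suc] by simp
qed

text \<open>For a sequence \<open>\<Phi>\<close> of successive derivatives, the chain rule expresses the derivative of
  \<open>\<Phi> j \<circ> g\<close> by \<open>\<Phi> (Suc j) \<circ> g\<close>, a function of the same kind, so induction on the order closes.\<close>
lemma Ck_on_compose:
  fixes \<Phi> :: "nat \<Rightarrow> real \<Rightarrow> 'b::real_normed_vector"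
  assumes S: "open S" and g: "Ck_on k S g" "\<And>x. x \<in> S \<Longrightarrow> g x \<in> T"
    and D: "\<And>j y. y \<in> T \<Longrightarrow> (\<Phi> j has_vector_derivative \<Phi> (Suc j) y) (at y)"
  shows "Ck_on k S (\<lambda>x. \<Phi> j (g x))"
  using g(1)
proof (induction k arbitrary: j)
  case 0
  have "continuous_on T (\<Phi> j)"
    unfolding continuous_on_eq_continuous_within
    using D has_vector_derivative_continuous continuous_at_imp_continuous_at_within by blast
  thus ?case using 0 g(2) by (auto intro: continuous_on_compose2)
next
  case (Suc k)
  show ?case
  proof (rule Ck_on_SucI[OF S])
    show "((\<lambda>x. \<Phi> j (g x)) has_derivative (\<lambda>v. frechet_derivative g (at x) v *\<^sub>R \<Phi> (Suc j) (g x))) (at x)" if "x \<in> S" for x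
      using has_derivative_compose[of g "frechet_derivative g (at x)" x UNIV "\<Phi> j" "\<lambda>h. h *\<^sub>R \<Phi> (Suc j) (g x)"]
        D[OF g(2)[OF that], of j] Suc.prems that by (auto simp: frechet_derivative_works has_vector_derivative_def)
    show "Ck_on k S (\<lambda>x. frechet_derivative g (at x) v *\<^sub>R \<Phi> (Suc j) (g x))" for v
    proof (rule Ck_on_scaleR[OF S])
      show "Ck_on k S (\<lambda>x. frechet_derivative g (at x) v)" using Suc.prems by simp
      show "Ck_on k S (\<lambda>x. \<Phi> (Suc j) (g x))" by (rule Suc.IH[OF Ck_on_Suc_imp[OF Suc.prems]])
    qed
  qed
qed

subsection \<open>Compositions with powers, exponentials and a flat function\<close>

definition powr_tower :: "real \<Rightarrow> nat \<Rightarrow> real \<Rightarrow> real" where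
  "powr_tower a j y = (\<Prod>i<j. a - real i) * y powr (a - real j)"

lemma powr_tower_deriv: "y > 0 \<Longrightarrow> (powr_tower a j has_vector_derivative powr_tower a (Suc j) y) (at y)"
  unfolding powr_tower_def[abs_def] has_real_derivative_iff_has_vector_derivative[symmetric]
  by (auto intro!: derivative_eq_intros simp: algebra_simps)

lemma Ck_on_powr:
  fixes g :: "_ \<Rightarrow> real"
  assumes "open S" "Ck_on k S g" "\<And>x. x \<in> S \<Longrightarrow> g x > 0" shows "Ck_on k S (\<lambda>x. g x powr a)"
  using Ck_on_compose[OF assms(1,2), of "{0<..}" "powr_tower a" 0] assms(3) powr_tower_deriv by (simp add: powr_tower_def)

lemma Ck_on_exp:
  fixes g :: "_ \<Rightarrow> real"
  assumes "open S" "Ck_on k S g" shows "Ck_on k S (\<lambda>x. exp (g x))"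
  by (rule Ck_on_compose[OF assms(1,2), of UNIV "\<lambda>_. exp"])
     (auto simp: has_real_derivative_iff_has_vector_derivative[symmetric] intro!: derivative_eq_intros)

lemma Ck_on_cis:
  fixes g :: "_ \<Rightarrow> real"
  assumes "open S" "Ck_on k S g" shows "Ck_on k S (\<lambda>x. cis (g x))"
proof -
  have "((\<lambda>y. \<i> ^ j * cis y) has_vector_derivative \<i> ^ Suc j * cis y) (at y)" for j y
  proof -
    have "((\<lambda>z. \<i> ^ j * exp (\<i> * z)) has_field_derivative \<i> ^ Suc j * exp (\<i> * of_real y)) (at (of_real y))"
      by (auto intro!: derivative_eq_intros)
    from has_vector_derivative_real_field[OF this] show ?thesis by (simp add: cis_conv_exp)
  qed
  from Ck_on_compose[OF assms(1,2), of UNIV "\<lambda>j y. \<i> ^ j * cis y" 0, OF _ this] show ?thesis by simp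
qed

text \<open>
  The \<open>j\<close>-th derivative of \<open>exp (- 1/u)\<close> is a polynomial in \<open>1/u\<close> times \<open>exp (- 1/u)\<close>. With \<open>y = 1/u\<close>,
  differentiation in \<open>u\<close> acts on the polynomial as \<open>p \<mapsto> y\<^sup>2 (p - p')\<close>.\<close>
definition flat_poly :: "nat \<Rightarrow> real poly" where
  "flat_poly j = ((\<lambda>p. [:0, 0, 1:] * (p - pderiv p)) ^^ j) 1"

definition flat_tower :: "nat \<Rightarrow> real \<Rightarrow> real" where
  "flat_tower j u = (if u > 0 then poly (flat_poly j) (1 / u) * exp (- (1 / u)) else 0)"

lemma flat_tower_deriv: "(flat_tower j has_vector_derivative flat_tower (Suc j) u) (at u)"
proof -
  have "(flat_tower j has_real_derivative flat_tower (Suc j) u) (at u)"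
  proof (cases u "0::real" rule: linorder_cases)
    case less
    have "((\<lambda>_. 0) has_real_derivative flat_tower (Suc j) u) (at u)" using less by (auto simp: flat_tower_def)
    thus ?thesis
      by (rule has_field_derivative_transform_within_open[of _ _ _ "{..<0}"]) (use less in \<open>auto simp: flat_tower_def\<close>)
  next
    case greater
    let ?p = "flat_poly j"
    have "((\<lambda>u. poly ?p (1 / u) * exp (- (1 / u))) has_real_derivative
       (poly (pderiv ?p) (1 / u) * (- (1 / u\<^sup>2)) * exp (- (1 / u)) + poly ?p (1 / u) * (exp (- (1 / u)) * (1 / u\<^sup>2)))) (at u)"
      using greater by (auto intro!: derivative_eq_intros poly_DERIV[THEN DERIV_chain2] simp: power2_eq_square field_simps)
    also have "(poly (pderiv ?p) (1 / u) * (- (1 / u\<^sup>2)) * exp (- (1 / u)) + poly ?p (1 / u) * (exp (- (1 / u)) * (1 / u\<^sup>2))) = flat_tower (Suc j) u"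
      using greater by (simp add: flat_tower_def flat_poly_def power2_eq_square algebra_simps)
    finally show ?thesis
      by (rule has_field_derivative_transform_within_open[of _ _ _ "{0<..}"]) (use greater in \<open>auto simp: flat_tower_def\<close>)
  next
    case equal
    let ?p = "flat_poly j"
    \<comment> \<open>The difference quotient at 0 is this expression at \<open>y = 1/u\<close>.\<close>
    have "((\<lambda>y. poly ([:0, 1:] * ?p) y * exp (- y)) \<longlongrightarrow> 0) at_top"
    proof -
      let ?q = "[:0, 1:] * ?p"
      have "((\<lambda>y. \<Sum>i\<le>degree ?q. coeff ?q i * (y ^ i / exp y)) \<longlongrightarrow> 0) at_top"
        by (intro tendsto_null_sum tendsto_mult_right_zero tendsto_power_div_exp_0)
      also have "(\<lambda>y. \<Sum>i\<le>degree ?q. coeff ?q i * (y ^ i / exp y)) = (\<lambda>y. poly ?q y * exp (- y))"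
        by (simp only: poly_altdef exp_minus sum_distrib_right divide_inverse mult.assoc)
      finally show ?thesis .
    qed
    hence "((\<lambda>u. poly ([:0, 1:] * ?p) (inverse u) * exp (- inverse u)) \<longlongrightarrow> 0) (at_right 0)"
      by (rule filterlim_compose[OF _ filterlim_inverse_at_top_right])
    hence "((\<lambda>h. flat_tower j h / h) \<longlongrightarrow> 0) (at_right 0)"
      by (rule Lim_transform_eventually)
         (use eventually_at_right_less[of 0] in eventually_elim, simp add: flat_tower_def field_simps)
    moreover have "((\<lambda>h. flat_tower j h / h) \<longlongrightarrow> 0) (at_left 0)"
    proof (rule Lim_transform_eventually[OF tendsto_const])
      have "\<forall>\<^sub>F h in at_left 0. h \<in> {-1<..<(0::real)}" by (rule eventually_at_left_real) simp
      thus "\<forall>\<^sub>F h in at_left 0. 0 = flat_tower j h / h" by eventually_elim (simp add: flat_tower_def)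
    qed
    ultimately have "((\<lambda>h. flat_tower j h / h) \<longlongrightarrow> 0) (at 0)" by (simp add: filterlim_at_split)
    thus ?thesis unfolding DERIV_def equal by (simp add: flat_tower_def)
  qed
  thus ?thesis by (simp add: has_real_derivative_iff_has_vector_derivative)
qed

definition flat :: "real \<Rightarrow> real" where "flat u = (if u > 0 then exp (- (1 / u)) else 0)"

lemma Ck_on_flat:
  assumes "open S" "Ck_on k S g" shows "Ck_on k S (\<lambda>x. flat (g x))"
proof -
  have "flat = flat_tower 0" by (auto simp: fun_eq_iff flat_def flat_tower_def flat_poly_def)
  thus ?thesis using Ck_on_compose[OF assms, of UNIV flat_tower 0] flat_tower_deriv by simp
qed

section \<open>Norms over the hypersurface\<close>

definition angle :: "complex \<Rightarrow> real" where
  "angle w = (let a = arccos (max (-1) (min 1 (Re w / cmod w))) in if 0 \<le> Im w then a else 2 * pi - a)"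

text \<open>A Borel angle with values in \<open>[0, 2\<pi>)\<close> makes the inverse of the parametrization Borel.\<close>
lemma angle_cis:
  assumes r: "r > 0" and t: "0 \<le> t" "t < 2 * pi"
  shows "angle (of_real r * cis t) = t"
proof -
  have n: "cmod (of_real r * cis t) = r" using r by (simp add: norm_mult)
  have c: "max (-1) (min 1 (Re (of_real r * cis t) / cmod (of_real r * cis t))) = cos t"
    unfolding n using r by (simp add: min_def max_def) (metis cos_ge_minus_one cos_le_one antisym)
  have i: "0 \<le> Im (of_real r * cis t) \<longleftrightarrow> 0 \<le> sin t" using r by (simp add: zero_le_mult_iff)
  show ?thesis
  proof (cases "t \<le> pi")
    case True
    hence "0 \<le> sin t" using t by (intro sin_ge_zero) auto
    thus ?thesis unfolding angle_def Let_def c i using True t by (simp add: arccos_cos)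
  next
    case False
    hence s: "\<not> 0 \<le> sin t" using sin_lt_zero[of t] t by simp
    have "arccos (cos t) = 2 * pi - t"
      using arccos_cos[of "2 * pi - t"] False t by (simp add: cos_diff)
    thus ?thesis unfolding angle_def Let_def c i using s by simp
  qed
qed

lemma polar_angle:
  assumes "w \<noteq> 0" shows "0 \<le> angle w \<and> angle w < 2 * pi \<and> of_real (cmod w) * cis (angle w) = w"
proof -
  define t where "t = Arg2pi w"
  have "w = of_real (cmod w) * exp (\<i> * of_real t)" "0 \<le> t" "t < 2 * pi"
    using Arg2pi[of w] by (auto simp: t_def is_Arg_def)
  hence w: "w = of_real (cmod w) * cis t" by (simp add: cis_conv_exp)
  have "angle w = t" using angle_cis[of "cmod w" t] assms \<open>0 \<le> t\<close> \<open>t < 2 * pi\<close> w by simp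
  thus ?thesis using w \<open>0 \<le> t\<close> \<open>t < 2 * pi\<close> by simp
qed

lemma measurable_angle [measurable]: "angle \<in> borel_measurable borel"
proof -
  have "continuous_on UNIV (\<lambda>x. arccos (max (-1) (min 1 x)))"
    by (intro continuous_intros) auto
  hence [measurable]: "(\<lambda>x. arccos (max (-1) (min 1 x))) \<in> borel_measurable borel" by (rule borel_measurable_continuous_onI)
  have "(\<lambda>w. arccos (max (-1) (min 1 (Re w / cmod w)))) \<in> borel_measurable borel"
    by (rule measurable_compose[of "\<lambda>w. Re w / cmod w" borel borel "\<lambda>x. arccos (max (-1) (min 1 x))"]) measurable
  note [measurable] = this
  show ?thesis unfolding angle_def Let_def by measurable
qed

definition par_inv :: "complex \<times> complex \<Rightarrow> real \<times> real \<times> real" where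
  "par_inv \<zeta> = (cmod (fst \<zeta>), angle (fst \<zeta>), Re (snd \<zeta>))"

lemma par_inv_par: "p \<in> pdom \<Longrightarrow> par_inv (par \<gamma> p) = p"
  by (cases p) (auto simp: par_inv_def par_def pdom_def angle_cis norm_mult)

lemma par_par_inv:
  assumes "\<zeta> \<in> Mgam \<gamma>" "fst \<zeta> \<noteq> 0" shows "par_inv \<zeta> \<in> pdom" "par \<gamma> (par_inv \<zeta>) = \<zeta>"
  using polar_angle[OF assms(2)] assms
  by (auto simp: par_inv_def par_def pdom_def Mgam_def complex_eq_iff prod_eq_iff)

lemma par_in_Mgam: "p \<in> pdom \<Longrightarrow> par \<gamma> p \<in> Mgam \<gamma> \<and> fst (par \<gamma> p) \<noteq> 0"
  by (cases p) (auto simp: par_def pdom_def Mgam_def norm_mult)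

lemma measurable_par_inv: "par_inv \<in> borel_measurable borel"
proof -
  have "par_inv \<in> (borel \<Otimes>\<^sub>M borel) \<rightarrow>\<^sub>M (borel \<Otimes>\<^sub>M (borel \<Otimes>\<^sub>M borel))"
    unfolding par_inv_def[abs_def] by measurable
  thus ?thesis by (simp add: borel_prod)
qed

lemma pdom_measurable: "pdom \<in> sets borel"
proof -
  have "pdom = {0<..} \<times> {0..<2*pi} \<times> UNIV" by (auto simp: pdom_def)
  also have "\<dots> \<in> sets (borel \<Otimes>\<^sub>M (borel \<Otimes>\<^sub>M borel))" by measurable
  finally show ?thesis unfolding borel_prod .
qed

lemma polar_measure: "half \<Otimes>\<^sub>M (circ \<Otimes>\<^sub>M lborel) = density lborel (indicator pdom)"
proof -
  have l: "(lborel :: real measure) = density lborel (\<lambda>_. 1)" by (simp add: density_1)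
  have 1: "circ \<Otimes>\<^sub>M lborel = density (lborel \<Otimes>\<^sub>M lborel) (\<lambda>(x,y::real). indicator {0..<2*pi} x * 1)"
    unfolding circ_def by (subst (2) l) (rule pair_measure_density, auto simp: sigma_finite_lborel density_1)
  have m: "(\<lambda>(x,y). indicator {0..<2*pi} x * 1 :: ennreal) \<in> borel_measurable (borel :: (real \<times> real) measure)"
    unfolding borel_prod[symmetric] by measurable
  have sf: "sigma_finite_measure (circ \<Otimes>\<^sub>M (lborel :: real measure))"
    by (rule sigma_finite_pair_measure) (auto simp: sigma_finite_lborel)
  have "half \<Otimes>\<^sub>M (circ \<Otimes>\<^sub>M (lborel :: real measure)) = density (lborel \<Otimes>\<^sub>M (lborel \<Otimes>\<^sub>M lborel)) (\<lambda>(x,y). indicator {0<..} x * (case y of (x,y) \<Rightarrow> indicator {0..<2*pi} x * 1))"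
    using sf unfolding 1 unfolding half_def
    by (intro pair_measure_density) (use m in \<open>auto simp: lborel_prod sigma_finite_lborel\<close>)
  also have "(\<lambda>(x,y). indicator {0<..} x * (case y of (x,y) \<Rightarrow> indicator {0..<2*pi} x * 1)) = (indicator pdom :: real \<times> real \<times> real \<Rightarrow> ennreal)"
    by (auto simp: fun_eq_iff indicator_def pdom_def)
  finally show ?thesis unfolding lborel_prod .
qed

definition esqrt :: "ennreal \<Rightarrow> ennreal" where "esqrt I = (if I = \<infinity> then \<infinity> else ennreal (sqrt (enn2real I)))"

lemma L2norm_esqrt: "L2norm M f = esqrt (\<integral>\<^sup>+ x. ennreal ((cmod (f x))\<^sup>2) \<partial>M)"
  by (simp add: L2norm_def esqrt_def Let_def)

lemma esqrt_mono: "a \<le> b \<Longrightarrow> esqrt a \<le> esqrt b"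
  by (auto simp: esqrt_def top_unique intro!: ennreal_leI enn2real_mono simp: less_top)

lemma esqrt_ennreal: "0 \<le> x \<Longrightarrow> esqrt (ennreal x) = ennreal (sqrt x)"
  by (simp add: esqrt_def)

lemma esqrt_mult: "C > 0 \<Longrightarrow> esqrt (ennreal C * I) = ennreal (sqrt C) * esqrt I"
proof (cases I)
  case (real x)
  assume "C > 0"
  thus ?thesis using real by (simp add: ennreal_mult[symmetric] esqrt_ennreal real_sqrt_mult)
next
  case top
  assume "C > 0"
  thus ?thesis using top by (simp add: esqrt_def ennreal_mult_top)
qed

lemma ennreal_divide_le:
  fixes x y c :: ennreal
  assumes "x \<le> c * y" shows "x / y \<le> c"
proof -
  have "x / y \<le> c * y / y" using assms by (rule divide_right_mono_ennreal)
  also have "c * y / y \<le> c"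
  proof -
    have "y * inverse y \<le> 1"
      by (cases y; cases "y = 0") (auto simp: inverse_ennreal ennreal_mult[symmetric])
    from mult_left_mono[OF this, of c] show ?thesis by (simp add: divide_ennreal_def mult.assoc)
  qed
  finally show ?thesis .
qed

text \<open>
  A test function is prescribed only on the hypersurface and need not be Borel on \<open>\<complex>\<^sup>2\<close>. It agrees
  almost everywhere with \<open>H \<circ> par_inv\<close>, which is Borel, and for that function the integral over the image
  measure can be pulled back.\<close>
lemma nn_integral_mu:
  assumes H: "(\<lambda>(r, \<theta>, s). H r \<theta> s :: complex) \<in> borel_measurable (borel \<Otimes>\<^sub>M (borel \<Otimes>\<^sub>M borel))"
    and f: "\<And>r \<theta> s. 0 < r \<Longrightarrow> 0 \<le> \<theta> \<Longrightarrow> \<theta> < 2 * pi \<Longrightarrow> f (par \<gamma> (r, \<theta>, s)) = H r \<theta> s"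
  shows "(\<integral>\<^sup>+ \<zeta>. ennreal ((cmod (f \<zeta>))\<^sup>2) \<partial>mu \<gamma> d) =
    polar_normsq d H"
proof -
  define h where "h = (\<lambda>(r, \<theta>, s). ennreal ((cmod (H r \<theta> s))\<^sup>2))"
  let ?G = "{\<zeta>. \<zeta> \<in> Mgam \<gamma> \<and> fst \<zeta> \<noteq> 0}"
  have hm: "h \<in> borel_measurable (borel \<Otimes>\<^sub>M (borel \<Otimes>\<^sub>M borel))"
  proof -
    have "(\<lambda>p. ennreal ((cmod ((\<lambda>(r, \<theta>, s). H r \<theta> s) p))\<^sup>2)) \<in> borel_measurable (borel \<Otimes>\<^sub>M (borel \<Otimes>\<^sub>M borel))"
      by (rule measurable_compose[OF H]) measurable
    thus ?thesis by (simp add: h_def case_prod_unfold)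
  qed
  hence [measurable]: "h \<in> borel_measurable borel" by (simp add: borel_prod)
  note [measurable] = measurable_par_inv par_measurable[of \<gamma>] pdom_measurable
  have dm: "(\<lambda>p. ennreal (fst p powr d) * indicator pdom p) \<in> borel_measurable (borel :: (real \<times> real \<times> real) measure)"
  proof -
    have "(\<lambda>p. ennreal (fst p powr d)) \<in> borel_measurable (borel \<Otimes>\<^sub>M (borel \<Otimes>\<^sub>M borel) :: (real \<times> real \<times> real) measure)" by measurable
    hence "(\<lambda>p. ennreal (fst p powr d)) \<in> borel_measurable (borel :: (real \<times> real \<times> real) measure)" by (simp add: borel_prod)
    thus ?thesis by measurable
  qed
  have Gm: "?G \<in> sets borel"
  proof -
    have "{\<zeta> \<in> space (borel \<Otimes>\<^sub>M borel). Im (snd \<zeta>) = cmod (fst \<zeta>) powr \<gamma> \<and> fst \<zeta> \<noteq> 0} \<in> sets (borel \<Otimes>\<^sub>M borel)" by measurable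
    thus ?thesis unfolding borel_prod by (simp add: Mgam_def)
  qed
  have "AE \<zeta> in mu \<gamma> d. \<zeta> \<in> ?G"
    unfolding mu_def
  proof (subst AE_distr_iff)
    show "AE x in density lborel (\<lambda>p. ennreal (fst p powr d) * indicator pdom p). par \<gamma> x \<in> ?G"
      using par_in_Mgam by (subst AE_density[OF ]) (use dm in \<open>auto simp: indicator_def\<close>)
  qed (use Gm in auto)
  hence "(\<integral>\<^sup>+ \<zeta>. ennreal ((cmod (f \<zeta>))\<^sup>2) \<partial>mu \<gamma> d) = (\<integral>\<^sup>+ \<zeta>. h (par_inv \<zeta>) \<partial>mu \<gamma> d)"
  proof (intro nn_integral_cong_AE, eventually_elim)
    fix \<zeta> assume z: "\<zeta> \<in> ?G"
    hence p: "par_inv \<zeta> \<in> pdom" "par \<gamma> (par_inv \<zeta>) = \<zeta>" using par_par_inv[of \<zeta> \<gamma>] by auto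
    obtain r \<theta> s where e: "par_inv \<zeta> = (r, \<theta>, s)" by (cases "par_inv \<zeta>")
    have "f \<zeta> = H r \<theta> s" using p f[of r \<theta> s] unfolding e by (auto simp: pdom_def)
    thus "ennreal ((cmod (f \<zeta>))\<^sup>2) = h (par_inv \<zeta>)" by (simp add: h_def e)
  qed
  also have "\<dots> = (\<integral>\<^sup>+ p. h (par_inv (par \<gamma> p)) \<partial>density lborel (\<lambda>p. ennreal (fst p powr d) * indicator pdom p))"
    unfolding mu_def by (rule nn_integral_distr) auto
  also have "\<dots> = (\<integral>\<^sup>+ p. (ennreal (fst p powr d) * indicator pdom p) * h (par_inv (par \<gamma> p)) \<partial>lborel)"
    by (rule nn_integral_density) (use dm in auto)
  also have "\<dots> = (\<integral>\<^sup>+ p. indicator pdom p * (ennreal (fst p powr d) * h p) \<partial>lborel)"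
    by (intro nn_integral_cong) (auto simp: indicator_def par_inv_par)
  also have "\<dots> = (\<integral>\<^sup>+ p. ennreal (fst p powr d) * h p \<partial>density lborel (indicator pdom))"
  proof (rule nn_integral_density[symmetric])
    have "(\<lambda>p. ennreal (fst p powr d) * h p) \<in> borel_measurable (borel \<Otimes>\<^sub>M (borel \<Otimes>\<^sub>M borel))" using hm by measurable
    thus "(\<lambda>p. ennreal (fst p powr d) * h p) \<in> borel_measurable lborel" by (simp add: borel_prod)
  qed measurable
  also have "\<dots> = (\<integral>\<^sup>+ p. ennreal (fst p powr d) * h p \<partial>(half \<Otimes>\<^sub>M (circ \<Otimes>\<^sub>M lborel)))" by (simp only: polar_measure)
  also have "\<dots> = (\<integral>\<^sup>+r. \<integral>\<^sup>+y. ennreal (fst (r, y) powr d) * h (r, y) \<partial>(circ \<Otimes>\<^sub>M lborel) \<partial>half)"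
  proof (rule sigma_finite_measure.nn_integral_fst[symmetric])
    show "sigma_finite_measure (circ \<Otimes>\<^sub>M (lborel :: real measure))" by (rule sigma_finite_pair_measure) (auto simp: sigma_finite_lborel)
    show "(\<lambda>p. ennreal (fst p powr d) * h p) \<in> borel_measurable (half \<Otimes>\<^sub>M (circ \<Otimes>\<^sub>M lborel))"
      using hm by measurable
  qed
  also have "\<dots> = (\<integral>\<^sup>+r. \<integral>\<^sup>+\<theta>. \<integral>\<^sup>+s. ennreal (fst (r, \<theta>, s) powr d) * h (r, \<theta>, s) \<partial>lborel \<partial>circ \<partial>half)"
  proof (rule nn_integral_cong)
    fix r
    have "(\<lambda>y. ennreal (fst (r, y) powr d) * h (r, y)) \<in> borel_measurable (circ \<Otimes>\<^sub>M lborel)"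
      using measurable_compose[OF measurable_Pair1'[of r borel "borel \<Otimes>\<^sub>M borel"] hm]
      by (simp cong: measurable_cong_sets add: borel_measurable_times_ennreal)
    thus "(\<integral>\<^sup>+y. ennreal (fst (r, y) powr d) * h (r, y) \<partial>(circ \<Otimes>\<^sub>M lborel)) = (\<integral>\<^sup>+\<theta>. \<integral>\<^sup>+s. ennreal (fst (r, \<theta>, s) powr d) * h (r, \<theta>, s) \<partial>lborel \<partial>circ)"
      by (rule sigma_finite_measure.nn_integral_fst[OF sigma_finite_lborel, symmetric])
  qed
  finally show ?thesis by (simp add: h_def)
qed


subsection \<open>Fourier decay of test functions\<close>
lemma fourier_deriv:
  fixes u u' :: "real \<Rightarrow> complex"
  assumes D: "\<And>s. (u has_vector_derivative u' s) (at s)" and c: "continuous_on UNIV u'"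
    and u0: "\<And>s. \<bar>s\<bar> > S \<Longrightarrow> u s = 0" and S: "S \<ge> 0"
  shows "\<And>s. \<bar>s\<bar> > S \<Longrightarrow> u' s = 0" and "fourier u' x = \<i> * of_real x * fourier u x"
proof -
  show z: "u' s = 0" if "\<bar>s\<bar> > S" for s
  proof -
    have "open {s. S < \<bar>s\<bar>}" by (intro open_Collect_less continuous_intros)
    hence "((\<lambda>_. 0) has_vector_derivative u' s) (at s)"
      using has_vector_derivative_transform_within_open[OF D[of s], of "{s. S < \<bar>s\<bar>}" "\<lambda>_. 0"] that u0 by auto
    moreover have "((\<lambda>_. 0) has_vector_derivative 0) (at s)" by simp
    ultimately show ?thesis by (rule vector_derivative_unique_at)
  qed
  have cu: "continuous_on UNIV u"
    using D by (auto simp: continuous_on_eq_continuous_within intro: has_vector_derivative_continuous)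
  have cont_cis: "continuous_on UNIV (\<lambda>s. cis (- (x * s)))" by (intro continuous_intros)
  let ?T = "S + 1"
  let ?f = "\<lambda>s. u' s * cis (- (x * s)) + u s * (- (\<i> * of_real x) * cis (- (x * s)))"
  have Dc: "((\<lambda>s. cis (- (x * s))) has_vector_derivative - (\<i> * of_real x) * cis (- (x * s))) (at s)" for s
  proof -
    have "((\<lambda>z. exp (- (\<i> * of_real x * z))) has_field_derivative - (\<i> * of_real x) * exp (- (\<i> * of_real x * of_real s))) (at (of_real s))"
      by (auto intro!: derivative_eq_intros)
    from has_vector_derivative_real_field[OF this] show ?thesis by (simp add: cis_conv_exp mult_ac)
  qed
  have "(\<integral>s. indicator {-?T..?T} s *\<^sub>R ?f s \<partial>lborel) = u ?T * cis (- (x * ?T)) - u (- ?T) * cis (- (x * (- ?T)))"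
  proof (rule integral_FTC_Icc)
    show "continuous_on {-?T..?T} ?f"
      using c cu cont_cis by (intro continuous_intros) (auto intro: continuous_on_subset)
    show "((\<lambda>s. u s * cis (- (x * s))) has_vector_derivative ?f s) (at s within {-?T..?T})" for s
      using has_vector_derivative_mult[OF D[of s] Dc[of s]] by (auto simp: add.commute intro: has_vector_derivative_at_within)
  qed (use S in auto)
  also have "\<dots> = 0" using u0[of ?T] u0[of "- ?T"] S by simp
  finally have I: "(\<integral>s. indicator {-?T..?T} s *\<^sub>R ?f s \<partial>lborel) = 0" .
  have iv: "integrable lborel (\<lambda>s. v s * cis (- (x * s)))" if "continuous_on UNIV v" "\<And>s. \<bar>s\<bar> > S \<Longrightarrow> v s = 0" for v :: "real \<Rightarrow> complex"
  proof -
    have "integrable lborel (\<lambda>s. indicator {-?T..?T} s *\<^sub>R (v s * cis (- (x * s))))"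
      by (rule borel_integrable_compact) (use that(1) cont_cis in \<open>auto intro!: continuous_intros intro: continuous_on_subset\<close>)
    also have "(\<lambda>s. indicator {-?T..?T} s *\<^sub>R (v s * cis (- (x * s)))) = (\<lambda>s. v s * cis (- (x * s)))"
      using that(2) by (auto simp: fun_eq_iff indicator_def abs_if split: if_splits)
    finally show ?thesis .
  qed
  have "(\<lambda>s. indicator {-?T..?T} s *\<^sub>R ?f s) = (\<lambda>s. u' s * cis (- (x * s)) + (- (\<i> * of_real x)) * (u s * cis (- (x * s))))"
    using u0 z by (auto simp: fun_eq_iff indicator_def abs_if split: if_splits)
  hence "0 = (\<integral>s. u' s * cis (- (x * s)) + (- (\<i> * of_real x)) * (u s * cis (- (x * s))) \<partial>lborel)" using I by simp
  also have "\<dots> = fourier u' x + (- (\<i> * of_real x)) * fourier u x"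
    unfolding fourier_def using iv[OF c z] iv[OF cu u0]
    by (subst Bochner_Integration.integral_add) auto
  finally show "fourier u' x = \<i> * of_real x * fourier u x" by algebra
qed

lemma fourier_bound_support:
  fixes v :: "real \<Rightarrow> complex"
  assumes b: "\<And>s. cmod (v s) \<le> M" and z: "\<And>s. \<bar>s\<bar> > S \<Longrightarrow> v s = 0" and S: "S \<ge> 0"
  shows "cmod (fourier v x) \<le> 2 * S * M"
proof -
  have M: "M \<ge> 0" using b[of 0] norm_ge_zero order_trans by blast
  show ?thesis
  proof (cases "integrable lborel (\<lambda>s. v s * cis (- (x * s)))")
    case True
    have "cmod (fourier v x) \<le> (\<integral>s. cmod (v s * cis (- (x * s))) \<partial>lborel)"
      unfolding fourier_def by (rule integral_norm_bound)
    also have "\<dots> \<le> (\<integral>s. M * indicator {-S..S} s \<partial>lborel)"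
    proof (rule Bochner_Integration.integral_mono)
      show "integrable lborel (\<lambda>s. M * indicator {-S..S} s)"
        by (intro integrable_mult_right integrable_real_indicator) (auto simp: emeasure_lborel_Icc_eq)
      show "cmod (v s * cis (- (x * s))) \<le> M * indicator {-S..S} s" for s
        using b[of s] z[of s] by (auto simp: norm_mult indicator_def abs_if split: if_splits)
    qed (use True in simp)
    also have "\<dots> = 2 * S * M" using S by simp
    finally show ?thesis .
  qed (use M S in \<open>simp add: fourier_def not_integrable_integral_eq\<close>)
qed

definition deriv_s :: "(complex \<times> real \<Rightarrow> complex) \<Rightarrow> complex \<times> real \<Rightarrow> complex" where
  "deriv_s g z = frechet_derivative g (at z) (0, 1)"

lemma deriv_s_Ck: "(\<And>k. Ck_on k S g) \<Longrightarrow> Ck_on k S (deriv_s g)"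
  using Ck_on.simps(2)[of k S g] unfolding deriv_s_def[abs_def] by blast

lemma deriv_s_deriv:
  assumes "\<And>k. Ck_on k S g" "(w, s) \<in> S"
  shows "((\<lambda>s. g (w, s)) has_vector_derivative deriv_s g (w, s)) (at s)"
proof -
  have "g differentiable (at (w, s))" using assms(1)[of "Suc 0"] assms(2) by auto
  hence "(g has_derivative frechet_derivative g (at (w, s))) (at (w, s))" by (simp add: frechet_derivative_works)
  moreover have "((\<lambda>s. (w, s)) has_derivative (\<lambda>h. (0, h))) (at s)" by (auto intro!: derivative_eq_intros)
  ultimately have "((\<lambda>s. g (w, s)) has_derivative (\<lambda>h. frechet_derivative g (at (w, s)) (0, h))) (at s)"
    using has_derivative_compose[of "\<lambda>s. (w, s)" "\<lambda>h. (0, h)" s UNIV g] by simp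
  moreover have "frechet_derivative g (at (w, s)) (0, h) = h *\<^sub>R deriv_s g (w, s)" for h
  proof -
    have "linear (frechet_derivative g (at (w, s)))"
      using \<open>g differentiable (at (w, s))\<close> by (rule linear_frechet_derivative)
    from linear_scale[OF this, of h "(0, 1)"] show ?thesis by (simp add: deriv_s_def)
  qed
  ultimately show ?thesis by (simp add: has_vector_derivative_def)
qed

text \<open>Compactness bounds the support in \<open>r\<close>, away from 0, and in \<open>s\<close>; three derivatives in \<open>s\<close>, bounded
  uniformly on the support, give the cubic decay of the Fourier transform.\<close>
lemma test_fun_leray_data:
  assumes \<gamma>: "\<gamma> > 1" and t: "test_fun \<gamma> f"
  shows "\<exists>F r0 R S B. leray_data \<gamma> F r0 R S B \<and> (\<forall>r \<theta> s. r > 0 \<longrightarrow> F r \<theta> s = f (par \<gamma> (r, \<theta>, s)))"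
proof -
  let ?S = "{(w, s). w \<noteq> 0} :: (complex \<times> real) set"
  define g where "g = (\<lambda>(w :: complex, s :: real). f (w, Complex s (cmod w powr \<gamma>)))"
  from t obtain supp_set where supp_set: "compact supp_set" "supp_set \<subseteq> Mgam \<gamma> \<inter> {\<zeta>. fst \<zeta> \<noteq> 0}" "\<And>\<zeta>. \<zeta> \<in> Mgam \<gamma> - supp_set \<Longrightarrow> f \<zeta> = 0"
    and Ck: "\<And>k. Ck_on k ?S g" unfolding test_fun_def g_def by auto
  obtain b where b: "\<And>\<zeta>. \<zeta> \<in> supp_set \<Longrightarrow> norm \<zeta> \<le> b" "b > 0" using compact_imp_bounded[OF supp_set(1)] by (auto simp: bounded_pos)
  have "\<exists>r0>0. \<forall>\<zeta>\<in>supp_set. r0 \<le> cmod (fst \<zeta>)"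
  proof (cases "supp_set = {}")
    case False
    have "continuous_on supp_set (\<lambda>\<zeta>. cmod (fst \<zeta>))" by (intro continuous_intros)
    from continuous_attains_inf[OF supp_set(1) False this] obtain \<zeta>0 where "\<zeta>0 \<in> supp_set" "\<forall>\<zeta>\<in>supp_set. cmod (fst \<zeta>0) \<le> cmod (fst \<zeta>)" by auto
    thus ?thesis using supp_set(2) by (intro exI[of _ "cmod (fst \<zeta>0)"]) auto
  qed (auto intro: exI[of _ 1])
  then obtain r0 where r0: "r0 > 0" "\<And>\<zeta>. \<zeta> \<in> supp_set \<Longrightarrow> r0 \<le> cmod (fst \<zeta>)" by blast
  have supp: "r0 \<le> cmod w \<and> cmod w \<le> b \<and> \<bar>s\<bar> \<le> b" if "g (w, s) \<noteq> 0" for w s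
  proof -
    let ?z = "(w, Complex s (cmod w powr \<gamma>))"
    have "?z \<in> Mgam \<gamma>" by (simp add: Mgam_def)
    hence z: "?z \<in> supp_set" using supp_set(3) that by (auto simp: g_def)
    have "cmod w \<le> norm ?z" using norm_fst_le[of w "Complex s (cmod w powr \<gamma>)"] by simp
    moreover have "\<bar>s\<bar> \<le> norm ?z" using norm_snd_le[of "Complex s (cmod w powr \<gamma>)" w] abs_Re_le_cmod[of "Complex s (cmod w powr \<gamma>)"] by simp
    ultimately show ?thesis using r0(2)[OF z] b(1)[OF z] by auto
  qed
  define G where "G j = (deriv_s ^^ j) g" for j
  have GCk: "Ck_on k ?S (G j)" for k j
    unfolding G_def by (induction j arbitrary: k) (auto intro: Ck deriv_s_Ck)
  have GD: "((\<lambda>s. G j (w, s)) has_vector_derivative G (Suc j) (w, s)) (at s)" if "w \<noteq> 0" for j w s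
    using deriv_s_deriv[OF GCk, of w s j] that by (simp add: G_def)
  have Gcont: "continuous_on ?S (G j)" for j using GCk[of 0 j] by simp
  have Gc: "continuous_on UNIV (\<lambda>s. G j (w, s))" if "w \<noteq> 0" for j w
    using that by (intro continuous_on_compose2[OF Gcont]) (auto intro!: continuous_intros)
  have Gz: "\<And>s. \<bar>s\<bar> > b \<Longrightarrow> G j (w, s) = 0" if "w \<noteq> 0" for j w
  proof (induction j)
    case 0 thus ?case using supp[of w] by (force simp: G_def)
  next
    case (Suc j)
    show ?case by (rule fourier_deriv(1)[OF GD[OF that] Gc[OF that] Suc.IH]) (use Suc.prems b(2) in auto)
  qed
  have Gz2: "G j (w, s) = 0" if "w \<noteq> 0" "\<not> (r0 \<le> cmod w \<and> cmod w \<le> b)" for j w s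
  proof (induction j arbitrary: s)
    case 0 show ?case using supp[of w s] that by (auto simp: G_def)
  next
    case (Suc j)
    have "((\<lambda>_. 0) has_vector_derivative G (Suc j) (w, s)) (at s)" using GD[OF that(1), of j s] Suc by simp
    moreover have "((\<lambda>_. 0) has_vector_derivative 0) (at s)" by simp
    ultimately show ?case by (rule vector_derivative_unique_at)
  qed
  have "\<exists>M\<ge>0. \<forall>w s. w \<noteq> 0 \<longrightarrow> cmod (G j (w, s)) \<le> M" for j
  proof -
    let ?A = "{w. r0 \<le> cmod w \<and> cmod w \<le> b} \<times> {-b..b}"
    have "{w. r0 \<le> cmod w \<and> cmod w \<le> b} = cball 0 b - ball 0 r0" by auto
    hence "compact {w::complex. r0 \<le> cmod w \<and> cmod w \<le> b}" by (metis compact_cball compact_diff open_ball)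
    hence "compact ?A" by (intro compact_Times) auto
    moreover have "continuous_on ?A (G j)" by (rule continuous_on_subset[OF Gcont]) (use r0 in auto)
    ultimately have "bounded (G j ` ?A)" by (intro compact_imp_bounded compact_continuous_image)
    then obtain M where M: "M > 0" "\<And>z. z \<in> ?A \<Longrightarrow> cmod (G j z) \<le> M" unfolding bounded_pos by auto
    have "cmod (G j (w, s)) \<le> M" if "w \<noteq> 0" for w s
    proof (cases "(w, s) \<in> ?A")
      case False
      hence "G j (w, s) = 0" using Gz[OF that, of s j] Gz2[OF that, of j s] by (auto simp: abs_if split: if_splits)
      thus ?thesis using M by simp
    qed (use M in auto)
    thus ?thesis using M by (intro exI[of _ M]) auto
  qed
  then obtain M where M: "\<And>j. M j \<ge> 0" "\<And>j w s. w \<noteq> 0 \<Longrightarrow> cmod (G j (w, s)) \<le> M j" by metis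
  define B where "B = M 0 + 2 * b * M 0 + 2 * b * M 3"
  define F where "F r \<theta> s = (if r > 0 then g (of_real r * cis \<theta>, s) else 0)" for r \<theta> s
  have nz: "of_real r * cis \<theta> \<noteq> 0" if "r > 0" for r \<theta> using that by (simp add: cis_neq_zero)
  have "leray_data \<gamma> F r0 b b B"
  proof
    show "1 < \<gamma>" "0 < r0" by fact+
    show "cmod (F r \<theta> s) \<le> B" for r \<theta> s
    proof -
      have "0 \<le> 2 * b * M 0" "0 \<le> 2 * b * M 3" using M(1)[of 0] M(1)[of 3] b(2) by auto
      thus ?thesis using M(2)[where j=0 and s=s, OF nz[of r \<theta>]] M(1)[of 0] by (auto simp: F_def B_def G_def)
    qed
    show "r0 \<le> r \<and> r \<le> b \<and> - b \<le> s \<and> s \<le> b" if "F r \<theta> s \<noteq> 0" for r \<theta> s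
      using that supp[of "of_real r * cis \<theta>" s] by (auto simp: F_def norm_mult split: if_splits)
    show "continuous_on UNIV (F r \<theta>)" for r \<theta>
      using Gc[OF nz[of r \<theta>], of 0] by (cases "r > 0") (auto simp: F_def[abs_def] G_def)
    show "(\<lambda>(r, \<theta>, s). F r \<theta> s) \<in> borel_measurable (borel \<Otimes>\<^sub>M (borel \<Otimes>\<^sub>M borel))"
    proof -
      have gm: "(\<lambda>p. indicator ?S p *\<^sub>R g p) \<in> borel_measurable borel"
      proof (rule borel_measurable_continuous_on_indicator)
        show "?S \<in> sets borel"
        proof (rule borel_open)
          have "?S = {p. fst p \<noteq> 0}" by auto
          thus "open ?S" by (simp add: open_Collect_neq continuous_intros)
        qed
        show "continuous_on ?S g" using Gcont[of 0] by (simp add: G_def)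
      qed
      have "(\<lambda>(r, \<theta>, s). (of_real r * cis \<theta>, s) :: complex \<times> real) \<in> (borel \<Otimes>\<^sub>M (borel \<Otimes>\<^sub>M borel)) \<rightarrow>\<^sub>M (borel \<Otimes>\<^sub>M borel)" by measurable
      hence m: "(\<lambda>(r, \<theta>, s). (of_real r * cis \<theta>, s) :: complex \<times> real) \<in> (borel \<Otimes>\<^sub>M (borel \<Otimes>\<^sub>M borel)) \<rightarrow>\<^sub>M borel" unfolding borel_prod .
      have "(\<lambda>p. indicator {0<..} (fst p) *\<^sub>R (\<lambda>p. indicator ?S p *\<^sub>R g p) ((\<lambda>(r, \<theta>, s). (of_real r * cis \<theta>, s)) p)) \<in> borel_measurable (borel \<Otimes>\<^sub>M (borel \<Otimes>\<^sub>M borel))"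
        using measurable_compose[OF m gm] by measurable
      also have "(\<lambda>p. indicator {0<..} (fst p) *\<^sub>R (\<lambda>p. indicator ?S p *\<^sub>R g p) ((\<lambda>(r, \<theta>, s). (of_real r * cis \<theta>, s)) p)) = (\<lambda>(r, \<theta>, s). F r \<theta> s)"
        by (auto simp: fun_eq_iff F_def indicator_def cis_neq_zero)
      finally show ?thesis .
    qed
    show "cmod (fourier (F r \<theta>) x) * (1 + \<bar>x\<bar> ^ 3) \<le> B" for r \<theta> x
    proof (cases "r > 0")
      case True
      let ?w = "of_real r * cis \<theta>"
      let ?u = "\<lambda>j s. G j (?w, s)"
      have u: "F r \<theta> = ?u 0" using True by (auto simp: F_def G_def)
      have st: "fourier (?u (Suc j)) x = \<i> * of_real x * fourier (?u j) x" for j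
        by (rule fourier_deriv(2)[OF GD[OF nz[OF True]] Gc[OF nz[OF True]] Gz[OF nz[OF True]]]) (use b in auto)
      have "fourier (?u 3) x = (\<i> * of_real x) ^ 3 * fourier (?u 0) x"
        using st[of 0] st[of 1] st[of 2] by (simp add: numeral_2_eq_2 numeral_3_eq_3 power_Suc mult_ac)
      hence e: "cmod (fourier (?u 3) x) = \<bar>x\<bar> ^ 3 * cmod (fourier (?u 0) x)" by (simp add: norm_mult norm_power)
      have fb: "cmod (fourier (?u j) x) \<le> 2 * b * M j" for j
        by (rule fourier_bound_support[OF M(2)[OF nz[OF True]] Gz[OF nz[OF True]]]) (use b in auto)
      have "cmod (fourier (F r \<theta>) x) * (1 + \<bar>x\<bar> ^ 3) = cmod (fourier (?u 0) x) + cmod (fourier (?u 3) x)"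
        unfolding u e by (simp add: algebra_simps)
      also have "\<dots> \<le> 2 * b * M 0 + 2 * b * M 3" by (intro add_mono fb)
      finally show ?thesis using M(1)[of 0] by (simp add: B_def)
    next
      case False
      hence "F r \<theta> = (\<lambda>_. 0)" by (auto simp: F_def)
      thus ?thesis using M(1)[of 0] M(1)[of 3] b(2) by (simp add: fourier_def B_def)
    qed
  qed
  moreover have "F r \<theta> s = f (par \<gamma> (r, \<theta>, s))" if "r > 0" for r \<theta> s
    using that by (simp add: F_def g_def par_def norm_mult)
  ultimately show ?thesis by blast
qed

context leray_data begin

lemma measurable_bd [measurable (raw)]:
  assumes [measurable]: "a \<in> borel_measurable M" "b \<in> borel_measurable M" "c \<in> borel_measurable M"
  shows "(\<lambda>x. bd (a x) (b x) (c x)) \<in> borel_measurable M"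
proof -
  interpret H: sigma_finite_measure half by simp
  show ?thesis unfolding bd_def by measurable
qed

lemma nn_integral_leray_bd:
  assumes f: "\<And>r \<theta> s. r > 0 \<Longrightarrow> F r \<theta> s = f (par \<gamma> (r, \<theta>, s))"
  shows "(\<integral>\<^sup>+ \<zeta>. ennreal ((cmod (leray_bd \<gamma> f \<zeta>))\<^sup>2) \<partial>mu \<gamma> d) =
    polar_normsq d bd"
proof (rule nn_integral_mu)
  show "(\<lambda>(r, \<theta>, s). bd r \<theta> s) \<in> borel_measurable (borel \<Otimes>\<^sub>M (borel \<Otimes>\<^sub>M borel))" by measurable
  show "leray_bd \<gamma> f (par \<gamma> (r, \<theta>, s)) = bd r \<theta> s" if "0 < r" for r \<theta> s
    by (rule leray_bd_eq) (use f that in auto)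
qed

lemma nn_integral_test:
  assumes f: "\<And>r \<theta> s. r > 0 \<Longrightarrow> F r \<theta> s = f (par \<gamma> (r, \<theta>, s))"
  shows "(\<integral>\<^sup>+ \<zeta>. ennreal ((cmod (f \<zeta>))\<^sup>2) \<partial>mu \<gamma> d) =
    polar_normsq d F"
  by (rule nn_integral_mu[OF meas]) (use f in auto)

end

text \<open>The estimate in polar coordinates transfers to every test function, whose data satisfy the
  hypotheses of the locale.\<close>
lemma opnorm_upper:
  assumes \<gamma>: "\<gamma> > 1" and d: "-1 < d" "d < 2 * \<gamma> - 1" and C: "C > 0" "\<And>k. mode_normsq \<gamma> d k \<le> C"
  shows "leray_opnorm \<gamma> (mu \<gamma> d) \<le> ennreal (sqrt C)"
  unfolding leray_opnorm_def
proof (rule SUP_least)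
  fix f assume "f \<in> {f. test_fun \<gamma> f \<and> (\<exists>\<zeta>\<in>Mgam \<gamma>. f \<zeta> \<noteq> 0)}"
  hence "test_fun \<gamma> f" by simp
  from test_fun_leray_data[OF \<gamma> this] obtain F r0 R S B where
    L: "leray_data \<gamma> F r0 R S B" and f: "\<And>r \<theta> s. r > 0 \<Longrightarrow> F r \<theta> s = f (par \<gamma> (r, \<theta>, s))" by blast
  interpret leray_data \<gamma> F r0 R S B by (rule L)
  have "(\<integral>\<^sup>+ \<zeta>. ennreal ((cmod (leray_bd \<gamma> f \<zeta>))\<^sup>2) \<partial>mu \<gamma> d) \<le> ennreal C * (\<integral>\<^sup>+ \<zeta>. ennreal ((cmod (f \<zeta>))\<^sup>2) \<partial>mu \<gamma> d)"
  proof -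
    have 1: "(\<integral>\<^sup>+ \<zeta>. ennreal ((cmod (leray_bd \<gamma> f \<zeta>))\<^sup>2) \<partial>mu \<gamma> d) =
      polar_normsq d bd"
      using f by (rule nn_integral_leray_bd)
    have 2: "(\<integral>\<^sup>+ \<zeta>. ennreal ((cmod (f \<zeta>))\<^sup>2) \<partial>mu \<gamma> d) =
      polar_normsq d F"
      using f by (rule nn_integral_test)
    show ?thesis unfolding 1 2 by (rule normsq_upper[OF d C(2)])
  qed
  hence "L2norm (mu \<gamma> d) (leray_bd \<gamma> f) \<le> ennreal (sqrt C) * L2norm (mu \<gamma> d) f"
    unfolding L2norm_esqrt esqrt_mult[OF C(1), symmetric] by (rule esqrt_mono)
  thus "L2norm (mu \<gamma> d) (leray_bd \<gamma> f) / L2norm (mu \<gamma> d) f \<le> ennreal (sqrt C)" by (rule ennreal_divide_le)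
qed

section \<open>The lower bound\<close>
lemma ennreal_le_of_divide:
  fixes x y c :: ennreal
  assumes "x / y \<le> c" "y \<noteq> top" "c \<noteq> top" shows "x \<le> c * y"
proof (cases "y = 0")
  case True
  have "x = 0"
  proof (rule ccontr)
    assume "x \<noteq> 0"
    hence "x / y = top" using True by (simp add: divide_ennreal_def ennreal_mult_top)
    thus False using assms by (simp add: top_unique)
  qed
  thus ?thesis by simp
next
  case False
  hence "y / y = 1" using assms(2) by (cases y) (auto simp: divide_ennreal)
  hence "x = x / y * y" by (simp add: ennreal_divide_times)
  also have "\<dots> \<le> c * y" using assms(1) by (rule mult_right_mono) simp
  finally show ?thesis .
qed

lemma esqrt_square: "esqrt I * esqrt I = I"
  by (cases I) (auto simp: esqrt_ennreal ennreal_mult[symmetric] esqrt_def ennreal_top_mult)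

lemma liminf_le_bound:
  fixes X :: "nat \<Rightarrow> ennreal"
  assumes "\<And>n. X n \<le> c" shows "liminf X \<le> c"
  using Liminf_mono[of X "\<lambda>_. c" sequentially] assms by (simp add: Liminf_const)

context leray_data begin

lemma F_hat_separated:
  assumes F: "\<And>\<theta> s. F r \<theta> s = of_real (b r) * cis (real k * \<theta>) * A s"
  shows "F_hat r \<theta> x = of_real (b r) * cis (real k * \<theta>) * fourier A x"
  unfolding F_hat_def fourier_def F mult.assoc by simp

lemma F_mode_separated:
  assumes F: "\<And>\<theta> s. F r \<theta> s = of_real (b r) * cis (real k * \<theta>) * A s"
  shows "F_mode k r x = of_real (2 * pi) * fourier A x * of_real (b r)"
proof -
  have "F_hat r \<theta> x * cis (- (real k * \<theta>)) = of_real (b r) * fourier A x" for \<theta>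
    unfolding F_hat_separated[of r b k A, OF F] by (simp add: mult_ac cis_mult)
  thus ?thesis unfolding F_mode_def by (simp add: measure_circ scaleR_conv_of_real)
qed

text \<open>
  The functional in the rank one operator, for data with radial part \<open>b\<close>.\<close>
definition box_pairing :: "(real \<Rightarrow> real) \<Rightarrow> nat \<Rightarrow> real \<Rightarrow> real" where
  "box_pairing b k x = (\<integral>r. r powr (\<gamma> - 1) * (r powr (\<gamma> - 1)) ^ k * exp (- (x * ((\<gamma> - 1) * r powr \<gamma>))) * b r \<partial>ival r0 R)"

lemma taylor_coeff_separated:
  assumes F: "\<And>r \<theta> s. r > 0 \<Longrightarrow> F r \<theta> s = of_real (b r) * cis (real k * \<theta>) * A s"
    and [measurable]: "b \<in> borel_measurable borel" "A \<in> borel_measurable borel"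
  shows "taylor_coeff k x = of_real ((x * \<gamma>) ^ k / fact k) * (of_real (2 * pi) * fourier A x * of_real (box_pairing b k x))"
proof -
  let ?h = "\<lambda>r. r powr (\<gamma> - 1) * (r powr (\<gamma> - 1)) ^ k * exp (- (x * ((\<gamma> - 1) * r powr \<gamma>)))"
  have "(\<integral>r. of_real (?h r) * F_mode k r x \<partial>ival r0 R) = (\<integral>r. (of_real (2 * pi) * fourier A x) * complex_of_real (?h r * b r) \<partial>ival r0 R)"
  proof (rule integral_cong_AE)
    show "AE r in ival r0 R. of_real (?h r) * F_mode k r x = (of_real (2 * pi) * fourier A x) * complex_of_real (?h r * b r)"
      using AE_ival
    proof eventually_elim
      fix r assume "r0 \<le> r \<and> r \<le> R"
      hence "r > 0" using r0 by simp
      from F_mode_separated[of r b k A x, OF F[OF this]] show "of_real (?h r) * F_mode k r x = (of_real (2 * pi) * fourier A x) * complex_of_real (?h r * b r)"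
        by (simp add: mult_ac)
    qed
  qed measurable
  also have "\<dots> = of_real (2 * pi) * fourier A x * of_real (box_pairing b k x)"
    unfolding box_pairing_def integral_mult_right_zero integral_complex_of_real ..
  finally show ?thesis unfolding taylor_coeff_def by simp
qed

text \<open>
  For data \<open>b(r) e\<^bsup>ik\<theta>\<^esup> A(s)\<close> the spectral density of the output is this function of \<open>x\<close> times the square of
  the Fourier transform of \<open>A\<close>.\<close>
definition box_peak :: "(real \<Rightarrow> real) \<Rightarrow> real \<Rightarrow> nat \<Rightarrow> real \<Rightarrow> real" where
  "box_peak b d k x = \<gamma> ^ 3 * (x\<^sup>2 * ((x * \<gamma>) ^ k / fact k)\<^sup>2 * ((2 * x) powr (- alpha d k) * Gamma (alpha d k))) * (box_pairing b k x)\<^sup>2"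

text \<open>Only the mode \<open>k\<close> of the energy identity is kept. Since the other modes of such data vanish, nothing
  is lost.\<close>
lemma normsq_lower:
  assumes F: "\<And>r \<theta> s. r > 0 \<Longrightarrow> F r \<theta> s = of_real (b r) * cis (real k * \<theta>) * A s"
    and [measurable]: "b \<in> borel_measurable borel" "A \<in> borel_measurable borel" and d: "d > -1"
  shows "(\<integral>\<^sup>+x. ennreal (box_peak b d k x * (cmod (fourier A x))\<^sup>2) \<partial>half) \<le>
    polar_normsq d bd"
  unfolding normsq_bd[OF d]
proof (rule nn_integral_mono)
  fix x
  let ?t = "\<lambda>j. ennreal (mode_energy d j x)"
  have "(cmod (taylor_coeff k x))\<^sup>2 = ((x * \<gamma>) ^ k / fact k)\<^sup>2 * (4 * pi\<^sup>2 * (cmod (fourier A x))\<^sup>2 * (box_pairing b k x)\<^sup>2)"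
  proof -
    have bb: "taylor_coeff k x = of_real ((x * \<gamma>) ^ k / fact k) * (of_real (2 * pi) * fourier A x * of_real (box_pairing b k x))"
      using F assms(2,3) by (rule taylor_coeff_separated)
    have "(cmod (taylor_coeff k x))\<^sup>2 = ((x * \<gamma>) ^ k / fact k)\<^sup>2 * ((2 * pi)\<^sup>2 * (cmod (fourier A x))\<^sup>2 * (box_pairing b k x)\<^sup>2)"
      unfolding bb norm_mult norm_of_real power_mult_distrib[of "\<bar>_\<bar>"] power_mult_distrib[of "_ * _" "\<bar>_\<bar>"] power_mult_distrib[of "\<bar>2 * pi\<bar>"] power2_abs ..
    thus ?thesis by (simp add: power_mult_distrib)
  qed
  hence "box_peak b d k x * (cmod (fourier A x))\<^sup>2 = mode_energy d k x"
    unfolding box_peak_def by (simp add: mult_ac)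
  hence "ennreal (box_peak b d k x * (cmod (fourier A x))\<^sup>2) = (\<Sum>j\<in>{k}. ?t j)" by simp
  also have "\<dots> \<le> (\<Sum>j. ?t j)" by (rule sum_le_suminf) auto
  finally show "ennreal (box_peak b d k x * (cmod (fourier A x))\<^sup>2) \<le> (\<Sum>j. ?t j)" .
qed

lemma box_pairing_tendsto:
  assumes b: "\<And>r. 0 < r \<Longrightarrow> \<bar>b r\<bar> \<le> M" and [measurable]: "b \<in> borel_measurable borel"
    and X: "X \<longlonglongrightarrow> 1" "\<And>n. X n \<ge> 0"
  shows "(\<lambda>n. box_pairing b k (X n)) \<longlonglongrightarrow> box_pairing b k 1"
  unfolding box_pairing_def
proof (rule integral_dominated_convergence[where w="\<lambda>_. R powr (\<gamma> - 1) * (R powr (\<gamma> - 1)) ^ k * M"])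
  show "integrable (ival r0 R) (\<lambda>_. R powr (\<gamma> - 1) * (R powr (\<gamma> - 1)) ^ k * M)"
    by (simp add: finite_measure.integrable_const)
  show "AE r in ival r0 R. (\<lambda>n. r powr (\<gamma> - 1) * (r powr (\<gamma> - 1)) ^ k * exp (- (X n * ((\<gamma> - 1) * r powr \<gamma>))) * b r) \<longlonglongrightarrow> r powr (\<gamma> - 1) * (r powr (\<gamma> - 1)) ^ k * exp (- (1 * ((\<gamma> - 1) * r powr \<gamma>))) * b r"
    by (intro AE_I2 tendsto_intros X)
  show "AE r in ival r0 R. norm (r powr (\<gamma> - 1) * (r powr (\<gamma> - 1)) ^ k * exp (- (X n * ((\<gamma> - 1) * r powr \<gamma>))) * b r) \<le> R powr (\<gamma> - 1) * (R powr (\<gamma> - 1)) ^ k * M" for n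
    using AE_ival
  proof eventually_elim
    fix r assume r: "r0 \<le> r \<and> r \<le> R"
    hence r1: "r > 0" using r0 by simp
    have p: "r powr (\<gamma> - 1) \<le> R powr (\<gamma> - 1)" using r r1 \<gamma> by (intro powr_mono2) auto
    have e: "exp (- (X n * ((\<gamma> - 1) * r powr \<gamma>))) \<le> 1" using X(2)[of n] \<gamma> by simp
    have "norm (r powr (\<gamma> - 1) * (r powr (\<gamma> - 1)) ^ k * exp (- (X n * ((\<gamma> - 1) * r powr \<gamma>))) * b r) = r powr (\<gamma> - 1) * (r powr (\<gamma> - 1)) ^ k * exp (- (X n * ((\<gamma> - 1) * r powr \<gamma>))) * \<bar>b r\<bar>"
      by (simp add: abs_mult)
    also have "\<dots> \<le> R powr (\<gamma> - 1) * (R powr (\<gamma> - 1)) ^ k * 1 * M"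
      using p e b[OF r1] by (intro mult_mono power_mono) auto
    finally show "norm (r powr (\<gamma> - 1) * (r powr (\<gamma> - 1)) ^ k * exp (- (X n * ((\<gamma> - 1) * r powr \<gamma>))) * b r) \<le> R powr (\<gamma> - 1) * (R powr (\<gamma> - 1)) ^ k * M" by simp
  qed
qed measurable

lemma box_pairing_eq_nn_integral:
  assumes b: "\<And>r. 0 < r \<Longrightarrow> 0 \<le> b r \<and> b r \<le> M" and [measurable]: "b \<in> borel_measurable borel"
    and s: "\<And>r. 0 < r \<Longrightarrow> b r \<noteq> 0 \<Longrightarrow> r0 \<le> r \<and> r \<le> R" and x: "x \<ge> 0"
  shows "ennreal (box_pairing b k x) = (\<integral>\<^sup>+r. ennreal (r powr (\<gamma> - 1) * (r powr (\<gamma> - 1)) ^ k * exp (- (x * ((\<gamma> - 1) * r powr \<gamma>))) * b r) \<partial>half)"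
    and "box_pairing b k x \<ge> 0"
proof -
  let ?h = "\<lambda>r. r powr (\<gamma> - 1) * (r powr (\<gamma> - 1)) ^ k * exp (- (x * ((\<gamma> - 1) * r powr \<gamma>))) * b r"
  have nn: "AE r in ival r0 R. 0 \<le> ?h r" using AE_ival by eventually_elim (use b r0 in auto)
  have M0: "M \<ge> 0" using b[of 1] by simp
  have i: "integrable (ival r0 R) ?h"
  proof (rule finite_measure.integrable_const_bound[OF finite_ival, of _ "R powr (\<gamma> - 1) * (R powr (\<gamma> - 1)) ^ k * 1 * M"])
    show "AE r in ival r0 R. norm (?h r) \<le> R powr (\<gamma> - 1) * (R powr (\<gamma> - 1)) ^ k * 1 * M"
      using AE_ival
    proof eventually_elim
      fix r assume r: "r0 \<le> r \<and> r \<le> R"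
      hence r1: "r > 0" using r0 by simp
      have p: "r powr (\<gamma> - 1) \<le> R powr (\<gamma> - 1)" using r r1 \<gamma> by (intro powr_mono2) auto
      have e: "exp (- (x * ((\<gamma> - 1) * r powr \<gamma>))) \<le> 1" using x \<gamma> by simp
      have "norm (?h r) = ?h r" using b[OF r1] by simp
      also have "\<dots> \<le> R powr (\<gamma> - 1) * (R powr (\<gamma> - 1)) ^ k * 1 * M"
        using p e b[OF r1] by (intro mult_mono power_mono) auto
      finally show "norm (?h r) \<le> R powr (\<gamma> - 1) * (R powr (\<gamma> - 1)) ^ k * 1 * M" .
    qed
  qed measurable
  show "box_pairing b k x \<ge> 0" unfolding box_pairing_def using nn by (rule integral_nonneg_AE)
  have "ennreal (box_pairing b k x) = (\<integral>\<^sup>+r. ennreal (?h r) \<partial>ival r0 R)"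
    unfolding box_pairing_def by (rule nn_integral_eq_integral[OF i nn, symmetric])
  also have "\<dots> = (\<integral>\<^sup>+r. indicator {r0..R} r * ennreal (?h r) \<partial>lborel)"
    unfolding ival_def by (rule nn_integral_density) auto
  also have "\<dots> = (\<integral>\<^sup>+r. ennreal (?h r) * indicator {0<..} r \<partial>lborel)"
  proof (rule nn_integral_cong)
    fix r
    show "indicator {r0..R} r * ennreal (?h r) = ennreal (?h r) * indicator {0<..} r"
      using r0 s[of r] by (cases "b r = 0") (auto simp: indicator_def)
  qed
  also have "\<dots> = (\<integral>\<^sup>+r. ennreal (?h r) \<partial>half)" by (rule nn_integral_half[symmetric]) measurable
  finally show "ennreal (box_pairing b k x) = (\<integral>\<^sup>+r. ennreal (?h r) \<partial>half)" .
qed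

end

subsection \<open>Wave packets\<close>

definition bump :: "real \<Rightarrow> complex" where "bump s = of_real (flat (1 - s\<^sup>2))"
text \<open>
  A packet oscillating at frequency 1 with envelope of length \<open>N + 1\<close>, so with spectrum of
  width about \<open>1 / (N + 1)\<close> around 1.\<close>
definition packet :: "nat \<Rightarrow> real \<Rightarrow> complex" where "packet N s = cis s * bump (s / real (Suc N))"
text \<open>
  Smooth cut-offs to compact subsets of the half line converging to 1. They are applied to
  \<open>q = |w|\<^sup>2\<close>, which is smooth in \<open>w\<close>; the factor in front of the last bracket makes its argument
  tend to infinity with \<open>n\<close>.\<close>
definition cut :: "nat \<Rightarrow> real \<Rightarrow> real" where "cut n q = flat (real (n + 2) * q - 1) * flat (real (n + 2) * (real (n + 2) - q))"

lemma flat_bounds: "0 \<le> flat u" "flat u \<le> 1" by (auto simp: flat_def)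
lemma flat_pos: "u > 0 \<Longrightarrow> flat u > 0" by (simp add: flat_def)
lemma flat_zero: "u \<le> 0 \<Longrightarrow> flat u = 0" by (simp add: flat_def)

lemma Ck_on_flat_real: "Ck_on k UNIV flat"
  using Ck_on_flat[of UNIV k "\<lambda>x. x"] Ck_on_linear[of "\<lambda>x::real. x" UNIV k] by (simp add: bounded_linear_ident)

lemma continuous_flat: "continuous_on UNIV flat" using Ck_on_flat_real[of 0] by simp

lemma measurable_flat [measurable]: "flat \<in> borel_measurable borel"
  by (rule borel_measurable_continuous_onI[OF continuous_flat])

lemma flat_tendsto: "filterlim g at_top F \<Longrightarrow> ((\<lambda>n. flat (g n)) \<longlongrightarrow> 1) F"
proof -
  assume g: "filterlim g at_top F"
  have "((\<lambda>y::real. exp (- (1 / y))) \<longlongrightarrow> 1) at_top" by real_asymp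
  hence "(flat \<longlongrightarrow> 1) at_top"
    by (rule Lim_transform_eventually) (use eventually_gt_at_top[of 0] in eventually_elim, simp add: flat_def)
  thus ?thesis by (rule filterlim_compose[OF _ g])
qed

lemma cut_tendsto: assumes "q > 0" shows "(\<lambda>n. cut n q) \<longlonglongrightarrow> 1"
proof -
  have 1: "filterlim (\<lambda>n. real (n + 2) * q - 1) at_top sequentially" using assms by real_asymp
  have 2: "filterlim (\<lambda>n. real (n + 2) * (real (n + 2) - q)) at_top sequentially" using assms by real_asymp
  show ?thesis unfolding cut_def
    using tendsto_mult[OF flat_tendsto[OF 1] flat_tendsto[OF 2]] by simp
qed

lemma cut_bounds: "0 \<le> cut n q" "cut n q \<le> 1"
  unfolding cut_def by (auto simp: flat_bounds intro!: mult_le_one)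

lemma cut_support: assumes "cut n q \<noteq> 0" shows "1 / real (n + 2) \<le> q \<and> q \<le> real (n + 2)"
proof -
  have n: "0 < real (n + 2)" by simp
  have "real (n + 2) * q - 1 > 0"
    using assms flat_zero[of "real (n + 2) * q - 1"] unfolding cut_def by (cases "real (n + 2) * q - 1 \<le> 0") auto
  hence 1: "1 / real (n + 2) \<le> q" using n by (simp add: divide_le_eq mult.commute)
  have "real (n + 2) * (real (n + 2) - q) > 0"
    using assms flat_zero[of "real (n + 2) * (real (n + 2) - q)"] unfolding cut_def by (cases "real (n + 2) * (real (n + 2) - q) \<le> 0") auto
  from zero_less_mult_pos[OF this n] 1 show ?thesis by simp
qed

text \<open>
  Without the cut-off this is the equality case of the Cauchy-Schwarz inequality at \<open>x = 1\<close>: the fixed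
  function in the radial integral divided by the weight \<open>r\<^sup>d\<close>.\<close>
definition profile :: "real \<Rightarrow> real \<Rightarrow> nat \<Rightarrow> nat \<Rightarrow> real \<Rightarrow> real" where
  "profile \<gamma> d k n r = r powr ((\<gamma> - 1) * (real k + 1) - d) * exp (- ((\<gamma> - 1) * r powr \<gamma>)) * cut n (r\<^sup>2)"

text \<open>
  The angular factor \<open>e\<^bsup>ik\<theta>\<^esup>\<close> is written as \<open>|w|\<^bsup>-k\<^esup> w\<^sup>k\<close>, visibly smooth for \<open>w \<noteq> 0\<close>.\<close>
definition test_mode :: "real \<Rightarrow> real \<Rightarrow> nat \<Rightarrow> nat \<Rightarrow> nat \<Rightarrow> complex \<times> complex \<Rightarrow> complex" where
  "test_mode \<gamma> d k n N \<zeta> = of_real (cmod (fst \<zeta>) powr (- real k) * profile \<gamma> d k n (cmod (fst \<zeta>))) * fst \<zeta> ^ k * packet N (Re (snd \<zeta>))"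

lemma test_mode_par: "r > 0 \<Longrightarrow> test_mode \<gamma> d k n N (par \<gamma> (r, \<theta>, s)) = of_real (profile \<gamma> d k n r) * cis (real k * \<theta>) * packet N s"
proof -
  assume r: "r > 0"
  have c: "cmod (of_real r * cis \<theta>) = r" using r by (simp add: norm_mult)
  have p: "r powr (- real k) * r ^ k = 1" using r by (simp add: powr_minus powr_realpow)
  have "of_real (r powr (- real k) * profile \<gamma> d k n r) * (of_real r * cis \<theta>) ^ k = of_real ((r powr (- real k) * r ^ k) * profile \<gamma> d k n r) * cis (real k * \<theta>)"
    by (simp add: power_mult_distrib Complex.DeMoivre)
  thus ?thesis unfolding test_mode_def par_def prod.case fst_conv snd_conv c p by simp
qed

lemma Ck_on_cut:
  assumes S: "open S" and g: "Ck_on j S g" shows "Ck_on j S (\<lambda>x. cut n (g x))"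
proof -
  have m: "Ck_on j S (\<lambda>x. a * g x)" for a :: real by (rule Ck_on_mult[OF S Ck_on_const g])
  have 1: "Ck_on j S (\<lambda>x. real (n + 2) * g x + (- 1))" by (rule Ck_on_add[OF S m Ck_on_const])
  have "Ck_on j S (\<lambda>x. real (n + 2) + (- 1) * g x)" by (rule Ck_on_add[OF S Ck_on_const m])
  from Ck_on_mult[OF S Ck_on_const this, of "real (n + 2)"]
  have 2: "Ck_on j S (\<lambda>x. real (n + 2) * (real (n + 2) - g x))" by simp
  from Ck_on_mult[OF S Ck_on_flat[OF S 1] Ck_on_flat[OF S 2]] show ?thesis by (simp add: cut_def)
qed

lemma test_mode_smooth: "Ck_on j {(w, s). w \<noteq> 0} (\<lambda>(w :: complex, s :: real). test_mode \<gamma> d k n N (w, Complex s (cmod w powr \<gamma>)))"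
proof -
  let ?S = "{(w, s). w \<noteq> 0} :: (complex \<times> real) set"
  have "?S = {p. fst p \<noteq> 0}" by auto
  hence S: "open ?S" by (simp add: open_Collect_neq continuous_intros)
  let ?q = "\<lambda>p :: complex \<times> real. fst p \<bullet> fst p"
  have w: "Ck_on j ?S fst" and s: "Ck_on j ?S snd" by (auto intro!: Ck_on_linear S bounded_linear_fst bounded_linear_snd)
  have q: "Ck_on j ?S ?q" by (rule Ck_on_bilinear[OF bounded_bilinear_inner S w w])
  have qp: "?q p > 0" if "p \<in> ?S" for p using that by auto
  have pw: "Ck_on j ?S (\<lambda>p. ?q p powr a)" for a by (rule Ck_on_powr[OF S q qp])
  let ?e = "(\<gamma> - 1) * (real k + 1) - d"
  let ?N = "real (Suc N)"
  have ex: "Ck_on j ?S (\<lambda>p. exp ((- (\<gamma> - 1)) * ?q p powr (\<gamma> / 2)))" by (rule Ck_on_exp[OF S Ck_on_mult[OF S Ck_on_const pw]])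
  have rad: "Ck_on j ?S (\<lambda>p. ?q p powr (- real k / 2) * (?q p powr (?e / 2) * exp ((- (\<gamma> - 1)) * ?q p powr (\<gamma> / 2)) * cut n (?q p)))"
    by (rule Ck_on_mult[OF S pw Ck_on_mult[OF S Ck_on_mult[OF S pw ex] Ck_on_cut[OF S q]]])
  have s1: "Ck_on j ?S (\<lambda>p. 1 + (- (1 / ?N\<^sup>2)) * (snd p * snd p))"
    by (rule Ck_on_add[OF S Ck_on_const Ck_on_mult[OF S Ck_on_const Ck_on_mult[OF S s s]]])
  have bump: "Ck_on j ?S (\<lambda>p. flat (1 + (- (1 / ?N\<^sup>2)) * (snd p * snd p)) *\<^sub>R cis (snd p))"
    by (rule Ck_on_scaleR[OF S Ck_on_flat[OF S s1] Ck_on_cis[OF S s]])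
  have "Ck_on j ?S (\<lambda>p. (?q p powr (- real k / 2) * (?q p powr (?e / 2) * exp ((- (\<gamma> - 1)) * ?q p powr (\<gamma> / 2)) * cut n (?q p))) *\<^sub>R
     (fst p ^ k * (flat (1 + (- (1 / ?N\<^sup>2)) * (snd p * snd p)) *\<^sub>R cis (snd p))))" (is "Ck_on j ?S ?g")
    by (rule Ck_on_scaleR[OF S rad Ck_on_mult[OF S Ck_on_power[OF S w] bump]])
  also have "?this \<longleftrightarrow> ?thesis"
  proof (rule Ck_on_cong[OF S])
    fix p assume "p \<in> ?S"
    then obtain w s where p: "p = (w, s)" and w: "w \<noteq> 0" by auto
    have q2: "w \<bullet> w = cmod w powr 2" using w by (simp add: power2_norm_eq_inner[symmetric])
    have qa: "(w \<bullet> w) powr (a / 2) = cmod w powr a" for a unfolding q2 powr_powr by simp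
    have q3: "w \<bullet> w = (cmod w)\<^sup>2" by (simp add: power2_norm_eq_inner)
    have f: "1 + (- (1 / ?N\<^sup>2)) * (s * s) = 1 - (s / ?N)\<^sup>2" by (simp add: power_divide power2_eq_square)
    show "?g p = (case p of (w, s) \<Rightarrow> test_mode \<gamma> d k n N (w, Complex s (cmod w powr \<gamma>)))"
      unfolding p prod.case fst_conv snd_conv qa f mult_minus_left[of "\<gamma> - 1"] test_mode_def profile_def packet_def bump_def
      unfolding q3 by (simp add: scaleR_conv_of_real mult_ac complex.sel)
  qed
  finally show ?thesis .
qed

lemma bump_zero: "\<bar>s\<bar> \<ge> 1 \<Longrightarrow> bump s = 0"
  unfolding bump_def using flat_zero[of "1 - s\<^sup>2"] abs_le_square_iff[of 1 s] by simp

lemma test_mode_support: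
  assumes "\<zeta> \<in> Mgam \<gamma>" "test_mode \<gamma> d k n N \<zeta> \<noteq> 0"
  shows "1 / real (n + 2) \<le> cmod (fst \<zeta>)" "cmod (fst \<zeta>) \<le> real (n + 2)" "\<bar>Re (snd \<zeta>)\<bar> \<le> real (Suc N)"
proof -
  let ?r = "cmod (fst \<zeta>)"
  have c: "cut n (?r\<^sup>2) \<noteq> 0" and x: "bump (Re (snd \<zeta>) / real (Suc N)) \<noteq> 0"
    using assms(2) by (auto simp: test_mode_def profile_def packet_def simp del: of_nat_Suc)
  from cut_support[OF c] have 1: "1 / real (n + 2) \<le> ?r\<^sup>2" "?r\<^sup>2 \<le> real (n + 2)" by auto
  show "1 / real (n + 2) \<le> ?r"
  proof (rule power2_le_imp_le)
    have "(1 / real (n + 2))\<^sup>2 \<le> 1 / real (n + 2)" by (simp add: power2_eq_square divide_le_eq)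
    thus "(1 / real (n + 2))\<^sup>2 \<le> ?r\<^sup>2" using 1 by linarith
  qed simp
  show "?r \<le> real (n + 2)"
  proof (rule power2_le_imp_le)
    have "real (n + 2) \<le> (real (n + 2))\<^sup>2" by (simp add: power2_eq_square)
    thus "?r\<^sup>2 \<le> (real (n + 2))\<^sup>2" using 1 by linarith
  qed simp
  have "\<bar>Re (snd \<zeta>) / real (Suc N)\<bar> < 1" using x bump_zero by (meson not_less)
  thus "\<bar>Re (snd \<zeta>)\<bar> \<le> real (Suc N)" by (simp add: divide_less_eq abs_divide del: of_nat_Suc)
qed

lemma test_mode_test_fun: "test_fun \<gamma> (test_mode \<gamma> d k n N)"
proof -
  let ?A = "{w::complex. 1 / real (n + 2) \<le> cmod w \<and> cmod w \<le> real (n + 2)} \<times> {- real (Suc N)..real (Suc N)}"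
  let ?\<Psi> = "\<lambda>(w, s). (w, Complex s (cmod w powr \<gamma>))"
  let ?K = "?\<Psi> ` ?A"
  have n: "1 / real (n + 2) > 0" by simp
  have "{w::complex. 1 / real (n + 2) \<le> cmod w \<and> cmod w \<le> real (n + 2)} = cball 0 (real (n + 2)) - ball 0 (1 / real (n + 2))" by auto
  hence "compact {w::complex. 1 / real (n + 2) \<le> cmod w \<and> cmod w \<le> real (n + 2)}" by (metis compact_cball compact_diff open_ball)
  hence cA: "compact ?A" by (intro compact_Times) auto
  have "continuous_on ?A (\<lambda>p. (fst p, of_real (snd p) + \<i> * of_real (cmod (fst p) powr \<gamma>)))"
    using n by (intro continuous_intros) (auto simp del: of_nat_add)
  also have "(\<lambda>p. (fst p, of_real (snd p) + \<i> * of_real (cmod (fst p) powr \<gamma>))) = ?\<Psi>" by (auto simp: fun_eq_iff complex_eq_iff)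
  finally have "compact ?K" by (rule compact_continuous_image[OF _ cA])
  moreover have "?K \<subseteq> Mgam \<gamma> \<inter> {\<zeta>. fst \<zeta> \<noteq> 0}" using n by (auto simp: Mgam_def simp del: of_nat_add)
  moreover have "test_mode \<gamma> d k n N \<zeta> = 0" if z: "\<zeta> \<in> Mgam \<gamma> - ?K" for \<zeta>
  proof (rule ccontr)
    assume nz: "test_mode \<gamma> d k n N \<zeta> \<noteq> 0"
    have "\<zeta> = ?\<Psi> (fst \<zeta>, Re (snd \<zeta>))" using z by (auto simp: Mgam_def complex_eq_iff prod_eq_iff)
    moreover have "(fst \<zeta>, Re (snd \<zeta>)) \<in> ?A" using test_mode_support[OF _ nz] z by (auto simp: abs_le_iff simp del: of_nat_add of_nat_Suc)
    ultimately have "\<zeta> \<in> ?K" by blast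
    thus False using z by simp
  qed
  ultimately show ?thesis unfolding test_fun_def using test_mode_smooth by blast
qed

lemma test_mode_nonzero: "\<exists>\<zeta>\<in>Mgam \<gamma>. test_mode \<gamma> d k n N \<zeta> \<noteq> 0"
proof -
  have "cut n 1 > 0" unfolding cut_def by (intro mult_pos_pos flat_pos) (auto simp del: of_nat_add simp: of_nat_add)
  moreover have "bump 0 \<noteq> 0" using flat_pos[of 1] by (simp add: bump_def)
  ultimately have "test_mode \<gamma> d k n N (par \<gamma> (1, 0, 0)) \<noteq> 0" by (subst test_mode_par) (auto simp: profile_def packet_def)
  moreover have "par \<gamma> (1, 0, 0) \<in> Mgam \<gamma>" using par_in_Mgam[of "(1, 0, 0)" \<gamma>] by (simp add: pdom_def)
  ultimately show ?thesis by blast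
qed

definition bump_normsq :: ennreal where "bump_normsq = (\<integral>\<^sup>+s. ennreal ((cmod (bump s))\<^sup>2) \<partial>lborel)"

lemma continuous_bump: "continuous_on UNIV bump"
  unfolding bump_def[abs_def] by (intro continuous_intros continuous_on_compose2[OF continuous_flat]) auto

lemma measurable_bump [measurable]: "bump \<in> borel_measurable borel"
  by (rule borel_measurable_continuous_onI[OF continuous_bump])

lemma measurable_packet [measurable]: "packet N \<in> borel_measurable borel"
  unfolding packet_def[abs_def] by measurable

lemma bump_bound: "cmod (bump s) \<le> 1" using flat_bounds[of "1 - s\<^sup>2"] by (simp add: bump_def)

lemma integrable_bump: "integrable lborel bump"
proof -
  have "integrable lborel (\<lambda>s. indicator {-1..1::real} s :: real)"
    by (intro integrable_real_indicator) (auto simp: emeasure_lborel_Icc_eq)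
  thus ?thesis
  proof (rule Bochner_Integration.integrable_bound)
    show "AE s in lborel. cmod (bump s) \<le> norm (indicator {-1..1} s :: real)"
      using bump_bound bump_zero by (auto simp: indicator_def abs_if split: if_splits)
  qed measurable
qed

lemma bump_normsq_finite: "bump_normsq \<noteq> top"
proof -
  have "bump_normsq \<le> (\<integral>\<^sup>+s. indicator {-1..1::real} s \<partial>lborel)"
    unfolding bump_normsq_def
  proof (rule nn_integral_mono)
    fix s :: real
    have "(cmod (bump s))\<^sup>2 \<le> 1" using bump_bound[of s] by (simp add: power_le_one)
    thus "ennreal ((cmod (bump s))\<^sup>2) \<le> indicator {-1..1} s"
      using bump_zero[of s] by (cases "s \<in> {-1..1}") (auto simp: ennreal_le_1 abs_if split: if_splits)
  qed
  also have "\<dots> < top" by (simp add: emeasure_lborel_Icc_eq)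
  finally show ?thesis by simp
qed

lemma bump_normsq_pos: "bump_normsq \<noteq> 0"
proof
  assume "bump_normsq = 0"
  hence "AE s in lborel. bump s = 0" unfolding bump_normsq_def by (subst (asm) nn_integral_0_iff_AE) auto
  hence "{s. bump s = 0} = UNIV"
  proof -
    assume a: "AE s in lborel. bump s = 0"
    have "open {s. bump s \<noteq> 0}" using continuous_bump by (intro open_Collect_neq continuous_on_const)
    moreover have "emeasure lborel {s. bump s \<noteq> 0} = 0" using a by (subst (asm) AE_iff_measurable[OF _ refl]) auto
    ultimately have "{s. bump s \<noteq> 0} = {}" using open_not_negligible[of "{s. bump s \<noteq> 0}"]
      by (metis borel_open negligible_iff_null_sets null_setsI null_sets_completionI sets_lborel)
    thus ?thesis by auto
  qed
  moreover have "bump 0 \<noteq> 0" using flat_pos[of 1] by (simp add: bump_def)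
  ultimately show False by auto
qed

lemma nn_integral_packet: "(\<integral>\<^sup>+s. ennreal ((cmod (packet N s))\<^sup>2) \<partial>lborel) = ennreal (real (Suc N)) * bump_normsq"
proof -
  have "(\<integral>\<^sup>+s. ennreal ((cmod (packet N s))\<^sup>2) \<partial>lborel) = ennreal \<bar>real (Suc N)\<bar> * (\<integral>\<^sup>+s. ennreal ((cmod (packet N (0 + real (Suc N) * s)))\<^sup>2) \<partial>lborel)"
    by (rule nn_integral_real_affine) auto
  thus ?thesis by (simp add: bump_normsq_def packet_def norm_mult del: of_nat_Suc)
qed

text \<open>The square of this concentrates at frequency 1 with mass of order \<open>N + 1\<close>, the order of the squared norm of the
  packet itself.\<close>
lemma fourier_packet: "fourier (packet N) x = of_real (real (Suc N)) * fourier bump (real (Suc N) * (x - 1))"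
proof -
  let ?N = "real (Suc N)"
  have "fourier (packet N) x = \<bar>?N\<bar> *\<^sub>R (\<integral>s. packet N (0 + ?N * s) * cis (- (x * (0 + ?N * s))) \<partial>lborel)"
    unfolding fourier_def by (rule lborel_integral_real_affine) simp
  also have "(\<lambda>s. packet N (0 + ?N * s) * cis (- (x * (0 + ?N * s)))) = (\<lambda>s. bump s * cis (- (?N * (x - 1) * s)))"
  proof
    fix s
    have "cis (?N * s) * cis (- (x * (?N * s))) = cis (- (?N * (x - 1) * s))" by (simp add: cis_mult algebra_simps)
    thus "packet N (0 + ?N * s) * cis (- (x * (0 + ?N * s))) = bump s * cis (- (?N * (x - 1) * s))"
      by (simp add: packet_def mult_ac del: of_nat_Suc)
  qed
  finally show ?thesis by (simp add: fourier_def scaleR_conv_of_real del: of_nat_Suc)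
qed

lemma plancherel_bump: "(\<integral>\<^sup>+x. ennreal ((cmod (fourier bump x))\<^sup>2) \<partial>lborel) = ennreal (2 * pi) * bump_normsq"
  unfolding bump_normsq_def by (rule plancherel[OF integrable_bump bump_bound continuous_bump])

lemma measurable_profile [measurable]: "profile \<gamma> d k n \<in> borel_measurable borel"
  unfolding profile_def[abs_def] cut_def by measurable

lemma profile_nonneg: "0 \<le> profile \<gamma> d k n r" unfolding profile_def by (simp add: cut_bounds)

text \<open>
  At \<open>x = 1\<close> this one number is both the pairing with the cut-off profile and a bound
  for its squared norm: the profile solves the extremal problem up to the cut-off, and the
  square of the cut-off is at most the cut-off.\<close>
definition cut_mass :: "real \<Rightarrow> real \<Rightarrow> nat \<Rightarrow> nat \<Rightarrow> ennreal" where
  "cut_mass \<gamma> d k n = (\<integral>\<^sup>+r. ennreal (r powr (2 * (\<gamma> - 1) * (real k + 1) - d) * exp (- (2 * (\<gamma> - 1) * r powr \<gamma>)) * cut n (r\<^sup>2)) \<partial>half)"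

lemma profile_square_le:
  "(\<integral>\<^sup>+r. ennreal (r powr d) * ennreal ((profile \<gamma> d k n r)\<^sup>2) \<partial>half) \<le> cut_mass \<gamma> d k n"
  unfolding cut_mass_def
proof (rule nn_integral_mono_AE, use AE_half in eventually_elim)
  fix r :: real assume r: "r > 0"
  let ?a = "(\<gamma> - 1) * (real k + 1)" and ?c = "cut n (r\<^sup>2)"
  have p: "r powr d * (r powr (?a - d) * r powr (?a - d)) = r powr (2 * (\<gamma> - 1) * (real k + 1) - d)"
    unfolding powr_add[symmetric] by (rule arg_cong[where f="\<lambda>x. r powr x"]) (simp add: algebra_simps)
  have e: "exp (- ((\<gamma> - 1) * r powr \<gamma>)) * exp (- ((\<gamma> - 1) * r powr \<gamma>)) = exp (- (2 * (\<gamma> - 1) * r powr \<gamma>))"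
    by (simp add: exp_add[symmetric])
  have "?c * ?c \<le> ?c * 1" by (intro mult_left_mono cut_bounds)
  hence "(r powr (2 * (\<gamma> - 1) * (real k + 1) - d) * exp (- (2 * (\<gamma> - 1) * r powr \<gamma>))) * (?c * ?c) \<le> (r powr (2 * (\<gamma> - 1) * (real k + 1) - d) * exp (- (2 * (\<gamma> - 1) * r powr \<gamma>))) * ?c"
    by (intro mult_left_mono) auto
  moreover have "r powr d * (profile \<gamma> d k n r)\<^sup>2 = (r powr (2 * (\<gamma> - 1) * (real k + 1) - d) * exp (- (2 * (\<gamma> - 1) * r powr \<gamma>))) * (?c * ?c)"
    unfolding p[symmetric] e[symmetric] profile_def power2_eq_square by (simp only: mult_ac)
  ultimately have "r powr d * (profile \<gamma> d k n r)\<^sup>2 \<le> r powr (2 * (\<gamma> - 1) * (real k + 1) - d) * exp (- (2 * (\<gamma> - 1) * r powr \<gamma>)) * ?c" by simp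
  thus "ennreal (r powr d) * ennreal ((profile \<gamma> d k n r)\<^sup>2) \<le> ennreal (r powr (2 * (\<gamma> - 1) * (real k + 1) - d) * exp (- (2 * (\<gamma> - 1) * r powr \<gamma>)) * ?c)"
    by (simp add: ennreal_mult[symmetric] ennreal_leI)
qed

text \<open>
  The value of \<open>box_pairing\<close> for the profile, as an integral over the whole half line, so that it
  is independent of the data \<open>r0\<close>, \<open>R\<close> of the locale, which vary with \<open>N\<close>.\<close>
definition pairing :: "real \<Rightarrow> real \<Rightarrow> nat \<Rightarrow> nat \<Rightarrow> real \<Rightarrow> real" where
  "pairing \<gamma> d k n x = enn2real (\<integral>\<^sup>+r. ennreal (r powr (\<gamma> - 1) * (r powr (\<gamma> - 1)) ^ k * exp (- (x * ((\<gamma> - 1) * r powr \<gamma>))) * profile \<gamma> d k n r) \<partial>half)"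

text \<open>The bound on the profile is the bound on \<open>F\<close> at \<open>\<theta> = s = 0\<close>, where the packet takes the value \<open>flat 1\<close>.\<close>
lemma test_mode_leray_data:
  assumes \<gamma>: "\<gamma> > 1"
  obtains F r0 R S B where "leray_data \<gamma> F r0 R S B"
    "\<And>r \<theta> s. r > 0 \<Longrightarrow> F r \<theta> s = test_mode \<gamma> d k n N (par \<gamma> (r, \<theta>, s))"
    "\<And>r \<theta> s. r > 0 \<Longrightarrow> F r \<theta> s = of_real (profile \<gamma> d k n r) * cis (real k * \<theta>) * packet N s"
    "\<And>r. r > 0 \<Longrightarrow> profile \<gamma> d k n r \<le> B / flat 1"
    "\<And>r. r > 0 \<Longrightarrow> profile \<gamma> d k n r \<noteq> 0 \<Longrightarrow> r0 \<le> r \<and> r \<le> R"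
proof -
  from test_fun_leray_data[OF \<gamma> test_mode_test_fun] obtain F r0 R S B where
    L: "leray_data \<gamma> F r0 R S B" and f: "\<And>r \<theta> s. r > 0 \<Longrightarrow> F r \<theta> s = test_mode \<gamma> d k n N (par \<gamma> (r, \<theta>, s))" by blast
  interpret leray_data \<gamma> F r0 R S B by (rule L)
  have F: "F r \<theta> s = of_real (profile \<gamma> d k n r) * cis (real k * \<theta>) * packet N s" if "r > 0" for r \<theta> s
    using f[OF that] test_mode_par[OF that] by simp
  have c0: "packet N 0 = of_real (flat 1)" by (simp add: packet_def bump_def)
  have f1: "flat 1 > 0" by (rule flat_pos) simp
  have "profile \<gamma> d k n r \<le> B / flat 1" if "r > 0" for r
    using bound[of r 0 0] f1 profile_nonneg[of \<gamma> d k n r] unfolding F[OF that] c0 by (simp add: norm_mult pos_le_divide_eq)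
  moreover have "r0 \<le> r \<and> r \<le> R" if "r > 0" "profile \<gamma> d k n r \<noteq> 0" for r
    using supp[of r 0 0] that f1 unfolding F[OF that(1)] c0 by auto
  ultimately show ?thesis using that[OF L f F] by blast
qed

lemma box_pairing_eq_pairing:
  assumes "leray_data \<gamma> F r0 R S B" "\<And>r. r > 0 \<Longrightarrow> profile \<gamma> d k n r \<le> M" "\<And>r. r > 0 \<Longrightarrow> profile \<gamma> d k n r \<noteq> 0 \<Longrightarrow> r0 \<le> r \<and> r \<le> R" "x \<ge> 0"
  shows "leray_data.box_pairing \<gamma> r0 R (profile \<gamma> d k n) k x = pairing \<gamma> d k n x"
proof -
  interpret leray_data \<gamma> F r0 R S B by (rule assms(1))
  have "ennreal (box_pairing (profile \<gamma> d k n) k x) = (\<integral>\<^sup>+r. ennreal (r powr (\<gamma> - 1) * (r powr (\<gamma> - 1)) ^ k * exp (- (x * ((\<gamma> - 1) * r powr \<gamma>))) * profile \<gamma> d k n r) \<partial>half)"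
    by (rule box_pairing_eq_nn_integral(1)[of _ M]) (use assms profile_nonneg in auto)
  moreover have "box_pairing (profile \<gamma> d k n) k x \<ge> 0" by (rule box_pairing_eq_nn_integral(2)[of _ M]) (use assms profile_nonneg in auto)
  ultimately show ?thesis unfolding pairing_def by (metis enn2real_ennreal)
qed

lemma pairing_1:
  assumes \<gamma>: "\<gamma> > 1" shows "ennreal (pairing \<gamma> d k n 1) = cut_mass \<gamma> d k n"
proof -
  obtain F r0 R S B where L: "leray_data \<gamma> F r0 R S B"
    and b: "\<And>r. r > 0 \<Longrightarrow> profile \<gamma> d k n r \<le> B / flat 1" and s: "\<And>r. r > 0 \<Longrightarrow> profile \<gamma> d k n r \<noteq> 0 \<Longrightarrow> r0 \<le> r \<and> r \<le> R"
    using test_mode_leray_data[OF \<gamma>, of d k n 0] by metis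
  interpret leray_data \<gamma> F r0 R S B by (rule L)
  have "ennreal (pairing \<gamma> d k n 1) = ennreal (box_pairing (profile \<gamma> d k n) k 1)" using box_pairing_eq_pairing[OF L b s] by simp
  also have "\<dots> = (\<integral>\<^sup>+r. ennreal (r powr (\<gamma> - 1) * (r powr (\<gamma> - 1)) ^ k * exp (- (1 * ((\<gamma> - 1) * r powr \<gamma>))) * profile \<gamma> d k n r) \<partial>half)"
    by (rule box_pairing_eq_nn_integral(1)[of _ "B / flat 1"]) (use b s profile_nonneg in auto)
  also have "\<dots> = cut_mass \<gamma> d k n" unfolding cut_mass_def
  proof (rule nn_integral_cong_AE, use AE_half in eventually_elim)
    fix r :: real assume r: "r > 0"
    have p1: "r powr (\<gamma> - 1) * (r powr (\<gamma> - 1)) ^ k = r powr ((\<gamma> - 1) * (real k + 1))"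
      using r by (simp add: powr_power powr_add[symmetric] algebra_simps)
    have p: "r powr ((\<gamma> - 1) * (real k + 1)) * r powr ((\<gamma> - 1) * (real k + 1) - d) = r powr (2 * (\<gamma> - 1) * (real k + 1) - d)"
      unfolding powr_add[symmetric] by (rule arg_cong[where f="\<lambda>x. r powr x"]) (simp add: algebra_simps)
    have e: "exp (- (1 * ((\<gamma> - 1) * r powr \<gamma>))) * exp (- ((\<gamma> - 1) * r powr \<gamma>)) = exp (- (2 * (\<gamma> - 1) * r powr \<gamma>))"
      by (simp add: exp_add[symmetric])
    show "ennreal (r powr (\<gamma> - 1) * (r powr (\<gamma> - 1)) ^ k * exp (- (1 * ((\<gamma> - 1) * r powr \<gamma>))) * profile \<gamma> d k n r) =
      ennreal (r powr (2 * (\<gamma> - 1) * (real k + 1) - d) * exp (- (2 * (\<gamma> - 1) * r powr \<gamma>)) * cut n (r\<^sup>2))"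
      unfolding p1 p[symmetric] e[symmetric] profile_def by (simp only: mult_ac)
  qed
  finally show ?thesis .
qed

lemma pairing_nonneg: "0 \<le> pairing \<gamma> d k n x" by (simp add: pairing_def)

lemma pairing_tendsto:
  assumes \<gamma>: "\<gamma> > 1" and X: "X \<longlonglongrightarrow> 1" "\<And>n. X n \<ge> 0"
  shows "(\<lambda>j. pairing \<gamma> d k n (X j)) \<longlonglongrightarrow> pairing \<gamma> d k n 1"
proof -
  obtain F r0 R S B where L: "leray_data \<gamma> F r0 R S B"
    and b: "\<And>r. r > 0 \<Longrightarrow> profile \<gamma> d k n r \<le> B / flat 1" and s: "\<And>r. r > 0 \<Longrightarrow> profile \<gamma> d k n r \<noteq> 0 \<Longrightarrow> r0 \<le> r \<and> r \<le> R"
    using test_mode_leray_data[OF \<gamma>, of d k n 0] by metis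
  interpret leray_data \<gamma> F r0 R S B by (rule L)
  have "(\<lambda>j. box_pairing (profile \<gamma> d k n) k (X j)) \<longlonglongrightarrow> box_pairing (profile \<gamma> d k n) k 1"
    by (rule box_pairing_tendsto[of _ "B / flat 1"]) (use b profile_nonneg X in auto)
  thus ?thesis using box_pairing_eq_pairing[OF L b s X(2)] box_pairing_eq_pairing[OF L b s, of 1] by simp
qed

definition peak :: "real \<Rightarrow> real \<Rightarrow> nat \<Rightarrow> nat \<Rightarrow> real \<Rightarrow> real" where
  "peak \<gamma> d k n x = \<gamma> ^ 3 * (x\<^sup>2 * ((x * \<gamma>) ^ k / fact k)\<^sup>2 * ((2 * x) powr (- ((2 * real k + d + 1) / \<gamma>)) * Gamma ((2 * real k + d + 1) / \<gamma>))) * (pairing \<gamma> d k n x)\<^sup>2"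

lemma measurable_pairing [measurable]: "pairing \<gamma> d k n \<in> borel_measurable borel"
proof -
  interpret sigma_finite_measure half by simp
  show ?thesis unfolding pairing_def[abs_def] by measurable
qed

lemma measurable_peak [measurable]: "peak \<gamma> d k n \<in> borel_measurable borel"
  unfolding peak_def[abs_def] by measurable

text \<open>The definition of the operator norm for a wave packet: energy of the mode \<open>k\<close> of the output on the left,
  squared norm of the input on the right.\<close>
lemma test_mode_norm_bound:
  assumes \<gamma>: "\<gamma> > 1" and d: "d > -1" and Lop: "leray_opnorm \<gamma> (mu \<gamma> d) \<noteq> top" and Jfin: "cut_mass \<gamma> d k n \<noteq> top"
  shows "(\<integral>\<^sup>+x. ennreal (peak \<gamma> d k n x * (cmod (fourier (packet N) x))\<^sup>2) \<partial>half) \<le>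
    (leray_opnorm \<gamma> (mu \<gamma> d))\<^sup>2 * (cut_mass \<gamma> d k n * (ennreal (2 * pi) * (ennreal (real (Suc N)) * bump_normsq)))"
proof -
  let ?L = "leray_opnorm \<gamma> (mu \<gamma> d)"
  let ?f = "test_mode \<gamma> d k n N"
  obtain F r0 R S B where L: "leray_data \<gamma> F r0 R S B"
    and f: "\<And>r \<theta> s. r > 0 \<Longrightarrow> F r \<theta> s = ?f (par \<gamma> (r, \<theta>, s))"
    and F: "\<And>r \<theta> s. r > 0 \<Longrightarrow> F r \<theta> s = of_real (profile \<gamma> d k n r) * cis (real k * \<theta>) * packet N s"
    and b: "\<And>r. r > 0 \<Longrightarrow> profile \<gamma> d k n r \<le> B / flat 1" and s: "\<And>r. r > 0 \<Longrightarrow> profile \<gamma> d k n r \<noteq> 0 \<Longrightarrow> r0 \<le> r \<and> r \<le> R"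
    by (rule test_mode_leray_data[OF \<gamma>, of d k n N]) (rule that)
  interpret leray_data \<gamma> F r0 R S B by (rule L)
  let ?I1 = "\<integral>\<^sup>+ \<zeta>. ennreal ((cmod (leray_bd \<gamma> ?f \<zeta>))\<^sup>2) \<partial>mu \<gamma> d"
  let ?I2 = "\<integral>\<^sup>+ \<zeta>. ennreal ((cmod (?f \<zeta>))\<^sup>2) \<partial>mu \<gamma> d"
  let ?E = "cut_mass \<gamma> d k n * (ennreal (2 * pi) * (ennreal (real (Suc N)) * bump_normsq))"
  have Efin: "?E \<noteq> top" using Jfin bump_normsq_finite by (auto simp: ennreal_mult_eq_top_iff)
  have "?I2 = polar_normsq d F"
    using f by (rule nn_integral_test)
  also have "\<dots> = (\<integral>\<^sup>+r. (ennreal (r powr d) * ennreal ((profile \<gamma> d k n r)\<^sup>2)) * (ennreal (2 * pi) * (ennreal (real (Suc N)) * bump_normsq)) \<partial>half)"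
  proof (rule nn_integral_cong_AE, use AE_half in eventually_elim)
    fix r :: real assume r: "r > 0"
    have "(\<integral>\<^sup>+s. ennreal (r powr d) * ennreal ((cmod (F r \<theta> s))\<^sup>2) \<partial>lborel) = (ennreal (r powr d) * ennreal ((profile \<gamma> d k n r)\<^sup>2)) * (ennreal (real (Suc N)) * bump_normsq)" for \<theta>
    proof -
      have "(\<integral>\<^sup>+s. ennreal (r powr d) * ennreal ((cmod (F r \<theta> s))\<^sup>2) \<partial>lborel) = (\<integral>\<^sup>+s. (ennreal (r powr d) * ennreal ((profile \<gamma> d k n r)\<^sup>2)) * ennreal ((cmod (packet N s))\<^sup>2) \<partial>lborel)"
        unfolding F[OF r] by (intro nn_integral_cong) (simp add: norm_mult power_mult_distrib ennreal_mult mult.assoc)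
      also have "\<dots> = (ennreal (r powr d) * ennreal ((profile \<gamma> d k n r)\<^sup>2)) * (\<integral>\<^sup>+s. ennreal ((cmod (packet N s))\<^sup>2) \<partial>lborel)"
        by (rule nn_integral_cmult) measurable
      finally show ?thesis unfolding nn_integral_packet .
    qed
    moreover have "emeasure circ UNIV = ennreal (2 * pi)"
      using measure_circ finite_circ by (metis finite_measure.emeasure_eq_measure)
    ultimately show "(\<integral>\<^sup>+\<theta>. \<integral>\<^sup>+s. ennreal (r powr d) * ennreal ((cmod (F r \<theta> s))\<^sup>2) \<partial>lborel \<partial>circ) = (ennreal (r powr d) * ennreal ((profile \<gamma> d k n r)\<^sup>2)) * (ennreal (2 * pi) * (ennreal (real (Suc N)) * bump_normsq))"
      by (simp add: mult_ac del: of_nat_Suc)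
  qed
  also have "\<dots> = (\<integral>\<^sup>+r. ennreal (r powr d) * ennreal ((profile \<gamma> d k n r)\<^sup>2) \<partial>half) * (ennreal (2 * pi) * (ennreal (real (Suc N)) * bump_normsq))"
    by (rule nn_integral_multc) measurable
  also have "\<dots> \<le> ?E" by (intro mult_right_mono profile_square_le) simp
  finally have I2: "?I2 \<le> ?E" .
  have "L2norm (mu \<gamma> d) (leray_bd \<gamma> ?f) / L2norm (mu \<gamma> d) ?f \<le> ?L"
    unfolding leray_opnorm_def by (rule SUP_upper) (use test_mode_test_fun test_mode_nonzero in blast)
  hence "esqrt ?I1 / esqrt ?I2 \<le> ?L" unfolding L2norm_esqrt .
  moreover have "esqrt ?I2 \<noteq> top" using I2 Efin by (auto simp: esqrt_def top_unique)
  ultimately have "esqrt ?I1 \<le> ?L * esqrt ?I2" using Lop by (rule ennreal_le_of_divide)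
  hence "esqrt ?I1 * esqrt ?I1 \<le> (?L * esqrt ?I2) * (?L * esqrt ?I2)" by (intro mult_mono) auto
  also have "\<dots> = ?L\<^sup>2 * (esqrt ?I2 * esqrt ?I2)" by (simp add: power2_eq_square mult_ac)
  finally have "?I1 \<le> ?L\<^sup>2 * ?I2" unfolding esqrt_square .
  also have "\<dots> \<le> ?L\<^sup>2 * ?E" by (intro mult_left_mono I2) simp
  finally have I1: "?I1 \<le> ?L\<^sup>2 * ?E" .
  have "(\<integral>\<^sup>+x. ennreal (peak \<gamma> d k n x * (cmod (fourier (packet N) x))\<^sup>2) \<partial>half) = (\<integral>\<^sup>+x. ennreal (box_peak (profile \<gamma> d k n) d k x * (cmod (fourier (packet N) x))\<^sup>2) \<partial>half)"
  proof (rule nn_integral_cong_AE, use AE_half in eventually_elim)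
    fix x :: real assume "x > 0"
    hence "box_pairing (profile \<gamma> d k n) k x = pairing \<gamma> d k n x" by (intro box_pairing_eq_pairing[OF L b s]) auto
    thus "ennreal (peak \<gamma> d k n x * (cmod (fourier (packet N) x))\<^sup>2) = ennreal (box_peak (profile \<gamma> d k n) d k x * (cmod (fourier (packet N) x))\<^sup>2)"
      by (simp add: peak_def box_peak_def alpha_def)
  qed
  also have "\<dots> \<le> polar_normsq d bd"
    by (rule normsq_lower[OF F _ _ d]) auto
  also have "\<dots> = ?I1" by (rule nn_integral_leray_bd[symmetric]) (rule f)
  finally show ?thesis using I1 by (rule order_trans)
qed

text \<open>The mass of the extremal profile before it is cut off, and a consequence for the cut-off masses.\<close>
lemma full_mass_cut_mass_finite:
  fixes \<gamma> d :: real and k :: nat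
  assumes \<gamma>: "\<gamma> > 1" and d: "d < 2 * \<gamma> - 1"
  defines "\<beta> \<equiv> (2 * (\<gamma> - 1) * (real k + 1) - d + 1) / \<gamma>"
  shows "(\<integral>\<^sup>+r. ennreal (r powr (2 * (\<gamma> - 1) * (real k + 1) - d) * exp (- (2 * (\<gamma> - 1) * r powr \<gamma>))) \<partial>half) = ennreal ((2 * (\<gamma> - 1)) powr (- \<beta>) * Gamma \<beta> / \<gamma>)"
    and "cut_mass \<gamma> d k n \<noteq> top"
proof -
  define t where "t = 2 * (\<gamma> - 1) * (real k + 1)"
  have "t \<ge> 2 * (\<gamma> - 1) * 1" unfolding t_def using \<gamma> by (intro mult_left_mono) auto
  hence "-1 < t - d" using d by simp
  from nn_integral_powr_exp_powr[OF this, of "2 * (\<gamma> - 1)" \<gamma>] \<gamma>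
  show 1: "(\<integral>\<^sup>+r. ennreal (r powr (2 * (\<gamma> - 1) * (real k + 1) - d) * exp (- (2 * (\<gamma> - 1) * r powr \<gamma>))) \<partial>half) = ennreal ((2 * (\<gamma> - 1)) powr (- \<beta>) * Gamma \<beta> / \<gamma>)"
    unfolding \<beta>_def t_def[symmetric] by simp
  have "cut_mass \<gamma> d k n \<le> (\<integral>\<^sup>+r. ennreal (r powr (2 * (\<gamma> - 1) * (real k + 1) - d) * exp (- (2 * (\<gamma> - 1) * r powr \<gamma>))) \<partial>half)"
    unfolding cut_mass_def by (intro nn_integral_mono ennreal_leI) (simp add: cut_bounds mult_left_le)
  thus "cut_mass \<gamma> d k n \<noteq> top" unfolding 1 by (auto simp: top_unique)
qed

text \<open>The case \<open>x = 1\<close> of \<open>mode_normsq_constant\<close>. Its parameters are those of the locale, whence the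
  arbitrary instance.\<close>
lemma mode_normsq_eq_weight:
  assumes \<gamma>: "\<gamma> > 1"
  defines "\<alpha> \<equiv> \<lambda>d k. (2 * real k + d + 1) / \<gamma>" and "\<beta> \<equiv> \<lambda>d k. (2 * (\<gamma> - 1) * (real k + 1) - d + 1) / \<gamma>"
  shows "mode_normsq \<gamma> d k = \<gamma> ^ 3 * (\<gamma> ^ k / fact k)\<^sup>2 * (2 powr (- \<alpha> d k) * Gamma (\<alpha> d k)) * ((2 * (\<gamma> - 1)) powr (- \<beta> d k) * Gamma (\<beta> d k) / \<gamma>)"
proof -
  obtain F r0 R S B where L: "leray_data \<gamma> F r0 R S B" using test_mode_leray_data[OF \<gamma>] by metis
  interpret leray_data \<gamma> F r0 R S B by (rule L)
  from mode_normsq_constant[of 1 k d] show ?thesis by (simp add: alpha_def beta_def \<alpha>_def \<beta>_def mult_ac)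
qed

text \<open>After rescaling frequencies by \<open>N + 1\<close> around 1, the spectral density converges pointwise to its value
  at frequency 1 times the spectrum of the fixed bump; Fatou's lemma passes to the limit in
  \<open>test_mode_norm_bound\<close>, and the norm of the bump cancels.\<close>
lemma peak_bound:
  assumes \<gamma>: "\<gamma> > 1" and d: "d > -1" "d < 2 * \<gamma> - 1" and Lop: "leray_opnorm \<gamma> (mu \<gamma> d) \<noteq> top"
  shows "ennreal (peak \<gamma> d k n 1) \<le> (leray_opnorm \<gamma> (mu \<gamma> d))\<^sup>2 * cut_mass \<gamma> d k n"
proof -
  let ?L = "(leray_opnorm \<gamma> (mu \<gamma> d))\<^sup>2"
  let ?m = "peak \<gamma> d k n"
  let ?J = "cut_mass \<gamma> d k n"
  let ?y = "\<lambda>N y. 1 + y / real (Suc N)"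
  define Q where "Q N y = ennreal (?m (?y N y) * (cmod (fourier bump y))\<^sup>2) * indicator {0<..} (?y N y)" for N y
  have [measurable]: "Q N \<in> borel_measurable borel" for N unfolding Q_def[abs_def] by measurable
  have Q: "(\<integral>\<^sup>+y. Q N y \<partial>lborel) \<le> ?L * (?J * (ennreal (2 * pi) * bump_normsq))" for N
  proof -
    let ?N = "real (Suc N)"
    have N: "?N > 0" by simp
    have "(\<integral>\<^sup>+x. ennreal (?m x * (cmod (fourier (packet N) x))\<^sup>2) \<partial>half) = (\<integral>\<^sup>+x. ennreal (?m x * (cmod (fourier (packet N) x))\<^sup>2) * indicator {0<..} x \<partial>lborel)"
      by (rule nn_integral_half) measurable
    also have "\<dots> = ennreal \<bar>1 / ?N\<bar> * (\<integral>\<^sup>+y. ennreal (?m (1 + 1 / ?N * y) * (cmod (fourier (packet N) (1 + 1 / ?N * y)))\<^sup>2) * indicator {0<..} (1 + 1 / ?N * y) \<partial>lborel)"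
      by (rule nn_integral_real_affine) auto
    also have "(\<lambda>y. ennreal (?m (1 + 1 / ?N * y) * (cmod (fourier (packet N) (1 + 1 / ?N * y)))\<^sup>2) * indicator {0<..} (1 + 1 / ?N * y)) = (\<lambda>y. ennreal (?N\<^sup>2) * Q N y)"
    proof
      fix y
      have a: "?N * (1 + 1 / ?N * y - 1) = y" using N by (simp del: of_nat_Suc)
      have b: "1 + 1 / ?N * y = ?y N y" by simp
      have "(cmod (fourier (packet N) (1 + 1 / ?N * y)))\<^sup>2 = ?N\<^sup>2 * (cmod (fourier bump y))\<^sup>2"
        unfolding fourier_packet a by (simp add: norm_mult power_mult_distrib del: of_nat_Suc)
      hence "ennreal (?m (1 + 1 / ?N * y) * (cmod (fourier (packet N) (1 + 1 / ?N * y)))\<^sup>2) = ennreal (?N\<^sup>2 * (?m (?y N y) * (cmod (fourier bump y))\<^sup>2))"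
        unfolding b by (simp only: mult_ac)
      also have "\<dots> = ennreal (?N\<^sup>2) * ennreal (?m (?y N y) * (cmod (fourier bump y))\<^sup>2)" by (rule ennreal_mult') simp
      finally show "ennreal (?m (1 + 1 / ?N * y) * (cmod (fourier (packet N) (1 + 1 / ?N * y)))\<^sup>2) * indicator {0<..} (1 + 1 / ?N * y) = ennreal (?N\<^sup>2) * Q N y"
        unfolding Q_def b by (simp only: mult.assoc)
    qed
    also have "(\<integral>\<^sup>+y. ennreal (?N\<^sup>2) * Q N y \<partial>lborel) = ennreal (?N\<^sup>2) * (\<integral>\<^sup>+y. Q N y \<partial>lborel)"
      by (rule nn_integral_cmult) measurable
    also have "ennreal \<bar>1 / ?N\<bar> * (ennreal (?N\<^sup>2) * (\<integral>\<^sup>+y. Q N y \<partial>lborel)) = ennreal ?N * (\<integral>\<^sup>+y. Q N y \<partial>lborel)"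
    proof -
      have "\<bar>1 / ?N\<bar> * ?N\<^sup>2 = ?N" using N by (simp add: power2_eq_square del: of_nat_Suc)
      hence "ennreal \<bar>1 / ?N\<bar> * ennreal (?N\<^sup>2) = ennreal ?N" by (simp add: ennreal_mult[symmetric] del: of_nat_Suc)
      thus ?thesis by (simp only: mult.assoc[symmetric])
    qed
    finally have "ennreal ?N * (\<integral>\<^sup>+y. Q N y \<partial>lborel) \<le> ?L * (?J * (ennreal (2 * pi) * (ennreal ?N * bump_normsq)))"
      using test_mode_norm_bound[OF \<gamma> d(1) Lop full_mass_cut_mass_finite(2)[OF \<gamma> d(2)], of k n N] by simp
    also have "\<dots> = ennreal ?N * (?L * (?J * (ennreal (2 * pi) * bump_normsq)))" by (simp only: mult_ac)
    finally show ?thesis using N by (subst (asm) ennreal_mult_le_mult_iff) (auto simp del: of_nat_Suc)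
  qed
  have lim: "(\<lambda>N. Q N y) \<longlonglongrightarrow> ennreal (?m 1 * (cmod (fourier bump y))\<^sup>2)" for y
  proof -
    have y1: "(\<lambda>N. ?y N y) \<longlonglongrightarrow> 1" by real_asymp
    have ev: "\<forall>\<^sub>F N in sequentially. 0 < ?y N y" using order_tendstoD(1)[OF y1, of 0] by simp
    have "(\<lambda>N. max 0 (?y N y)) \<longlonglongrightarrow> max 0 1" by (intro tendsto_intros y1)
    hence y2: "(\<lambda>N. max 0 (?y N y)) \<longlonglongrightarrow> 1" by simp
    have "(\<lambda>N. ?m (max 0 (?y N y))) \<longlonglongrightarrow> ?m 1"
      unfolding peak_def by (intro tendsto_intros pairing_tendsto[OF \<gamma>] y2) auto
    hence "(\<lambda>N. ennreal (?m (max 0 (?y N y)) * (cmod (fourier bump y))\<^sup>2)) \<longlonglongrightarrow> ennreal (?m 1 * (cmod (fourier bump y))\<^sup>2)"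
      by (intro tendsto_ennrealI tendsto_intros)
    thus ?thesis
      by (rule Lim_transform_eventually) (use ev in eventually_elim, simp add: Q_def max_def)
  qed
  have m0: "?m 1 \<ge> 0"
  proof -
    have "(2 * real k + d + 1) / \<gamma> > 0" using d \<gamma> by (intro divide_pos_pos) auto
    thus ?thesis unfolding peak_def using \<gamma> by (intro mult_nonneg_nonneg) auto
  qed
  have "ennreal (?m 1) * (ennreal (2 * pi) * bump_normsq) = (\<integral>\<^sup>+y. ennreal (?m 1) * ennreal ((cmod (fourier bump y))\<^sup>2) \<partial>lborel)"
    by (subst nn_integral_cmult) (auto simp: plancherel_bump)
  also have "\<dots> = (\<integral>\<^sup>+y. liminf (\<lambda>N. Q N y) \<partial>lborel)"
    using lim_imp_Liminf[OF _ lim] m0 by (intro nn_integral_cong) (simp add: ennreal_mult)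
  also have "\<dots> \<le> liminf (\<lambda>N. \<integral>\<^sup>+y. Q N y \<partial>lborel)" by (rule nn_integral_liminf) measurable
  also have "\<dots> \<le> ?L * (?J * (ennreal (2 * pi) * bump_normsq))" by (rule liminf_le_bound[OF Q])
  finally have "(ennreal (2 * pi) * bump_normsq) * ennreal (?m 1) \<le> (ennreal (2 * pi) * bump_normsq) * (?L * ?J)"
    by (simp only: mult_ac)
  moreover have "ennreal (2 * pi) * bump_normsq \<noteq> 0" using bump_normsq_pos by simp
  moreover have "ennreal (2 * pi) * bump_normsq < top" using bump_normsq_finite by (simp add: ennreal_mult_less_top less_top)
  ultimately show ?thesis by (subst (asm) ennreal_mult_le_mult_iff) auto
qed

text \<open>At frequency 1 the output is proportional to the square of the cut-off mass and the input to its
  first power. Dividing and removing the cut-off by Fatou's lemma leaves the full Gamma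
  integral of the profile.\<close>
lemma mode_normsq_le_opnorm:
  assumes \<gamma>: "\<gamma> > 1" and d: "d > -1" "d < 2 * \<gamma> - 1"
  shows "ennreal (sqrt (mode_normsq \<gamma> d k)) \<le> leray_opnorm \<gamma> (mu \<gamma> d)"
proof (cases "leray_opnorm \<gamma> (mu \<gamma> d) = top")
  case False
  let ?L = "leray_opnorm \<gamma> (mu \<gamma> d)"
  let ?\<alpha> = "(2 * real k + d + 1) / \<gamma>" and ?\<beta> = "(2 * (\<gamma> - 1) * (real k + 1) - d + 1) / \<gamma>"
  define c0 where "c0 = \<gamma> ^ 3 * (\<gamma> ^ k / fact k)\<^sup>2 * (2 powr (- ?\<alpha>) * Gamma ?\<alpha>)"
  have ap: "?\<alpha> > 0" using d \<gamma> by (intro divide_pos_pos) auto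
  hence c0: "c0 \<ge> 0" unfolding c0_def using \<gamma> by (intro mult_nonneg_nonneg) auto
  have mk1: "peak \<gamma> d k n 1 = c0 * (pairing \<gamma> d k n 1)\<^sup>2" for n by (simp add: peak_def c0_def)
  have J: "ennreal c0 * cut_mass \<gamma> d k n \<le> ?L\<^sup>2" for n
  proof (cases "cut_mass \<gamma> d k n = 0")
    case False': False
    have "cut_mass \<gamma> d k n * (ennreal c0 * cut_mass \<gamma> d k n) = ennreal (peak \<gamma> d k n 1)"
      unfolding mk1 pairing_1[OF \<gamma>, symmetric] using c0 pairing_nonneg[of \<gamma> d k n 1] by (simp add: ennreal_mult power2_eq_square mult_ac)
    also have "\<dots> \<le> ?L\<^sup>2 * cut_mass \<gamma> d k n" by (rule peak_bound[OF \<gamma> d False])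
    also have "\<dots> = cut_mass \<gamma> d k n * ?L\<^sup>2" by (rule mult.commute)
    finally show ?thesis using False' full_mass_cut_mass_finite(2)[OF \<gamma> d(2), of k n] by (subst (asm) ennreal_mult_le_mult_iff) (auto simp: less_top)
  qed simp
  let ?h = "\<lambda>r. r powr (2 * (\<gamma> - 1) * (real k + 1) - d) * exp (- (2 * (\<gamma> - 1) * r powr \<gamma>))"
  let ?u = "\<lambda>n r. ennreal c0 * ennreal (?h r * cut n (r\<^sup>2))"
  have um: "?u n \<in> borel_measurable half" for n unfolding cut_def by measurable
  have "ennreal (mode_normsq \<gamma> d k) = ennreal c0 * ennreal ((2 * (\<gamma> - 1)) powr (- ?\<beta>) * Gamma ?\<beta> / \<gamma>)"
    unfolding mode_normsq_eq_weight[OF \<gamma>] c0_def[symmetric] by (rule ennreal_mult'[OF c0])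
  also have "\<dots> = (\<integral>\<^sup>+r. ennreal c0 * ennreal (?h r) \<partial>half)"
    unfolding full_mass_cut_mass_finite(1)[OF \<gamma> d(2), symmetric] by (rule nn_integral_cmult[symmetric]) measurable
  also have "\<dots> = (\<integral>\<^sup>+r. liminf (\<lambda>n. ?u n r) \<partial>half)"
  proof (rule nn_integral_cong_AE, use AE_half in eventually_elim)
    fix r :: real assume r: "r > 0"
    have "(\<lambda>n. ?h r * cut n (r\<^sup>2)) \<longlonglongrightarrow> ?h r * 1" by (intro tendsto_intros cut_tendsto) (use r in simp)
    hence "(\<lambda>n. ?u n r) \<longlonglongrightarrow> ennreal c0 * ennreal (?h r)" by (intro ennreal_tendsto_cmult tendsto_ennrealI) auto
    from lim_imp_Liminf[OF _ this] show "ennreal c0 * ennreal (?h r) = liminf (\<lambda>n. ?u n r)" by simp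
  qed
  also have "\<dots> \<le> liminf (\<lambda>n. \<integral>\<^sup>+r. ?u n r \<partial>half)" by (rule nn_integral_liminf[OF um])
  also have "\<dots> \<le> ?L\<^sup>2"
  proof (rule liminf_le_bound)
    fix n
    have "(\<integral>\<^sup>+r. ?u n r \<partial>half) = ennreal c0 * cut_mass \<gamma> d k n" unfolding cut_mass_def by (rule nn_integral_cmult) (simp add: cut_def)
    thus "(\<integral>\<^sup>+r. ?u n r \<partial>half) \<le> ?L\<^sup>2" using J[of n] by simp
  qed
  finally have C: "ennreal (mode_normsq \<gamma> d k) \<le> ?L\<^sup>2" .
  obtain l where l: "?L = ennreal l" "l \<ge> 0" using False by (cases ?L) auto
  have "mode_normsq \<gamma> d k \<le> l\<^sup>2" using C unfolding l(1) ennreal_power[OF l(2)] by (simp add: ennreal_le_iff)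
  hence "sqrt (mode_normsq \<gamma> d k) \<le> l" using l(2) by (rule real_le_lsqrt[OF _, rotated])
  thus ?thesis unfolding l(1) by (rule ennreal_leI)
qed simp

text \<open>The numbers \<open>mode_normsq \<gamma> d k\<close> need not attain their supremum, which occurs for the
  preferred measure.\<close>
theorem leray_opnorm_eq:
  assumes \<gamma>: "\<gamma> > 1" and d: "d > -1" "d < 2 * \<gamma> - 1" and C: "C > 0" "\<And>k. mode_normsq \<gamma> d k \<le> C"
    and sup: "\<And>e. e < C \<Longrightarrow> \<exists>k. e < mode_normsq \<gamma> d k"
  shows "leray_opnorm \<gamma> (mu \<gamma> d) = ennreal (sqrt C)"
proof (rule antisym)
  show "leray_opnorm \<gamma> (mu \<gamma> d) \<le> ennreal (sqrt C)" by (rule opnorm_upper[OF \<gamma> d C])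
  show "ennreal (sqrt C) \<le> leray_opnorm \<gamma> (mu \<gamma> d)"
  proof (cases "leray_opnorm \<gamma> (mu \<gamma> d)")
    case (real l)
    have "sqrt C \<le> l"
    proof (rule ccontr)
      assume "\<not> sqrt C \<le> l"
      hence "l\<^sup>2 < C" using real(1) by (metis not_le real_sqrt_le_iff real_sqrt_unique)
      from sup[OF this] obtain k where k: "l\<^sup>2 < mode_normsq \<gamma> d k" by blast
      have "ennreal (sqrt (mode_normsq \<gamma> d k)) \<le> ennreal l" using mode_normsq_le_opnorm[OF \<gamma> d, of k] real by simp
      hence "sqrt (mode_normsq \<gamma> d k) \<le> l" using real(1) by (simp add: ennreal_le_iff)
      hence "mode_normsq \<gamma> d k \<le> l\<^sup>2" using real(1) by (meson sqrt_le_D)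
      thus False using k by simp
    qed
    thus ?thesis unfolding real(2) by (rule ennreal_leI)
  qed simp
qed

lemma leray_opnorm_max:
  assumes "\<gamma> > 1" "d > -1" "d < 2 * \<gamma> - 1" "\<And>k. mode_normsq \<gamma> d k \<le> mode_normsq \<gamma> d 0"
  shows "leray_opnorm \<gamma> (mu \<gamma> d) = ennreal (sqrt (mode_normsq \<gamma> d 0))"
proof (rule leray_opnorm_eq[OF assms(1-3) _ assms(4)])
  have "(2 * real 0 + d + 1) / \<gamma> > 0" "(2 * (\<gamma> - 1) * (real 0 + 1) - d + 1) / \<gamma> > 0" using assms by (auto intro!: divide_pos_pos)
  thus "mode_normsq \<gamma> d 0 > 0" using assms(1) unfolding mode_normsq_def by (intro divide_pos_pos mult_pos_pos) auto
qed auto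

section \<open>Polygamma estimates\<close>

lemma pos_not_nonpos_Int [simp]: "(x::real) > 0 \<Longrightarrow> x \<notin> \<int>\<^sub>\<le>\<^sub>0"
  by (auto simp: nonpos_Ints_def)

text \<open>With \<open>R(y) = 1/y + 1/(6y\<^sup>2)\<close>, each term \<open>1 / (y + 1/3)\<^sup>2\<close> of the series is at most
  \<open>R(y) - R(y + 1)\<close>, and the series telescopes. The inequality says that the second derivative of
  \<open>ln \<Gamma>(x + 1/3) - (x - 1/6) ln x + x\<close> is nonpositive.\<close>
lemma trigamma_le:
  assumes x: "(x::real) > 0"
  shows "Polygamma 1 (x + 1/3) \<le> 1 / x + 1 / (6 * x\<^sup>2)"
proof -
  let ?f = "\<lambda>k::nat. inverse (((x + 1/3) + real k) ^ Suc 1)"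
  let ?R = "\<lambda>y::real. 1 / y + 1 / (6 * y\<^sup>2)"
  have sums: "?f sums Polygamma 1 (x + 1/3)"
    using Polygamma_LIMSEQ[of "x + 1/3" 1] x by simp
  have step: "inverse ((y + 1/3) ^ 2) \<le> ?R y - ?R (y + 1)" if y: "y > 0" for y :: real
  proof -
    have d: "?R y - ?R (y + 1) = (6 * y\<^sup>2 + 8 * y + 1) / (6 * y\<^sup>2 * (y + 1)\<^sup>2)"
      using y by (simp add: divide_simps power2_eq_square) (simp add: algebra_simps)
    have "54 * (y\<^sup>2 * (y + 1)\<^sup>2) \<le> (6 * y\<^sup>2 + 8 * y + 1) * (3 * y + 1)\<^sup>2"
      using y by (simp add: power2_eq_square algebra_simps)
    hence "9 / (3 * y + 1)\<^sup>2 \<le> (6 * y\<^sup>2 + 8 * y + 1) / (6 * y\<^sup>2 * (y + 1)\<^sup>2)"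
      using y by (simp add: divide_simps mult_ac)
    moreover have "inverse ((y + 1/3) ^ 2) = 9 / (3 * y + 1)\<^sup>2"
      using y by (simp add: divide_simps power2_eq_square) (simp add: algebra_simps)
    ultimately show ?thesis unfolding d by simp
  qed
  have part: "sum ?f {..<n} \<le> ?R x - ?R (x + real n)" for n
  proof (induction n)
    case (Suc n)
    have "?f n = inverse (((x + real n) + 1/3) ^ 2)" by (simp add: numeral_2_eq_2 add_ac)
    also have "\<dots> \<le> ?R (x + real n) - ?R (x + real n + 1)" using x by (intro step) auto
    finally show ?case using Suc by (simp add: add_ac)
  qed simp
  have "?R (x + real n) \<ge> 0" for n using x by auto
  hence "sum ?f {..<n} \<le> ?R x" for n using part[of n] by (smt (verit))
  thus ?thesis by (intro LIMSEQ_le_const2[OF sums[unfolded sums_def]] exI[of _ 0] allI impI)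
qed

text \<open>The left side is the sum of \<open>2k / (x + k)\<^sup>3\<close>, whose terms with \<open>k \<ge> 1\<close> are dominated by telescoping differences
  of the sequence \<open>?t\<close> with \<open>?t 0 = 1/x\<close>. The inequality says that the second derivative of
  \<open>x \<psi>(x) - x ln x\<close> is nonpositive.\<close>
lemma two_trigamma_le:
  assumes x: "(x::real) > 0"
  shows "2 * Polygamma 1 x + x * Polygamma 2 x \<le> 1 / x"
proof -
  let ?f = "\<lambda>k::nat. 2 * real k / (x + real k) ^ 3"
  let ?t = "\<lambda>n::nat. real n / ((x + real n) * (x + real n + 1)) + 1 / (x + real n)"
  have s1: "(\<lambda>k. inverse ((x + real k) ^ Suc 1)) sums Polygamma 1 x"
    using Polygamma_LIMSEQ[of x 1] x by simp
  have s2: "(\<lambda>k. inverse ((x + real k) ^ Suc 2)) sums (- Polygamma 2 x / 2)"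
    using Polygamma_LIMSEQ[of x 2] x by (simp add: fact_numeral)
  have "(\<lambda>k. 2 * inverse ((x + real k) ^ Suc 1) - 2 * x * inverse ((x + real k) ^ Suc 2)) sums (2 * Polygamma 1 x - 2 * x * (- Polygamma 2 x / 2))"
    by (intro sums_diff sums_mult s1 s2)
  also have "(\<lambda>k. 2 * inverse ((x + real k) ^ Suc 1) - 2 * x * inverse ((x + real k) ^ Suc 2)) = ?f"
  proof
    fix k show "2 * inverse ((x + real k) ^ Suc 1) - 2 * x * inverse ((x + real k) ^ Suc 2) = ?f k"
      using x by (simp add: divide_simps eval_nat_numeral add_nonneg_eq_0_iff add_pos_nonneg)
  qed
  finally have sums: "?f sums (2 * Polygamma 1 x + x * Polygamma 2 x)" by simp
  have step: "?f (Suc n) \<le> ?t n - ?t (Suc n)" for n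
  proof -
    define y where "y = x + real n + 1"
    have y: "y > 1" using x by (simp add: y_def)
    have "?t n - ?t (Suc n) = (2 * real n + 2) / ((y - 1) * y * (y + 1))"
    proof -
      have e1: "?t n = real n / ((y - 1) * y) + 1 / (y - 1)" by (simp add: y_def add_ac)
      have e2: "?t (Suc n) = (real n + 1) / (y * (y + 1)) + 1 / y" by (simp add: y_def add_ac)
      have "m / ((y - 1) * y) + 1 / (y - 1) - ((m + 1) / (y * (y + 1)) + 1 / y) = (2 * m + 2) / ((y - 1) * y * (y + 1))" for m
        using y by (simp add: divide_simps) (simp add: algebra_simps)
      thus ?thesis unfolding e1 e2 .
    qed
    moreover have "?f (Suc n) = (2 * real n + 2) / (y * y * y)" by (simp add: y_def power3_eq_cube add_ac)
    moreover have "(y - 1) * y * (y + 1) \<le> y * y * y" using y by (simp add: algebra_simps)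
    hence "(2 * real n + 2) / (y * y * y) \<le> (2 * real n + 2) / ((y - 1) * y * (y + 1))"
      using y by (intro divide_left_mono mult_pos_pos) auto
    ultimately show ?thesis by simp
  qed
  have part: "sum ?f {..<Suc n} \<le> 1 / x - ?t n" for n
  proof (induction n)
    case (Suc n)
    have "sum ?f {..<Suc (Suc n)} = sum ?f {..<Suc n} + ?f (Suc n)" by simp
    also have "\<dots> \<le> (1 / x - ?t n) + (?t n - ?t (Suc n))" by (intro add_mono Suc step)
    finally show ?case by simp
  qed simp
  have t0: "?t n \<ge> 0" for n using x by auto
  have "sum ?f {..<n} \<le> 1 / x" for n
  proof (cases n)
    case (Suc m) show ?thesis unfolding Suc using part[of m] t0[of m] by linarith
  qed (use x in simp)
  thus ?thesis by (intro LIMSEQ_le_const2[OF sums[unfolded sums_def]] exI[of _ 0] allI impI)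
qed

lemma supergradient:
  fixes F :: "real \<Rightarrow> real"
  assumes 1: "\<And>x. x > 0 \<Longrightarrow> (F has_real_derivative F' x) (at x)"
    and 2: "\<And>x. x > 0 \<Longrightarrow> (F' has_real_derivative F'' x) (at x)"
    and 3: "\<And>x. x > 0 \<Longrightarrow> F'' x \<le> 0" and xy: "x > 0" "y > 0"
  shows "F y - F x \<le> F' x * (y - x)"
proof -
  have "- F' x * (y - x) \<le> - F y - (- F x)"
    by (rule f''_imp_f'[where C="{0<..}" and f''="\<lambda>x. - F'' x"])
       (use xy 3 in \<open>auto intro!: DERIV_minus 1 2\<close>)
  thus ?thesis by simp
qed

subsection \<open>Monotonicity of the mode norms in the mode\<close>

definition digamma_defect :: "real \<Rightarrow> real" where "digamma_defect x = x * Digamma x - x * ln x"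

lemma digamma_defect_midpoint:
  assumes "a > 0" "b > 0" shows "digamma_defect a + digamma_defect b \<le> 2 * digamma_defect ((a + b) / 2)"
proof -
  let ?m = "(a + b) / 2"
  define G' where "G' x = Digamma x + x * Polygamma 1 x - ln x - 1" for x :: real
  have sg: "digamma_defect y - digamma_defect ?m \<le> G' ?m * (y - ?m)" if "y > 0" for y
  proof (rule supergradient[where F''="\<lambda>x. 2 * Polygamma 1 x + x * Polygamma 2 x - 1 / x"])
    show "(digamma_defect has_real_derivative G' x) (at x)" if "x > 0" for x
      unfolding digamma_defect_def[abs_def] G'_def using that
      by (auto intro!: derivative_eq_intros simp: algebra_simps)
    show "(G' has_real_derivative 2 * Polygamma 1 x + x * Polygamma 2 x - 1 / x) (at x)" if "x > 0" for x
      unfolding G'_def[abs_def] using that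
      by (auto intro!: derivative_eq_intros simp: algebra_simps numeral_2_eq_2)
    show "2 * Polygamma 1 x + x * Polygamma 2 x - 1 / x \<le> 0" if "x > 0" for x :: real using two_trigamma_le[OF that] by simp
  qed (use assms that in auto)
  have "G' ?m * (a - ?m) + G' ?m * (b - ?m) = 0" by (simp add: algebra_simps field_simps)
  thus ?thesis using sg[OF assms(1)] sg[OF assms(2)] by linarith
qed

text \<open>
  For \<open>p = 1/\<gamma>\<close> and \<open>q = 1 - 1/\<gamma>\<close> this interpolates, at integers \<open>n = k + 1\<close>, the logarithms of
  the mode norms for \<open>d = 1\<close>; see \<open>mode_normsq_1\<close>.\<close>
definition log_mode :: "real \<Rightarrow> real \<Rightarrow> real \<Rightarrow> real" where
  "log_mode p q n = 2 * n * (- ln 2 - p * ln p - q * ln q) + ln_Gamma (2 * n * p) + ln_Gamma (2 * n * q) - 2 * ln_Gamma n"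

text \<open>Multiplied by \<open>n\<close>, the derivative at \<open>n\<close> is the sum of the values of \<^const>\<open>digamma_defect\<close> at \<open>2np\<close> and \<open>2nq\<close>
  minus twice its value at their midpoint \<open>n\<close>; the logarithmic terms match exactly because \<open>p + q = 1\<close>.\<close>
lemma log_mode_antimono:
  assumes pq: "p > 0" "q > 0" "p + q = 1" and "0 < a" "a \<le> b"
  shows "log_mode p q b \<le> log_mode p q a"
proof (rule DERIV_nonpos_imp_nonincreasing[OF assms(5)])
  fix n assume "a \<le> n" "n \<le> b"
  hence n: "n > 0" using assms by simp
  let ?D = "2 * (- ln 2 - p * ln p - q * ln q) + 2 * p * Digamma (2 * n * p) + 2 * q * Digamma (2 * n * q) - 2 * Digamma n"
  have "(log_mode p q has_real_derivative ?D) (at n)"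
    unfolding log_mode_def[abs_def] using n pq
    by (auto intro!: derivative_eq_intros)
  moreover have "n * ?D \<le> 0"
  proof -
    have m: "digamma_defect (2 * n * p) + digamma_defect (2 * n * q) \<le> 2 * digamma_defect ((2 * n * p + 2 * n * q) / 2)" using n pq by (intro digamma_defect_midpoint) auto
    have e: "(2 * n * p + 2 * n * q) / 2 = n" using pq(3) by (simp add: distrib_left[symmetric] mult.assoc)
    have l: "ln (2 * n * p) = ln 2 + ln n + ln p" "ln (2 * n * q) = ln 2 + ln n + ln q"
      using n pq by (auto simp: ln_mult)
    have "n * ?D = digamma_defect (2 * n * p) + digamma_defect (2 * n * q) - 2 * digamma_defect n"
      unfolding digamma_defect_def l by (simp add: algebra_simps) (use pq(3) in algebra)
    thus ?thesis using m unfolding e by simp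
  qed
  hence "?D \<le> 0" using n by (simp add: mult_le_0_iff)
  ultimately show "\<exists>y. (log_mode p q has_real_derivative y) (at n) \<and> y \<le> 0" by blast
qed

lemma ln_Gamma_plus1: "(x::real) > 0 \<Longrightarrow> ln_Gamma (1 + x) = ln x + ln_Gamma x"
proof -
  assume x: "x > 0"
  have "exp (ln_Gamma (1 + x)) = Gamma (x + 1)" using x by (simp add: Gamma_real_pos_exp add_ac)
  also have "\<dots> = x * Gamma x" using x by (intro Gamma_plus1) auto
  also have "\<dots> = exp (ln x + ln_Gamma x)" using x by (simp add: exp_add Gamma_real_pos_exp)
  finally show ?thesis by simp
qed

text \<open>The bound is the limit of the decreasing function \<open>log_mode p q\<close> at 0. The poles of the
  three Gamma factors cancel there, as is seen by shifting each argument by 1.\<close>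
lemma log_mode_le_limit:
  assumes pq: "p > 0" "q > 0" "p + q = 1" and n: "0 < n"
  shows "log_mode p q n \<le> - ln (4 * p * q)"
proof -
  define T0 where "T0 x = 2 * x * (- ln 2 - p * ln p - q * ln q) + ln_Gamma (1 + 2 * x * p) + ln_Gamma (1 + 2 * x * q) - 2 * ln_Gamma (1 + x) - ln (4 * p * q)" for x
  have e: "log_mode p q x = T0 x" if "x > 0" for x
  proof -
    have "ln 4 = 2 * ln (2::real)" using ln_realpow[of 2 2] by simp
    thus ?thesis using that pq unfolding log_mode_def T0_def by (simp add: ln_Gamma_plus1 ln_mult)
  qed
  have "(T0 has_real_derivative (2 * (- ln 2 - p * ln p - q * ln q) + 2 * p * Digamma 1 + 2 * q * Digamma 1 - 2 * Digamma 1)) (at 0)"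
    unfolding T0_def[abs_def] by (auto intro!: derivative_eq_intros simp del: Digamma_1)
  hence "isCont T0 0" by (rule DERIV_isCont)
  hence "(T0 \<longlongrightarrow> T0 0) (at_right 0)"
    by (simp add: isCont_def filterlim_at_split)
  moreover have "T0 0 = - ln (4 * p * q)" by (simp add: T0_def)
  ultimately have l: "(T0 \<longlongrightarrow> - ln (4 * p * q)) (at_right 0)" by simp
  show ?thesis
  proof (rule tendsto_lowerbound[OF l])
    show "\<forall>\<^sub>F x in at_right 0. log_mode p q n \<le> T0 x"
      using eventually_at_right_less[of 0] eventually_at_right_real[OF n]
    proof eventually_elim
      case (elim x)
      thus ?case using log_mode_antimono[OF pq, of x n] e[of x] by auto
    qed
  qed simp
qed

section \<open>The largest mode for \<open>\<gamma> = 2\<close>, for \<open>d = 1\<close> and for the pairing measure\<close>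

lemma Gamma_reflection_real:
  fixes z :: real
  assumes "z \<notin> \<int>"
  shows "Gamma z * Gamma (1 - z) = pi / sin (pi * z)"
proof -
  have "complex_of_real (Gamma z * Gamma (1 - z)) = Gamma (complex_of_real z) * Gamma (1 - complex_of_real z)"
    by (simp add: Gamma_complex_of_real[symmetric])
  also have "\<dots> = of_real pi / sin (of_real pi * of_real z)" by (rule Gamma_reflection_complex)
  also have "\<dots> = complex_of_real (pi / sin (pi * z))" by (simp add: sin_of_real[symmetric])
  finally show ?thesis using of_real_eq_iff by blast
qed

text \<open>The reflection formula, shifted by one, yields the secant and the cosecant of the final constants.\<close>
lemma Gamma_mult_reflect:
  assumes "0 < x" "x < 2" "x \<noteq> 1"
  shows "Gamma x * Gamma (2 - x) = (1 - x) * pi / sin (pi * x)"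
proof -
  have nz: "1 - x \<notin> \<int>\<^sub>\<le>\<^sub>0"
  proof
    assume "1 - x \<in> \<int>\<^sub>\<le>\<^sub>0"
    then obtain n where "1 - x = of_int n" "n \<le> 0" by (auto elim!: nonpos_Ints_cases)
    with assms have "-1 < real_of_int n" "n \<noteq> 0" by linarith+
    thus False using \<open>n \<le> 0\<close> by linarith
  qed
  have xz: "x \<notin> \<int>"
  proof
    assume "x \<in> \<int>"
    then obtain n where "x = of_int n" by (auto elim: Ints_cases)
    with assms have "0 < n" "n < 2" "n \<noteq> 1" by auto
    thus False by linarith
  qed
  have "Gamma (2 - x) = (1 - x) * Gamma (1 - x)"
    using Gamma_plus1[OF nz] by (simp add: algebra_simps)
  hence "Gamma x * Gamma (2 - x) = (1 - x) * (Gamma x * Gamma (1 - x))" by simp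
  thus ?thesis unfolding Gamma_reflection_real[OF xz] by simp
qed

text \<open>Here \<open>\<gamma> / 2 = \<gamma> - 1 = 1\<close>, so the quotient of consecutive terms is \<open>\<alpha>\<beta> / (k+1)\<^sup>2\<close>, and
  \<open>(\<alpha> + \<beta>) / 2 = k + 1\<close>.\<close>
lemma mode_normsq_2_Suc:
  assumes "-1 < d" "d < 3"
  shows "mode_normsq 2 d (Suc k) \<le> mode_normsq 2 d k"
proof -
  define a where "a = real k + (d + 1) / 2"
  define b where "b = real k + (3 - d) / 2"
  have ab: "a > 0" "b > 0" using assms by (auto simp: a_def b_def add_nonneg_pos)
  have C: "mode_normsq 2 d j = Gamma (real j + (d + 1) / 2) * Gamma (real j + (3 - d) / 2) / (fact j)\<^sup>2" for j
    unfolding mode_normsq_def by (simp add: add_divide_distrib diff_divide_distrib algebra_simps)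
  have "mode_normsq 2 d (Suc k) = (a * Gamma a) * (b * Gamma b) / ((real k + 1) * fact k)\<^sup>2"
  proof -
    have "real (Suc k) + (d + 1) / 2 = a + 1" "real (Suc k) + (3 - d) / 2 = b + 1" by (auto simp: a_def b_def)
    moreover have "Gamma (a + 1) = a * Gamma a" "Gamma (b + 1) = b * Gamma b" using ab by (auto intro: Gamma_plus1)
    moreover have "(fact (Suc k) :: real) = (real k + 1) * fact k" by simp
    ultimately show ?thesis unfolding C by (simp only:)
  qed
  also have "\<dots> = Gamma a * Gamma b / (fact k)\<^sup>2 * ((a * b) / (real k + 1)\<^sup>2)"
    by (simp add: power_mult_distrib mult_ac)
  also have "\<dots> \<le> Gamma a * Gamma b / (fact k)\<^sup>2 * 1"
  proof (rule mult_left_mono)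
    have "a * b \<le> ((a + b) / 2)\<^sup>2"
      using zero_le_power2[of "a - b"] by (simp add: power2_eq_square field_simps)
    also have "(a + b) / 2 = real k + 1" by (simp add: a_def b_def field_simps)
    finally show "a * b / (real k + 1)\<^sup>2 \<le> 1" by (simp add: divide_le_eq add_nonneg_pos)
  qed (use ab in auto)
  also have "\<dots> = mode_normsq 2 d k" unfolding C a_def b_def by simp
  finally show ?thesis .
qed

lemma mode_normsq_2_le:
  assumes "-1 < d" "d < 3" shows "mode_normsq 2 d k \<le> mode_normsq 2 d 0"
proof (induction k)
  case (Suc k) thus ?case using mode_normsq_2_Suc[OF assms, of k] by linarith
qed simp

lemma mode_normsq_2_0:
  assumes "-1 < d" "d < 3" "d \<noteq> 1"
  shows "mode_normsq 2 d 0 = pi / 2 * (1 - d) * (1 / cos (d * pi / 2))"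
proof -
  have "mode_normsq 2 d 0 = Gamma ((d + 1) / 2) * Gamma (2 - (d + 1) / 2)"
    unfolding mode_normsq_def by (simp add: diff_divide_distrib add_divide_distrib algebra_simps)
  also have "\<dots> = (1 - (d + 1) / 2) * pi / sin (pi * ((d + 1) / 2))"
    using assms by (intro Gamma_mult_reflect) (auto simp: field_simps)
  also have "sin (pi * ((d + 1) / 2)) = cos (d * pi / 2)"
  proof -
    have "pi * ((d + 1) / 2) = d * pi / 2 + pi / 2" by (simp add: field_simps)
    thus ?thesis by (simp only: sin_add cos_pi_half sin_pi_half mult_zero_right mult_1_right add_0_left)
  qed
  finally show ?thesis by (simp add: field_simps)
qed

lemma mode_normsq_2_1: "mode_normsq 2 1 k = 1"
proof -
  have e: "(2 * real k + 1 + 1) / 2 = 1 + real k" "(2 * (2 - 1) * (real k + 1) - 1 + 1) / 2 = 1 + real k" by auto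
  show ?thesis unfolding mode_normsq_def e Gamma_fact by (simp add: power2_eq_square)
qed

lemma exp_log_mode:
  assumes "\<gamma> > 1" "n > 0"
  shows "exp (log_mode (1 / \<gamma>) (1 - 1 / \<gamma>) (real n)) = (\<gamma> / 2) ^ (2 * n) * (\<gamma> - 1) powr (- (2 * real n * (1 - 1 / \<gamma>))) *
    Gamma (2 * real n * (1 / \<gamma>)) * Gamma (2 * real n * (1 - 1 / \<gamma>)) / (Gamma (real n))\<^sup>2"
proof -
  define p where "p = 1 / \<gamma>"
  define q where "q = 1 - 1 / \<gamma>"
  have pq: "p > 0" "q > 0" "p + q = 1" using assms by (auto simp: p_def q_def)
  have q: "q = (\<gamma> - 1) / \<gamma>" using assms by (simp add: q_def field_simps)
  have lp: "ln p = - ln \<gamma>" using assms by (simp add: p_def ln_div)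
  have lq: "ln q = ln (\<gamma> - 1) - ln \<gamma>" using assms unfolding q by (simp add: ln_div)
  have k: "- ln 2 - p * ln p - q * ln q = ln (\<gamma> / 2) - q * ln (\<gamma> - 1)"
  proof -
    have "- ln 2 - p * ln p - q * ln q = - ln 2 + (p + q) * ln \<gamma> - q * ln (\<gamma> - 1)"
      unfolding lp lq by (simp add: algebra_simps)
    thus ?thesis unfolding pq(3) using assms by (simp add: ln_div)
  qed
  have "exp (log_mode p q (real n)) = exp (real (2 * n) * ln (\<gamma> / 2)) * exp (- (2 * real n * q) * ln (\<gamma> - 1)) * exp (ln_Gamma (2 * real n * p)) * exp (ln_Gamma (2 * real n * q)) / (exp (ln_Gamma (real n)))\<^sup>2"
    unfolding log_mode_def k by (simp add: exp_add[symmetric] exp_diff[symmetric] power2_eq_square algebra_simps)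
  also have "exp (real (2 * n) * ln (\<gamma> / 2)) = (\<gamma> / 2) ^ (2 * n)"
    using assms by (subst exp_of_nat_mult) auto
  also have "exp (- (2 * real n * q) * ln (\<gamma> - 1)) = (\<gamma> - 1) powr (- (2 * real n * q))"
    using assms by (simp add: powr_def)
  finally show ?thesis using pq assms(2) unfolding q_def[symmetric] unfolding p_def[symmetric] by (simp add: Gamma_real_pos_exp)
qed

lemma mode_normsq_1:
  assumes "\<gamma> > 1"
  shows "mode_normsq \<gamma> 1 k = exp (log_mode (1 / \<gamma>) (1 - 1 / \<gamma>) (real (Suc k)))"
proof -
  have "Gamma (real (Suc k)) = fact k" using Gamma_fact[of k, where 'a=real] by (simp add: add_ac)
  moreover have "(2 * real k + 1 + 1) / \<gamma> = 2 * real (Suc k) * (1 / \<gamma>)" by (simp add: field_simps)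
  moreover have "(2 * (\<gamma> - 1) * (real k + 1) - 1 + 1) / \<gamma> = 2 * real (Suc k) * (1 - 1 / \<gamma>)" using assms by (simp add: field_simps)
  ultimately show ?thesis unfolding mode_normsq_def by (subst exp_log_mode[OF assms]) simp_all
qed

lemma mode_normsq_1_le: "\<gamma> > 1 \<Longrightarrow> mode_normsq \<gamma> 1 k \<le> mode_normsq \<gamma> 1 0"
  using log_mode_antimono[of "1 / \<gamma>" "1 - 1 / \<gamma>" 1 "real (Suc k)"] by (simp add: mode_normsq_1)

lemma mode_normsq_1_0:
  assumes "\<gamma> > 1" "\<gamma> \<noteq> 2"
  shows "sqrt (mode_normsq \<gamma> 1 0) = (\<gamma> - 1) powr (1 / \<gamma> - 1) * sqrt (pi / 4 * (\<gamma> - 2) * \<gamma> * (1 / sin (2 * pi / \<gamma>)))"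
proof -
  have e: "2 * (\<gamma> - 1) / \<gamma> = 2 - 2 / \<gamma>" using assms by (simp add: field_simps)
  have "mode_normsq \<gamma> 1 0 = (\<gamma> / 2)\<^sup>2 * (\<gamma> - 1) powr (- (2 - 2 / \<gamma>)) * (Gamma (2 / \<gamma>) * Gamma (2 - 2 / \<gamma>))"
    unfolding mode_normsq_def using e by (simp add: mult_ac power2_eq_square)
  also have "Gamma (2 / \<gamma>) * Gamma (2 - 2 / \<gamma>) = (1 - 2 / \<gamma>) * pi / sin (pi * (2 / \<gamma>))"
    using assms by (intro Gamma_mult_reflect) (auto simp: field_simps)
  also have "(\<gamma> - 1) powr (- (2 - 2 / \<gamma>)) = ((\<gamma> - 1) powr (1 / \<gamma> - 1))\<^sup>2"
    by (simp add: power2_eq_square powr_add[symmetric])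
  also have "(\<gamma> / 2)\<^sup>2 * ((\<gamma> - 1) powr (1 / \<gamma> - 1))\<^sup>2 * ((1 - 2 / \<gamma>) * pi / sin (pi * (2 / \<gamma>))) =
    ((\<gamma> - 1) powr (1 / \<gamma> - 1))\<^sup>2 * (pi / 4 * (\<gamma> - 2) * \<gamma> * (1 / sin (2 * pi / \<gamma>)))"
  proof -
    have "(\<gamma> / 2)\<^sup>2 * (1 - 2 / \<gamma>) = (\<gamma> - 2) * \<gamma> / 4" using assms by (simp add: power2_eq_square field_simps)
    moreover have "a * x * (b * pi / s) = x * ((a * b) * (pi / s))" for a b x s :: real by simp
    moreover have "pi * (2 / \<gamma>) = 2 * pi / \<gamma>" by simp
    ultimately show ?thesis by (simp only:) simp
  qed
  finally have fin: "mode_normsq \<gamma> 1 0 = ((\<gamma> - 1) powr (1 / \<gamma> - 1))\<^sup>2 * (pi / 4 * (\<gamma> - 2) * \<gamma> * (1 / sin (2 * pi / \<gamma>)))" .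
  show ?thesis unfolding fin real_sqrt_mult[of "_\<^sup>2"] by simp
qed

lemma mode_normsq_pairing_0:
  assumes "\<gamma> > 1" shows "mode_normsq \<gamma> (\<gamma> - 1) 0 = \<gamma>\<^sup>2 / (4 * (\<gamma> - 1))"
proof -
  have "(2 * (\<gamma> - 1) - (\<gamma> - 1) + 1) / \<gamma> = 1" using assms by (simp add: field_simps)
  moreover have "(\<gamma> - 1) powr (- 1) = 1 / (\<gamma> - 1)" using assms by (simp add: powr_minus_divide)
  ultimately show ?thesis using assms unfolding mode_normsq_def by (simp add: power_divide power2_eq_square)
qed

text \<open>For \<open>d = \<gamma> - 1\<close> the Gamma arguments are \<open>2kp + 1\<close> and \<open>2kq + 1\<close>. Shifting them down by one, for \<open>k \<ge> 1\<close>,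
  expresses the mode as \<open>exp (log_mode p q k)\<close>; the mode \<open>k = 0\<close> equals \<open>1 / (4pq)\<close>, the limit of
  that expression at 0.\<close>
lemma mode_normsq_pairing_le:
  assumes \<gamma>: "\<gamma> > 1" shows "mode_normsq \<gamma> (\<gamma> - 1) k \<le> mode_normsq \<gamma> (\<gamma> - 1) 0"
proof (cases "k = 0")
  case False
  define p where "p = 1 / \<gamma>"
  define q where "q = 1 - 1 / \<gamma>"
  have pq: "p > 0" "q > 0" "p + q = 1" using \<gamma> by (auto simp: p_def q_def)
  have k: "real k > 0" using False by simp
  have q: "q = (\<gamma> - 1) / \<gamma>" using \<gamma> by (simp add: q_def field_simps)
  have a: "(2 * real k + (\<gamma> - 1) + 1) / \<gamma> = 2 * real k * p + 1" using \<gamma> by (simp add: p_def field_simps)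
  have b: "(2 * (\<gamma> - 1) * (real k + 1) - (\<gamma> - 1) + 1) / \<gamma> = 2 * real k * q + 1" using \<gamma> by (simp add: q field_simps)
  have ga: "Gamma (2 * real k * p + 1) = (2 * real k * p) * Gamma (2 * real k * p)" using k pq by (intro Gamma_plus1) auto
  have gb: "Gamma (2 * real k * q + 1) = (2 * real k * q) * Gamma (2 * real k * q)" using k pq by (intro Gamma_plus1) auto
  have f: "fact k = real k * Gamma (real k)"
    using Gamma_fact[of k, where 'a=real] Gamma_plus1[of "real k"] k by (simp add: add_ac)
  have w: "(\<gamma> - 1) powr (- (2 * real k * q + 1)) = (\<gamma> - 1) powr (- (2 * real k * q)) / (\<gamma> - 1)"
    using \<gamma> by (simp add: powr_diff powr_minus)
  have "mode_normsq \<gamma> (\<gamma> - 1) k = (\<gamma> / 2) ^ (2 * k + 2) * ((\<gamma> - 1) powr (- (2 * real k * q)) / (\<gamma> - 1)) *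
     ((2 * real k * p) * Gamma (2 * real k * p)) * ((2 * real k * q) * Gamma (2 * real k * q)) / (real k * Gamma (real k))\<^sup>2"
    unfolding mode_normsq_def a b ga gb w f ..
  also have "\<dots> = ((\<gamma> / 2)\<^sup>2 * (4 * p * q) / (\<gamma> - 1)) * ((\<gamma> / 2) ^ (2 * k) * (\<gamma> - 1) powr (- (2 * real k * q)) * Gamma (2 * real k * p) * Gamma (2 * real k * q) / (Gamma (real k))\<^sup>2)"
    using k \<gamma> by (simp add: power_add power_mult_distrib divide_simps) (simp add: power2_eq_square)
  also have "(\<gamma> / 2)\<^sup>2 * (4 * p * q) / (\<gamma> - 1) = 1" using \<gamma> unfolding q p_def by (simp add: power2_eq_square)
  also have "(\<gamma> / 2) ^ (2 * k) * (\<gamma> - 1) powr (- (2 * real k * q)) * Gamma (2 * real k * p) * Gamma (2 * real k * q) / (Gamma (real k))\<^sup>2 = exp (log_mode p q (real k))"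
    using exp_log_mode[OF \<gamma>, of k] False unfolding q_def[symmetric] unfolding p_def[symmetric] by simp
  also have "1 * exp (log_mode p q (real k)) \<le> exp (- ln (4 * p * q))" using log_mode_le_limit[OF pq k] by simp
  also have "\<dots> = mode_normsq \<gamma> (\<gamma> - 1) 0"
    using pq \<gamma> unfolding mode_normsq_pairing_0[OF \<gamma>] by (simp add: exp_minus q p_def power2_eq_square field_simps)
  finally show ?thesis .
qed simp

section \<open>The supremum of the modes for the preferred measure\<close>

text \<open>
  The error of Stirling's formula for \<open>ln \<Gamma>(x + 1/3)\<close>, up to an additive constant. The shift \<open>1/3\<close> is the one for which
  the Gamma arguments of the preferred measure become \<open>1/3\<close> plus the multiples \<open>pm\<close>, \<open>qm\<close> and
  \<open>m/2\<close> of one number \<open>m\<close>.\<close>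
definition stirling_defect :: "real \<Rightarrow> real" where "stirling_defect x = ln_Gamma (x + 1/3) - (x - 1/6) * ln x + x"
definition stirling_defect' :: "real \<Rightarrow> real" where "stirling_defect' x = Digamma (x + 1/3) - ln x + 1 / (6 * x)"

lemma stirling_defect_deriv: "x > 0 \<Longrightarrow> (stirling_defect has_real_derivative stirling_defect' x) (at x)"
proof -
  assume x: "x > 0"
  have "(stirling_defect has_real_derivative Digamma (x + 1/3) - (1 * ln x + (x - 1/6) * (1 / x)) + 1) (at x)"
    unfolding stirling_defect_def[abs_def] using x by (auto intro!: derivative_eq_intros)
  moreover have "(x - 1/6) * (1 / x) = 1 - 1 / (6 * x)" using x by (simp add: field_simps)
  ultimately show ?thesis unfolding stirling_defect'_def by (simp add: algebra_simps)
qed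

lemma stirling_defect_supergradient:
  assumes "x > 0" "y > 0" shows "stirling_defect y - stirling_defect x \<le> stirling_defect' x * (y - x)"
proof (rule supergradient[where F''="\<lambda>x. Polygamma 1 (x + 1/3) - 1 / x - 1 / (6 * x\<^sup>2)"])
  show "(stirling_defect has_real_derivative stirling_defect' x) (at x)" if "x > 0" for x using stirling_defect_deriv[OF that] .
  show "(stirling_defect' has_real_derivative Polygamma 1 (x + 1/3) - 1 / x - 1 / (6 * x\<^sup>2)) (at x)" if "x > 0" for x
    unfolding stirling_defect'_def[abs_def] using that
    by (auto intro!: derivative_eq_intros simp: power2_eq_square)
  show "Polygamma 1 (x + 1/3) - 1 / x - 1 / (6 * x\<^sup>2) \<le> 0" if "x > 0" for x :: real using trigamma_le[OF that] by simp
qed (use assms in auto)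

text \<open>
  The unit increments of \<^const>\<open>stirling_defect\<close> are elementary functions, so their asymptotics are
  available without an asymptotic expansion of \<open>\<Gamma>\<close>.\<close>
definition stirling_step :: "real \<Rightarrow> real" where "stirling_step x = ln (x + 1/3) - (x + 5/6) * ln (x + 1) + (x - 1/6) * ln x + 1"

lemma stirling_defect_diff: "x > 0 \<Longrightarrow> stirling_defect (x + 1) - stirling_defect x = stirling_step x"
  using ln_Gamma_plus1[of "x + 1/3"] by (simp add: stirling_defect_def stirling_step_def algebra_simps)

lemma stirling_step_limits: "(stirling_step \<longlongrightarrow> 0) at_top" "((\<lambda>x. (x + 1) * stirling_step x) \<longlongrightarrow> 0) at_top"
  unfolding stirling_step_def by real_asymp+

text \<open>By concavity the derivative decreases and dominates the unit increments, which tend to 0.\<close>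
lemma stirling_defect'_nonneg:
  assumes x: "x > 0" shows "stirling_defect' x \<ge> 0"
proof (rule tendsto_upperbound[OF stirling_step_limits(1)])
  show "\<forall>\<^sub>F y in at_top. stirling_step y \<le> stirling_defect' x"
    using eventually_gt_at_top[of x]
  proof eventually_elim
    case (elim y)
    have "stirling_step y \<le> stirling_defect' y" using stirling_defect_supergradient[of y "y + 1"] stirling_defect_diff[of y] elim x by simp
    also have "stirling_defect' y \<le> stirling_defect' x"
    proof -
      have "0 \<le> (stirling_defect' x - stirling_defect' y) * (y - x)"
        using stirling_defect_supergradient[of x y] stirling_defect_supergradient[of y x] elim x by (simp add: algebra_simps)
      thus ?thesis using elim by (simp add: zero_le_mult_iff)
    qed
    finally show ?case .
  qed
qed simp

text \<open>By concavity the derivative at \<open>x\<close> is at most the increment over \<open>[x - 1, x]\<close>, which is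
  \<open>o(1/x)\<close>.\<close>
lemma stirling_defect'_small: "((\<lambda>x. x * stirling_defect' x) \<longlongrightarrow> 0) at_top"
proof (rule tendsto_sandwich)
  show "\<forall>\<^sub>F x in at_top. 0 \<le> x * stirling_defect' x"
    using eventually_gt_at_top[of 0] by eventually_elim (simp add: stirling_defect'_nonneg)
  show "\<forall>\<^sub>F x in at_top. x * stirling_defect' x \<le> ((x - 1) + 1) * stirling_step (x - 1)"
    using eventually_gt_at_top[of 1]
  proof eventually_elim
    case (elim x)
    have "stirling_defect' x \<le> stirling_step (x - 1)" using stirling_defect_supergradient[of x "x - 1"] stirling_defect_diff[of "x - 1"] elim by simp
    thus ?case using elim by simp
  qed
  show "((\<lambda>x. ((x - 1) + 1) * stirling_step (x - 1)) \<longlongrightarrow> 0) at_top"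
    by (rule filterlim_compose[OF stirling_step_limits(2)]) real_asymp
qed simp

text \<open>The mean value of the derivative over \<open>[am, cm]\<close> is \<open>o(1/m)\<close> while the length of the interval is \<open>O(m)\<close>.\<close>
lemma stirling_defect_dilation_limit:
  assumes c: "0 < a" "a \<le> c"
  shows "((\<lambda>m. stirling_defect (c * m) - stirling_defect (a * m)) \<longlongrightarrow> 0) at_top"
proof (rule tendsto_sandwich)
  show "\<forall>\<^sub>F m in at_top. 0 \<le> stirling_defect (c * m) - stirling_defect (a * m)"
    using eventually_gt_at_top[of 0]
  proof eventually_elim
    case (elim m)
    have "stirling_defect (a * m) - stirling_defect (c * m) \<le> stirling_defect' (c * m) * (a * m - c * m)" using elim c by (intro stirling_defect_supergradient) auto
    also have "\<dots> \<le> 0" using elim c stirling_defect'_nonneg[of "c * m"] by (intro mult_nonneg_nonpos) auto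
    finally show ?case by simp
  qed
  show "\<forall>\<^sub>F m in at_top. stirling_defect (c * m) - stirling_defect (a * m) \<le> (c - a) / a * ((a * m) * stirling_defect' (a * m))"
    using eventually_gt_at_top[of 0]
  proof eventually_elim
    case (elim m)
    have "stirling_defect (c * m) - stirling_defect (a * m) \<le> stirling_defect' (a * m) * (c * m - a * m)" using elim c by (intro stirling_defect_supergradient) auto
    also have "\<dots> = (c - a) / a * ((a * m) * stirling_defect' (a * m))" using c by (simp add: left_diff_distrib[symmetric])
    finally show ?case .
  qed
  have "((\<lambda>m. (a * m) * stirling_defect' (a * m)) \<longlongrightarrow> 0) at_top"
    by (rule filterlim_compose[OF stirling_defect'_small]) (use c in real_asymp)
  from tendsto_mult_left[OF this, of "(c - a) / a"]
  show "((\<lambda>m. (c - a) / a * ((a * m) * stirling_defect' (a * m))) \<longlongrightarrow> 0) at_top" by simp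
qed simp

text \<open>The Stirling main terms of the three Gamma factors combine with the explicit powers, and what is
  left of them does not depend on \<open>k\<close>.\<close>
lemma mode_normsq_preferred:
  assumes \<gamma>: "\<gamma> > 1"
  defines "p \<equiv> 1 / \<gamma>" and "q \<equiv> 1 - 1 / \<gamma>"
  defines "m \<equiv> \<lambda>k. 2 * real k + 4 / 3"
  shows "mode_normsq \<gamma> ((\<gamma> + 1) / 3) k = exp (stirling_defect (p * m k) + stirling_defect (q * m k) - 2 * stirling_defect (1/2 * m k)) * (\<gamma> / (2 * sqrt (\<gamma> - 1)))"
proof -
  have pq: "p > 0" "q > 0" "p + q = 1" using assms by (auto simp: p_def q_def)
  have q: "q = (\<gamma> - 1) / \<gamma>" using \<gamma> by (simp add: q_def field_simps)
  have lp: "ln p = - ln \<gamma>" using \<gamma> by (simp add: p_def ln_div)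
  have lq: "ln q = ln (\<gamma> - 1) - ln \<gamma>" using \<gamma> unfolding q by (simp add: ln_div)
  have lg: "ln (\<gamma> - 1) = ln q - ln p" "ln \<gamma> = - ln p" using lp lq by auto
  let ?M = "m k"
  have M: "?M > 0" by (simp add: m_def add_nonneg_pos)
  have a: "(2 * real k + (\<gamma> + 1) / 3 + 1) / \<gamma> = p * ?M + 1/3" using \<gamma> by (simp add: p_def m_def field_simps)
  have b: "(2 * (\<gamma> - 1) * (real k + 1) - (\<gamma> + 1) / 3 + 1) / \<gamma> = q * ?M + 1/3" using \<gamma> by (simp add: q m_def field_simps)
  have "1/2 * ?M + 1/3 = 1 + real k" by (simp add: m_def field_simps)
  hence f: "fact k = Gamma (1/2 * ?M + 1/3)" by (simp only: Gamma_fact)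
  have pos: "p * ?M + 1/3 > 0" "q * ?M + 1/3 > 0" "1/2 * ?M + 1/3 > 0" using pq M by (auto intro: add_pos_pos)
  have "(\<gamma> / 2) ^ (2 * k + 2) = exp (real (2 * k + 2) * ln (\<gamma> / 2))" using \<gamma> by (subst exp_of_nat_mult) auto
  also have "real (2 * k + 2) = ?M + 2/3" by (simp add: m_def)
  finally have g: "(\<gamma> / 2) ^ (2 * k + 2) = exp ((?M + 2/3) * ln (\<gamma> / 2))" .
  have "mode_normsq \<gamma> ((\<gamma> + 1) / 3) k = exp ((?M + 2/3) * ln (\<gamma> / 2)) * exp (- (q * ?M + 1/3) * ln (\<gamma> - 1)) *
     exp (ln_Gamma (p * ?M + 1/3)) * exp (ln_Gamma (q * ?M + 1/3)) / (exp (ln_Gamma (1/2 * ?M + 1/3)))\<^sup>2"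
    unfolding mode_normsq_def a b f g using \<gamma> Gamma_real_pos_exp[OF pos(1)] Gamma_real_pos_exp[OF pos(2)] Gamma_real_pos_exp[OF pos(3)] by (simp add: powr_def)
  also have "\<dots> = exp ((?M + 2/3) * ln (\<gamma> / 2) - (q * ?M + 1/3) * ln (\<gamma> - 1) + ln_Gamma (p * ?M + 1/3) + ln_Gamma (q * ?M + 1/3) - 2 * ln_Gamma (1/2 * ?M + 1/3))"
    by (simp add: exp_add[symmetric] exp_diff[symmetric] power2_eq_square) (simp add: algebra_simps)
  also have "(?M + 2/3) * ln (\<gamma> / 2) - (q * ?M + 1/3) * ln (\<gamma> - 1) + ln_Gamma (p * ?M + 1/3) + ln_Gamma (q * ?M + 1/3) - 2 * ln_Gamma (1/2 * ?M + 1/3)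
     = (stirling_defect (p * ?M) + stirling_defect (q * ?M) - 2 * stirling_defect (1/2 * ?M)) + (- ln 2 - ln p / 2 - ln q / 2)"
  proof -
    have l: "ln (p * ?M) = ln p + ln ?M" "ln (q * ?M) = ln q + ln ?M" "ln (1/2 * ?M) = ln ?M - ln 2" "ln (\<gamma> / 2) = - ln p - ln 2"
      using pq M \<gamma> lg by (auto simp: ln_mult ln_div)
    \<comment> \<open>Written with free variables for the logarithms and the Gamma values, this is a polynomial identity once \<open>p = 1 - q\<close> is substituted.\<close>
    have gen: "(M + 2/3) * (- P - L) - (q * M + 1/3) * (Q - P) + A + B - 2 * C =
        ((A - (p * M - 1/6) * (P + N) + p * M) + (B - (q * M - 1/6) * (Q + N) + q * M) - 2 * (C - (1/2 * M - 1/6) * (N - L) + 1/2 * M)) + (- L - P / 2 - Q / 2)"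
      for A B C L M N P Q :: real
    proof -
      have p: "p = 1 - q" using pq by simp
      show ?thesis unfolding p by (simp add: algebra_simps) (simp add: field_simps)
    qed
    show ?thesis unfolding stirling_defect_def l lg(1) by (rule gen)
  qed
  also have "exp (\<dots>) = exp (stirling_defect (p * ?M) + stirling_defect (q * ?M) - 2 * stirling_defect (1/2 * ?M)) * exp (- ln 2 - ln p / 2 - ln q / 2)" by (rule exp_add)
  also have "exp (- ln 2 - ln p / 2 - ln q / 2) = \<gamma> / (2 * sqrt (\<gamma> - 1))"
  proof -
    have "- ln 2 - ln p / 2 - ln q / 2 = ln (\<gamma> / (2 * sqrt (\<gamma> - 1)))"
      using \<gamma> unfolding lp lq by (simp add: ln_div ln_mult ln_sqrt field_simps)
    thus ?thesis using \<gamma> by simp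
  qed
  finally show ?thesis .
qed

text \<open>Since \<open>p + q = 1\<close>, the points \<open>pm\<close> and \<open>qm\<close> have midpoint \<open>m/2\<close>, and concavity applies.\<close>
lemma mode_normsq_preferred_le:
  assumes \<gamma>: "\<gamma> > 1" shows "mode_normsq \<gamma> ((\<gamma> + 1) / 3) k \<le> \<gamma> / (2 * sqrt (\<gamma> - 1))"
proof -
  define p where "p = 1 / \<gamma>"
  define q where "q = 1 - 1 / \<gamma>"
  define m where "m = 2 * real k + 4 / 3"
  have pq: "p > 0" "q > 0" "p + q = 1" and m: "m > 0" using assms by (auto simp: p_def q_def m_def add_nonneg_pos)
  have "stirling_defect (p * m) - stirling_defect (1/2 * m) \<le> stirling_defect' (1/2 * m) * (p * m - 1/2 * m)" using pq m by (intro stirling_defect_supergradient) auto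
  moreover have "stirling_defect (q * m) - stirling_defect (1/2 * m) \<le> stirling_defect' (1/2 * m) * (q * m - 1/2 * m)" using pq m by (intro stirling_defect_supergradient) auto
  moreover have "stirling_defect' (1/2 * m) * (p * m - 1/2 * m) + stirling_defect' (1/2 * m) * (q * m - 1/2 * m) = 0"
    using pq(3) by algebra
  ultimately have "stirling_defect (p * m) + stirling_defect (q * m) - 2 * stirling_defect (1/2 * m) \<le> 0" by linarith
  hence "exp (stirling_defect (p * m) + stirling_defect (q * m) - 2 * stirling_defect (1/2 * m)) * (\<gamma> / (2 * sqrt (\<gamma> - 1))) \<le> 1 * (\<gamma> / (2 * sqrt (\<gamma> - 1)))"
    using \<gamma> by (intro mult_right_mono) auto
  thus ?thesis unfolding mode_normsq_preferred[OF \<gamma>] p_def q_def m_def by simp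
qed

lemma mode_normsq_preferred_limit:
  assumes \<gamma>: "\<gamma> > 1" shows "(\<lambda>k. mode_normsq \<gamma> ((\<gamma> + 1) / 3) k) \<longlonglongrightarrow> \<gamma> / (2 * sqrt (\<gamma> - 1))"
proof -
  define p where "p = 1 / \<gamma>"
  define q where "q = 1 - 1 / \<gamma>"
  \<comment> \<open>All three arguments are compared with the common point \<open>am\<close>, below each of them.\<close>
  define a where "a = min p q"
  let ?m = "\<lambda>k. 2 * real k + 4 / 3"
  have pq: "p > 0" "q > 0" "p + q = 1" using assms by (auto simp: p_def q_def)
  have a: "0 < a" "a \<le> p" "a \<le> q" "a \<le> 1/2" using pq by (auto simp: a_def)
  have mt: "filterlim ?m at_top sequentially" by real_asymp
  have "(\<lambda>k. stirling_defect (c * ?m k) - stirling_defect (a * ?m k)) \<longlonglongrightarrow> 0" if "a \<le> c" for c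
    by (rule filterlim_compose[OF stirling_defect_dilation_limit[OF a(1) that] mt])
  from tendsto_diff[OF tendsto_add[OF this[OF a(2)] this[OF a(3)]] tendsto_mult_left[OF this[OF a(4)], of 2]]
  have "(\<lambda>k. stirling_defect (p * ?m k) + stirling_defect (q * ?m k) - 2 * stirling_defect (1/2 * ?m k)) \<longlonglongrightarrow> 0" by (simp add: algebra_simps)
  hence "(\<lambda>k. exp (stirling_defect (p * ?m k) + stirling_defect (q * ?m k) - 2 * stirling_defect (1/2 * ?m k)) * (\<gamma> / (2 * sqrt (\<gamma> - 1)))) \<longlonglongrightarrow> exp 0 * (\<gamma> / (2 * sqrt (\<gamma> - 1)))"
    by (intro tendsto_intros)
  thus ?thesis unfolding mode_normsq_preferred[OF \<gamma>] p_def q_def by simp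
qed

section \<open>The operator norms\<close>

theorem theorem1p6:
  fixes \<gamma> :: real
  assumes "\<gamma> > 1"
  shows
    "(\<gamma> = 2 \<longrightarrow>
       (\<forall>d \<in> {-1<..<1} \<union> {1<..<3}.
          leray_opnorm \<gamma> (mu \<gamma> d) = ennreal (sqrt (pi / 2 * (1 - d) * (1 / cos (d * pi / 2))))) \<and>
       leray_opnorm \<gamma> (mu \<gamma> 1) = ennreal 1) \<and>
     (\<gamma> \<in> {1<..<2} \<union> {2<..} \<longrightarrow>
       leray_opnorm \<gamma> (mu \<gamma> 1) =
         ennreal ((\<gamma> - 1) powr (1 / \<gamma> - 1) *
                  sqrt (pi / 4 * (\<gamma> - 2) * \<gamma> * (1 / sin (2 * pi / \<gamma>))))) \<and>
     (\<gamma> = 2 \<longrightarrow> leray_opnorm \<gamma> (mu \<gamma> 1) = ennreal 1) \<and>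
     leray_opnorm \<gamma> (pairing_measure \<gamma>) = ennreal (\<gamma> / (2 * sqrt (\<gamma> - 1))) \<and>
     leray_opnorm \<gamma> (preferred_measure \<gamma>) = ennreal (sqrt (\<gamma> / (2 * sqrt (\<gamma> - 1))))"
proof (intro conjI impI ballI)
  have two: "leray_opnorm 2 (mu 2 1) = ennreal 1"
    using leray_opnorm_max[of 2 1] by (simp add: mode_normsq_2_1)
  show "leray_opnorm \<gamma> (mu \<gamma> 1) = ennreal 1" if "\<gamma> = 2" using two that by simp
  show "leray_opnorm \<gamma> (mu \<gamma> 1) = ennreal 1" if "\<gamma> = 2" using two that by simp
  show "leray_opnorm \<gamma> (mu \<gamma> d) = ennreal (sqrt (pi / 2 * (1 - d) * (1 / cos (d * pi / 2))))"
    if g: "\<gamma> = 2" and "d \<in> {-1<..<1} \<union> {1<..<3}" for d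
  proof -
    from that have d: "-1 < d" "d < 3" "d \<noteq> 1" by auto
    have "leray_opnorm 2 (mu 2 d) = ennreal (sqrt (mode_normsq 2 d 0))"
      by (rule leray_opnorm_max) (use d mode_normsq_2_le in auto)
    thus ?thesis unfolding g mode_normsq_2_0[OF d] .
  qed
  show "leray_opnorm \<gamma> (mu \<gamma> 1) = ennreal ((\<gamma> - 1) powr (1 / \<gamma> - 1) * sqrt (pi / 4 * (\<gamma> - 2) * \<gamma> * (1 / sin (2 * pi / \<gamma>))))"
    if "\<gamma> \<in> {1<..<2} \<union> {2<..}"
  proof -
    have "leray_opnorm \<gamma> (mu \<gamma> 1) = ennreal (sqrt (mode_normsq \<gamma> 1 0))"
      by (rule leray_opnorm_max) (use assms mode_normsq_1_le in auto)
    thus ?thesis using mode_normsq_1_0[OF assms] that by auto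
  qed
  show "leray_opnorm \<gamma> (pairing_measure \<gamma>) = ennreal (\<gamma> / (2 * sqrt (\<gamma> - 1)))"
  proof -
    have "leray_opnorm \<gamma> (pairing_measure \<gamma>) = ennreal (sqrt (mode_normsq \<gamma> (\<gamma> - 1) 0))"
      unfolding pairing_measure_def by (rule leray_opnorm_max) (use assms mode_normsq_pairing_le in auto)
    moreover have "sqrt (4 * (\<gamma> - 1)) = 2 * sqrt (\<gamma> - 1)" by (simp only: real_sqrt_mult real_sqrt_four)
    hence "sqrt (\<gamma>\<^sup>2 / (4 * (\<gamma> - 1))) = \<gamma> / (2 * sqrt (\<gamma> - 1))" using assms by (simp only: real_sqrt_divide) simp
    ultimately show ?thesis unfolding mode_normsq_pairing_0[OF assms] by simp
  qed
  show "leray_opnorm \<gamma> (preferred_measure \<gamma>) = ennreal (sqrt (\<gamma> / (2 * sqrt (\<gamma> - 1))))"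
    unfolding preferred_measure_def
  proof (rule leray_opnorm_eq[OF assms])
    show "\<exists>k. e < mode_normsq \<gamma> ((\<gamma> + 1) / 3) k" if "e < \<gamma> / (2 * sqrt (\<gamma> - 1))" for e
      using order_tendstoD(1)[OF mode_normsq_preferred_limit[OF assms] that] eventually_happens'[OF sequentially_bot] by blast
  qed (use assms mode_normsq_preferred_le in auto)
qed

end
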